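(* Let $\mathbb F$ be a finite field and let $\mathcal M$ be a matrix class over $\mathbb F$. Then $\mathcal M$ has bounded twin-width if and only if there exists a matrix over $\mathbb F$ that is not a linear minor of any matrix in $\mathcal M$.
   Context: A matrix $M$ over a finite alphabet $A$ with (totally ordered) row index set $R$ and column index set $C$ is identified with the ordered binary structure with domain $R\uplus C$, a unary relation interpreted as $R$, a binary relation $<$ that is a total order on $R\uplus C$ extending the orders of rows and of columns with all rows preceding all columns, and for each $a\in A$ a binary relation $E_a$ containing exactly the pairs $(r,c)$ with $r\in R$, $c\in C$, $M[r,c]=a$. Twin-width of a binary structure with domain $U$: a contraction sequence is a sequence of partitions $\mathcal P_{|U|},\dots,\mathcal P_1$ of $U$, where $\mathcal P_{|U|}$ consists of singletons, $\mathcal P_1=\{U\}$, and each $\mathcal P_{i-1}$ is obtained from $\mathcal P_i$ by merging two parts. Two distinct parts $X,Y$ of a partition are red-adjacent if there are $u,u'\in X$, $v,v'\in Y$ such that the atomic type of $(u,v)$ differs from that of $(u',v')$, where the atomic type of $(u,v)$ records which unary relations contain $u$, which contain $v$, which binary relations contain $(u,v)$ and which contain $(v,u)$. A $d$-sequence is a contraction sequence in which every part of every $\mathcal P_i$ is red-adjacent to at most $d$ other parts of $\mathcal P_i$; the twin-width of the structure is the least $d$ for which a $d$-sequence exists. A set of matrices has bounded twin-width if the twin-widths of its members are bounded by a constant. A matrix class is a set of matrices closed under taking submatrices (deleting rows and/or columns). A weighted sum operation on a matrix over $\mathbb F$ replaces two consecutive rows $r_i,r_{i+1}$ by the single row $\alpha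 r_i+\beta r_{i+1}$ (at the position of $r_i$, with $r_{i+1}$ removed), for some $\alpha,\beta\in\mathbb F$, or does the same with two consecutive columns. A matrix $N$ is a linear minor of $M$ if $N$ can be obtained from $M$ by a finite (possibly empty) sequence of weighted sum operations. *)

theory Defs
  imports
    "HOL-Library.Disjoint_Sets"
    "Jordan_Normal_Form.Matrix"
    "Jordan_Normal_Form.DL_Submatrix"
begin

section \<open>Twin-width of binary structures\<close>

record ('u, 'p, 'r) binary_structure =
  domain :: "'u set"
  unary :: "'p \<Rightarrow> 'u set"
  binary :: "'r \<Rightarrow> ('u \<times> 'u) set"

definition atomic_type ::
  "('u, 'p, 'r) binary_structure \<Rightarrow> 'u \<Rightarrow> 'u \<Rightarrow> 'p set \<times> 'p set \<times> 'r set \<times> 'r set" where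
  "atomic_type S u v =
     ({p. u \<in> unary S p}, {p. v \<in> unary S p}, {r. (u, v) \<in> binary S r}, {r. (v, u) \<in> binary S r})"

definition red_adjacent :: "('u, 'p, 'r) binary_structure \<Rightarrow> 'u set \<Rightarrow> 'u set \<Rightarrow> bool" where
  "red_adjacent S X Y \<longleftrightarrow>
     X \<noteq> Y \<and> (\<exists>u\<in>X. \<exists>u'\<in>X. \<exists>v\<in>Y. \<exists>v'\<in>Y. atomic_type S u v \<noteq> atomic_type S u' v')"

text \<open>
  Only the values \<open>P i\<close> with \<open>1 \<le> i \<le> card U\<close> matter when \<open>U\<close> is nonempty. For \<open>U = {}\<close> the
  conditions reduce to \<open>P 0 = {}\<close> and \<open>P 1 = {{}}\<close>, which makes the twin-width of the empty
  structure \<open>0\<close>.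
\<close>

definition contraction_sequence :: "'u set \<Rightarrow> (nat \<Rightarrow> 'u set set) \<Rightarrow> bool" where
  "contraction_sequence U P \<longleftrightarrow>
     (\<forall>i\<in>{1..card U}. partition_on U (P i)) \<and>
     P (card U) = (\<lambda>u. {u}) ` U \<and>
     P 1 = {U} \<and>
     (\<forall>i\<in>{2..card U}. \<exists>X\<in>P i. \<exists>Y\<in>P i. X \<noteq> Y \<and> P (i - 1) = insert (X \<union> Y) (P i - {X, Y}))"

definition d_sequence ::
  "('u, 'p, 'r) binary_structure \<Rightarrow> nat \<Rightarrow> (nat \<Rightarrow> 'u set set) \<Rightarrow> bool" where
  "d_sequence S d P \<longleftrightarrow>
     contraction_sequence (domain S) P \<and>
     (\<forall>i\<in>{1..card (domain S)}. \<forall>X\<in>P i. card {Y \<in> P i. red_adjacent S X Y} \<le> d)"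

text \<open>
  This is meant for structures with a finite domain; for these the minimum exists, see
  \<open>twin_width_attained\<close> below.
\<close>

definition twin_width :: "('u, 'p, 'r) binary_structure \<Rightarrow> nat" where
  "twin_width S = (LEAST d. \<exists>P. d_sequence S d P)"

lemma contraction_sequence_exists:
  assumes "finite U"
  shows "\<exists>P. contraction_sequence U P"
proof -
  obtain xs where xs: "set xs = U" "distinct xs"
    using finite_distinct_list[OF assms] by blast
  have len: "card U = length xs"
    using xs distinct_card by fastforce
  define Q where "Q i = insert (set (drop (i - 1) xs)) ((\<lambda>u. {u}) ` set (take (i - 1) xs))" for i
  define P where "P i = (if i = 0 then {} else Q i)" for i
  have part: "partition_on U (P i)" if "i \<in> {1..card U}" for i
  proof -
    have "set (take (i - 1) xs) \<inter> set (drop (i - 1) xs) = {}"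
      using xs(2) by (simp add: set_take_disj_set_drop_if_distinct)
    moreover have "set (take (i - 1) xs) \<union> set (drop (i - 1) xs) = U"
      using xs(1) set_append[of "take (i - 1) xs" "drop (i - 1) xs"] by simp
    moreover have "set (drop (i - 1) xs) \<noteq> {}"
      using that len by auto
    ultimately have "partition_on U (Q i)"
      unfolding partition_on_def Q_def by (auto simp: disjoint_def)
    then show ?thesis
      using that by (simp add: P_def)
  qed
  have first: "P (card U) = (\<lambda>u. {u}) ` U"
  proof (cases xs rule: rev_cases)
    case Nil
    then show ?thesis using len xs by (auto simp: P_def)
  next
    case (snoc ys y)
    then show ?thesis using len xs by (auto simp: P_def Q_def)
  qed
  have last: "P 1 = {U}"
    using xs by (auto simp: P_def Q_def)
  have step: "\<exists>X\<in>P i. \<exists>Y\<in>P i. X \<noteq> Y \<and> P (i - 1) = insert (X \<union> Y) (P i - {X, Y})"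
    if i: "i \<in> {2..card U}" for i
  proof -
    obtain j where j: "i = Suc (Suc j)" "Suc j < length xs"
    proof (rule that)
      show "i = Suc (Suc (i - 2))" "Suc (i - 2) < length xs"
        using i len by (simp_all, linarith+)
    qed
    define A where "A = take j xs"
    define B where "B = drop (Suc j) xs"
    have dr: "drop j xs = xs ! j # B"
      using j by (simp add: B_def Cons_nth_drop_Suc)
    have tk: "take (Suc j) xs = A @ [xs ! j]"
      using j by (simp add: A_def take_Suc_conv_app_nth)
    have "A @ xs ! j # B = xs"
      using append_take_drop_id[of j xs] unfolding A_def dr .
    then have "distinct (A @ xs ! j # B)"
      using xs(2) by (simp only:)
    then have dist: "xs ! j \<notin> set A" "xs ! j \<notin> set B" "set A \<inter> set B = {}"
      by auto
    have "B \<noteq> []"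
      using j by (simp add: B_def)
    have Pi: "P i = insert (set B) (insert {xs ! j} ((\<lambda>u. {u}) ` set A))"
      using tk by (auto simp: P_def Q_def j(1) B_def)
    have Pi1: "P (i - 1) = insert (insert (xs ! j) (set B)) ((\<lambda>u. {u}) ` set A)"
      using dr by (simp add: P_def Q_def j(1) A_def)
    have "set B \<noteq> {xs ! j}"
      using dist by auto
    moreover have "set B \<notin> (\<lambda>u. {u}) ` set A"
      using dist by auto
    moreover have "{xs ! j} \<notin> (\<lambda>u. {u}) ` set A"
      using dist by auto
    ultimately have "{xs ! j} \<noteq> set B \<and> P (i - 1) = insert ({xs ! j} \<union> set B) (P i - {{xs ! j}, set B})"
      unfolding Pi Pi1 by (simp add: insert_Diff_if)
    moreover have "{xs ! j} \<in> P i" "set B \<in> P i"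
      unfolding Pi by simp_all
    ultimately show ?thesis
      by (intro bexI[of _ "{xs ! j}"] bexI[of _ "set B"])
  qed
  show ?thesis
    unfolding contraction_sequence_def using part first last step
    by (intro exI[of _ P] conjI ballI)
qed

lemma twin_width_attained:
  assumes "finite (domain S)"
  shows "\<exists>P. d_sequence S (twin_width S) P"
proof -
  from contraction_sequence_exists[OF assms] obtain P where P: "contraction_sequence (domain S) P" ..
  have "card {Y \<in> P i. red_adjacent S X Y} \<le> card (Pow (domain S))"
    if "i \<in> {1..card (domain S)}" for i X
  proof -
    have "partition_on (domain S) (P i)"
      using P that by (simp add: contraction_sequence_def)
    then have "P i \<subseteq> Pow (domain S)"
      unfolding partition_on_def by blast
    then have "{Y \<in> P i. red_adjacent S X Y} \<subseteq> Pow (domain S)"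
      by blast
    then show ?thesis
      using assms by (simp only: card_mono finite_Pow_iff)
  qed
  then have "d_sequence S (card (Pow (domain S))) P"
    using P by (simp add: d_sequence_def)
  then have "\<exists>P. d_sequence S (card (Pow (domain S))) P"
    by (intro exI[of _ P])
  then show ?thesis
    unfolding twin_width_def by (rule LeastI[where P = "\<lambda>d. \<exists>P. d_sequence S d P"])
qed

section \<open>Matrices as ordered binary structures\<close>

datatype 'a matrix_relation = Less | Entry 'a

text \<open>
  Row \<open>i\<close> is represented by \<open>Inl i\<close> and column \<open>j\<close> by \<open>Inr j\<close>. The only unary relation is the set
  of rows, so its index type is \<^typ>\<open>unit\<close>.
\<close>

definition matrix_structure :: "'a mat \<Rightarrow> (nat + nat, unit, 'a matrix_relation) binary_structure" where
  "matrix_structure M =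
     \<lparr> domain = {..<dim_row M} <+> {..<dim_col M},
       unary = (\<lambda>_. Inl ` {..<dim_row M}),
       binary = (\<lambda>r. case r of
           Less \<Rightarrow> {(Inl i, Inl i') | i i'. i < i' \<and> i' < dim_row M}
             \<union> {(Inr j, Inr j') | j j'. j < j' \<and> j' < dim_col M}
             \<union> {(Inl i, Inr j) | i j. i < dim_row M \<and> j < dim_col M}
         | Entry a \<Rightarrow> {(Inl i, Inr j) | i j. i < dim_row M \<and> j < dim_col M \<and> M $$ (i, j) = a}) \<rparr>"

definition bounded_twin_width :: "'a mat set \<Rightarrow> bool" where
  "bounded_twin_width \<M> \<longleftrightarrow> (\<exists>d. \<forall>M\<in>\<M>. twin_width (matrix_structure M) \<le> d)"

text \<open>
  In \<^term>\<open>submatrix M I J\<close> the sets \<open>I\<close> and \<open>J\<close> are those of the rows and columns that are kept;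
  indices beyond the dimensions of \<open>M\<close> are ignored.
\<close>

definition matrix_class :: "'a mat set \<Rightarrow> bool" where
  "matrix_class \<M> \<longleftrightarrow> (\<forall>M\<in>\<M>. \<forall>I J. submatrix M I J \<in> \<M>)"

section \<open>Linear minors\<close>

definition sum_rows :: "'a::semiring_1 \<Rightarrow> 'a \<Rightarrow> nat \<Rightarrow> 'a mat \<Rightarrow> 'a mat" where
  "sum_rows \<alpha> \<beta> i M = mat (dim_row M - 1) (dim_col M) (\<lambda>(k, j).
     if k < i then M $$ (k, j)
     else if k = i then \<alpha> * M $$ (i, j) + \<beta> * M $$ (Suc i, j)
     else M $$ (Suc k, j))"

definition sum_cols :: "'a::semiring_1 \<Rightarrow> 'a \<Rightarrow> nat \<Rightarrow> 'a mat \<Rightarrow> 'a mat" where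
  "sum_cols \<alpha> \<beta> j M = mat (dim_row M) (dim_col M - 1) (\<lambda>(i, k).
     if k < j then M $$ (i, k)
     else if k = j then \<alpha> * M $$ (i, j) + \<beta> * M $$ (i, Suc j)
     else M $$ (i, Suc k))"

inductive weighted_sum_operation :: "'a::semiring_1 mat \<Rightarrow> 'a mat \<Rightarrow> bool" where
  rows: "Suc i < dim_row M \<Longrightarrow> weighted_sum_operation M (sum_rows \<alpha> \<beta> i M)"
| cols: "Suc j < dim_col M \<Longrightarrow> weighted_sum_operation M (sum_cols \<alpha> \<beta> j M)"

definition linear_minor :: "'a::semiring_1 mat \<Rightarrow> 'a mat \<Rightarrow> bool" where
  "linear_minor N M \<longleftrightarrow> weighted_sum_operation\<^sup>*\<^sup>* M N"

end

theory Submission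
  imports Defs "HOL-Library.Cardinality" "HOL-Library.FuncSet"
begin

text \<open>
  Linear minors of \<open>M\<close> are the matrices obtained by dividing rows and columns of \<open>M\<close> into intervals
  and replacing every zone \<open>Z\<close> of the division by a number \<open>u\<^sup>T Z v\<close>, where \<open>u\<close> depends only on the
  row part and \<open>v\<close> only on the column part.

  If the twin-width is at most \<open>d\<close>, take a division of \<open>M\<close> into many parts and the first moment of a
  \<open>d\<close>-sequence when some part surrounds a whole part of the division, say a set \<open>R\<close> of rows. All
  parts meeting \<open>R\<close> are then red-adjacent to it because of the order, so \<open>R\<close> is covered by \<open>d + 1\<close>
  parts, few column parts are red to these, and on some zone \<open>R \<times> C\<close> there are at most \<open>d + 1\<close>
  distinct rows. Hence a block matrix all of whose blocks are large identity matrices is not a linear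
  minor.

  Conversely, call a zone complex if it has many distinct columns. Merge consecutive parts of the
  finest division greedily, subject to the condition that no part crosses a long sequence of
  disjoint intervals of parts with which it forms complex zones. If this gets stuck, then a
  Marcus--Tardos theorem for intervals instead of points yields a \<open>p \<times> p\<close> division all of whose zones
  are complex; for a random \<open>v\<close> the vectors \<open>Z v\<close>, for the zones \<open>Z\<close> of one row part, are then linearly
  independent, so \<open>u\<close> can be chosen to produce any \<open>p \<times> p\<close> matrix. Otherwise the greedy process ends
  in the trivial division, and splitting the parts of its divisions according to the entries outside
  the complex zones gives partitions of bounded red degree.
\<close>

section \<open>A Marcus--Tardos theorem for interval families\<close>

text \<open>The greedy invariant must bound two numbers for each row part: its complex zones, and
  its distinct rows once these zones are ignored. Few complex zones alone do not bound the second,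
  because many simple zones together can separate arbitrarily many rows. Without a chain of g
  complex intervals, however, the simple column parts are covered by at most 2g simple intervals,
  which leaves at most \<open>L ^ (2 * g)\<close> distinct rows if a simple zone has at most L. This
  is why the extremal theorem is about intervals. The constants: C is the extremal constant for p,
  and \<open>g = Suc (3 * C)\<close>; over a field with q elements a part has at most K = (q^Q)^(2g)
  classes, each of red degree at most K + gK, and one greedy step unites two parts, so a new class
  consists of at most 2K old ones. The threshold Q exceeds p q^p, which lets a union bound over p
  row parts and q^p coefficient vectors find v. In the other direction the order is indispensable:
  without it, a part could contain rows far apart and still be homogeneous to every part in
  between.\<close>

definition interval_family :: "nat \<Rightarrow> nat \<Rightarrow> (nat \<times> nat \<times> nat) set \<Rightarrow> bool" where
  "interval_family s t T \<longleftrightarrow>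
     (\<forall>(i, x, y)\<in>T. i < s \<and> x < y \<and> y \<le> t) \<and>
     (\<forall>i x y x' y'. (i, x, y) \<in> T \<and> (i, x', y') \<in> T \<longrightarrow> (x, y) = (x', y') \<or> y \<le> x' \<or> y' \<le> x)"

abbreviation has_interval :: "(nat \<times> nat \<times> nat) set \<Rightarrow> nat \<Rightarrow> nat \<Rightarrow> nat \<Rightarrow> nat \<Rightarrow> bool" where
  "has_interval T a a' b b' \<equiv> \<exists>i x y. (i, x, y) \<in> T \<and> a \<le> i \<and> i < a' \<and> b \<le> x \<and> y \<le> b'"

abbreviation pairwise_apart :: "(nat \<times> nat) set \<Rightarrow> bool" where
  "pairwise_apart E \<equiv> \<forall>x y x' y'. (x, y) \<in> E \<and> (x', y') \<in> E \<longrightarrow> (x, y) = (x', y') \<or> y \<le> x' \<or> y' \<le> x"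

text \<open>A triple (i, x, y) stands for the columns x, ..., y - 1 of row i; point patterns are the
  case y = x + 1. In an interval family the cuts \<open>a\<close> and \<open>b\<close> increase by
  themselves, because every cell contains a nonempty interval.\<close>

definition interval_grid :: "nat \<Rightarrow> (nat \<times> nat \<times> nat) set \<Rightarrow> bool" where
  "interval_grid p T \<longleftrightarrow> (\<exists>a b. \<forall>k<p. \<forall>l<p. has_interval T (a k) (a (Suc k)) (b l) (b (Suc l)))"

lemma interval_gridE:
  assumes "interval_grid p T"
  obtains a b where "\<forall>k<p. \<forall>l<p.
    has_interval T (a k) (a (Suc k)) (b l) (b (Suc l))"
  using assms unfolding interval_grid_def by (elim exE)

lemma interval_gridI:
  assumes "\<And>k l. k < p \<Longrightarrow> l < p \<Longrightarrow>
    has_interval T (a k) (a (Suc k)) (b l) (b (Suc l))"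
  shows "interval_grid p T"
  unfolding interval_grid_def by (rule exI[of _ a], rule exI[of _ b]) (simp add: assms)

lemma interval_grid_mono: "interval_grid p T \<Longrightarrow> T \<subseteq> T' \<Longrightarrow> interval_grid p T'"
  unfolding interval_grid_def by (meson subsetD)

lemma interval_familyD:
  assumes "interval_family s t T" "(i, x, y) \<in> T"
  shows "i < s" "x < y" "y \<le> t"
  using assms unfolding interval_family_def by auto

lemma interval_family_disjoint:
  assumes "interval_family s t T" "(i, x, y) \<in> T" "(i, x', y') \<in> T"
  shows "(x, y) = (x', y') \<or> y \<le> x' \<or> y' \<le> x"
  using assms unfolding interval_family_def by blast

lemma finite_interval_family: "interval_family s t T \<Longrightarrow> finite T"
  unfolding interval_family_def
  by (rule finite_subset[of _ "{..<s} \<times> {..t} \<times> {..t}"]) (auto dest!: bspec intro: less_imp_le le_trans)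

lemma interval_family_subset: "interval_family s t T \<Longrightarrow> F \<subseteq> T \<Longrightarrow> interval_family s t F"
  unfolding interval_family_def by blast

text \<open>The pigeonhole arguments below produce grids of this shape: single rows
  \<open>r k\<close> against successive column segments from \<open>c l\<close> to
  \<open>e l\<close>.\<close>

lemma interval_grid_of_segments:
  assumes cell: "\<And>k l. k < p \<Longrightarrow> l < p \<Longrightarrow> \<exists>x y. (r k, x, y) \<in> T \<and> c l \<le> x \<and> y \<le> e l"
    and r: "\<And>k. Suc k < p \<Longrightarrow> r k < r (Suc k)"
    and c: "\<And>l. Suc l < p \<Longrightarrow> e l \<le> c (Suc l)"
  shows "interval_grid p T"
proof -
  \<comment> \<open>Each cut lies just before a chosen row or segment; only the cut with index p,
    behind the last one, needs a value of its own.\<close>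
  define a where "a k = (if k < p then r k else Suc (r (p - 1)))" for k
  define b where "b k = (if k < p then c k else e (p - 1))" for k
  have a: "a k \<le> r k" "r k < a (Suc k)" if "k < p" for k
  proof -
    show "a k \<le> r k" using that by (simp add: a_def)
    show "r k < a (Suc k)"
    proof (cases "Suc k < p")
      case True then show ?thesis using r by (simp add: a_def)
    next
      case False then have "k = p - 1" using that by simp
      then show ?thesis using False by (simp add: a_def)
    qed
  qed
  have b: "b k \<le> c k" "e k \<le> b (Suc k)" if "k < p" for k
  proof -
    show "b k \<le> c k" using that by (simp add: b_def)
    show "e k \<le> b (Suc k)"
    proof (cases "Suc k < p")
      case True then show ?thesis using c by (simp add: b_def)
    next
      case False then have "k = p - 1" using that by simp
      then show ?thesis using False by (simp add: b_def)
    qed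
  qed
  have "has_interval T (a k) (a (Suc k)) (b l) (b (Suc l))"
    if kl: "k < p" "l < p" for k l
  proof -
    obtain x y where "(r k, x, y) \<in> T" "c l \<le> x" "y \<le> e l" using cell[OF kl] by blast
    then show ?thesis using a[OF kl(1)] b[OF kl(2)] le_trans by blast
  qed
  then show ?thesis by (rule interval_gridI)
qed

section \<open>Selection, pigeonhole and parity of ranks\<close>

lemma obtain_increasing:
  fixes W :: "nat set"
  assumes "finite W" "p \<le> card W"
  obtains f where "\<And>k. k < p \<Longrightarrow> f k \<in> W" "\<And>k l. k < l \<Longrightarrow> l < p \<Longrightarrow> f k < f l"
proof
  let ?xs = "sorted_list_of_set W"
  have len: "length ?xs = card W" using assms(1) by simp
  show "?xs ! k \<in> W" if "k < p" for k
    using that assms len by (metis nth_mem order_less_le_trans set_sorted_list_of_set)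
  show "?xs ! k < ?xs ! l" if "k < l" "l < p" for k l
    using that assms(2) len strict_sorted_list_of_set[of W] by (simp add: sorted_wrt_nth_less)
qed

lemma pigeonhole_fibre:
  fixes p :: nat
  assumes "finite A" "finite V" "f ` A \<subseteq> V" "(p - 1) * card V < card A"
  shows "\<exists>v\<in>V. p \<le> card {a \<in> A. f a = v}"
proof (rule ccontr)
  assume "\<not> ?thesis"
  then have less: "card {a \<in> A. f a = v} \<le> p - 1" if "v \<in> V" for v using that by force
  have "(\<Union>v\<in>V. {a \<in> A. f a = v}) = A" using assms(3) by auto
  then have "card A \<le> (\<Sum>v\<in>V. card {a \<in> A. f a = v})"
    using card_UN_le[OF assms(2), of "\<lambda>v. {a \<in> A. f a = v}"] by simp
  also have "\<dots> \<le> (\<Sum>v\<in>V. p - 1)" using less by (rule sum_mono)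
  finally show False using assms(4) by (simp add: mult.commute)
qed

text \<open>The element in between is what stops an interval: one that starts in block
  \<open>x\<close> cannot pass the interval starting in block \<open>z\<close>, so it ends before
  block \<open>x'\<close> begins. Joining a block to the very next nonempty one would not guarantee
  this.\<close>

lemma rank_parity_between:
  fixes X :: "nat set"
  assumes X: "finite X" "x \<in> X" "x' \<in> X" "x < x'"
    and par: "even (card {z \<in> X. z < x}) = even (card {z \<in> X. z < x'})"
  shows "\<exists>z\<in>X. x < z \<and> z < x'"
proof (rule ccontr)
  assume "\<not> ?thesis"
  then have "{z \<in> X. z < x'} = insert x {z \<in> X. z < x}" using X by force
  then have "card {z \<in> X. z < x'} = Suc (card {z \<in> X. z < x})" using X by simp
  then show False using par by simp
qed

text \<open>
  A contracted row contains the blocks in which intervals start. Every second of them is joined to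
  the next one of the same parity, so that the joined blocks cover the intervals starting there.
\<close>

lemma contract_columns:
  assumes T: "interval_family s (t * D) T" and no: "\<not> interval_grid p T" and D: "0 < D" and p: "0 < p"
  shows "\<exists>T'. interval_family s t T' \<and> \<not> interval_grid p T' \<and>
    card T \<le> 2 * p * card T' + (p - 1) * 2 ^ (Suc D)\<^sup>2 * D * t"
proof -
  define S where "S i g = {(x, y). (i, x, y) \<in> T \<and> x div D = g}" for i g
  \<comment> \<open>These intervals also end in their block. At most one interval of a row starts in
    a block and leaves it, since two of them would share the last column of the block.\<close>
  define S' where "S' i g = {(x, y). (x, y) \<in> S i g \<and> y \<le> Suc g * D}" for i g
  define X where "X i = {g. S i g \<noteq> {}}" for i
  define P where "P = {(i, g). g \<in> X i}"
  have block: "g * D \<le> x" "x < Suc g * D" "g < t" "i < s" if "(x, y) \<in> S i g" for x y i g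
  proof -
    have xy: "(i, x, y) \<in> T" "x div D = g" using that by (auto simp: S_def)
    show "g * D \<le> x" "x < Suc g * D" using xy(2) dividend_less_div_times[OF D, of x] by auto
    have "x < t * D" using interval_familyD(2,3)[OF T xy(1)] by linarith
    then show "g < t" using xy(2) D by (auto simp: less_mult_imp_div_less)
    show "i < s" by (rule interval_familyD(1)[OF T xy(1)])
  qed
  have Xt: "X i \<subseteq> {..<t}" for i using block(3) by (auto simp: X_def)
  have finX: "finite (X i)" for i by (rule finite_subset[OF Xt]) simp
  have P_sub: "P \<subseteq> {..<s} \<times> {..<t}" using block(3,4) by (auto simp: P_def X_def)
  then have finP: "finite P" by (rule finite_subset) simp
  have inj: "inj_on fst (S i g)" for i g
    using interval_family_disjoint[OF T] interval_familyD(2)[OF T]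
    by (fastforce simp: S_def inj_on_def)
  have fst_S: "fst ` S i g \<subseteq> {g * D..<Suc g * D}" for i g using block(1,2) by fastforce
  have finS: "finite (S i g)" for i g
    by (rule finite_imageD[OF finite_subset[OF fst_S] inj]) simp
  have cardS: "card (S i g) \<le> D" for i g
    using card_mono[OF _ fst_S[of i g]] card_image[OF inj, of i g] by simp
  have S'_sub: "S' i g \<subseteq> S i g" "S' i g \<subseteq> {g * D..Suc g * D} \<times> {g * D..Suc g * D}" for i g
  proof -
    show "S' i g \<subseteq> S i g" by (auto simp: S'_def)
    show "S' i g \<subseteq> {g * D..Suc g * D} \<times> {g * D..Suc g * D}"
    proof
      fix z assume z: "z \<in> S' i g"
      obtain x y where [simp]: "z = (x, y)" by (cases z)
      have xy: "(x, y) \<in> S i g" "y \<le> Suc g * D" using z by (auto simp: S'_def)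
      then have "x < y" using interval_familyD(2)[OF T] by (auto simp: S_def)
      then show "z \<in> {g * D..Suc g * D} \<times> {g * D..Suc g * D}"
        using block(1,2)[OF xy(1)] xy(2) by simp
    qed
  qed
  have card_S_S': "card (S i g) \<le> card (S' i g) + 1" for i g
  proof -
    have "a = b" if "a \<in> S i g - S' i g" "b \<in> S i g - S' i g" for a b
    proof -
      obtain x y x' y' where [simp]: "a = (x, y)" "b = (x', y')" by (cases a, cases b)
      have "Suc g * D < y" "Suc g * D < y'" "x < Suc g * D" "x' < Suc g * D"
        using that block(2) by (auto simp: S'_def)
      then show ?thesis using interval_family_disjoint[OF T, of i x y x' y'] that by (auto simp: S_def)
    qed
    then have "card (S i g - S' i g) \<le> 1" using finS by (simp add: card_le_Suc0_iff_eq)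
    then show ?thesis using card_Un_le[of "S' i g" "S i g - S' i g"] S'_sub(1)[of i g]
      by (simp add: Un_absorb1)
  qed
  \<comment> \<open>A cell that is not rich has at most p intervals: p - 1 inside the block and one
    leaving it. Rich cells are few, because a block admits at most
    \<open>2 ^ (Suc D)\<^sup>2\<close> patterns and p rich rows with the same pattern form a
    grid.\<close>
  define rich where "rich g = {i. p \<le> card (S' i g)}" for g
  have rich_sub: "rich g \<subseteq> {..<s}" for g
  proof
    fix i assume "i \<in> rich g"
    then have "S' i g \<noteq> {}" using p by (auto simp: rich_def)
    then obtain x y where "(x, y) \<in> S i g" using S'_sub(1) by fastforce
    then show "i \<in> {..<s}" using block(4) by simp
  qed
  have fin_rich: "finite (rich g)" for g by (rule finite_subset[OF rich_sub]) simp
  have card_rich: "card (rich g) \<le> (p - 1) * 2 ^ (Suc D)\<^sup>2" for g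
  proof (rule ccontr)
    assume neg: "\<not> ?thesis"
    define V where "V = Pow ({g * D..Suc g * D} \<times> {g * D..Suc g * D})"
    have "card V = 2 ^ (Suc D)\<^sup>2"
      unfolding V_def by (simp add: card_Pow card_cartesian_product power2_eq_square algebra_simps)
    then have "(p - 1) * card V < card (rich g)" using neg by simp
    moreover have "(\<lambda>i. S' i g) ` rich g \<subseteq> V" using S'_sub(2) by (auto simp: V_def)
    ultimately obtain W where W: "p \<le> card {i \<in> rich g. S' i g = W}"
      using pigeonhole_fibre[of "rich g" V "\<lambda>i. S' i g" p] fin_rich by (auto simp: V_def)
    obtain r where r: "\<And>k. k < p \<Longrightarrow> r k \<in> {i \<in> rich g. S' i g = W}" "\<And>k l. k < l \<Longrightarrow> l < p \<Longrightarrow> r k < r l"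
      by (rule obtain_increasing[OF _ W]) (use fin_rich in auto)
    have r0: "S' (r 0) g = W" "p \<le> card W" using r(1)[OF p] by (auto simp: rich_def)
    have "inj_on fst W" "finite W"
      using inj_on_subset[OF inj S'_sub(1), of "r 0" g] finite_subset[OF S'_sub(1) finS, of "r 0" g] r0(1) by auto
    then have "p \<le> card (fst ` W)" "finite (fst ` W)" using r0(2) by (simp_all add: card_image)
    then obtain c where c: "\<And>k. k < p \<Longrightarrow> c k \<in> fst ` W" "\<And>k l. k < l \<Longrightarrow> l < p \<Longrightarrow> c k < c l"
      using obtain_increasing by blast
    have "\<forall>k\<in>{..<p}. \<exists>y. (c k, y) \<in> W" using c(1) by force
    then obtain e where e: "\<And>k. k < p \<Longrightarrow> (c k, e k) \<in> W" by (metis lessThan_iff)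
    have in_T: "(r k, c l, e l) \<in> T" if "k < p" "l < p" for k l
      using e[OF that(2)] r(1)[OF that(1)] by (auto simp: S'_def S_def)
    have "interval_grid p T"
    proof (rule interval_grid_of_segments)
      show "\<exists>x y. (r k, x, y) \<in> T \<and> c l \<le> x \<and> y \<le> e l" if "k < p" "l < p" for k l
        using in_T[OF that] by blast
      show "r k < r (Suc k)" if "Suc k < p" for k using r(2) that by simp
      show "e l \<le> c (Suc l)" if "Suc l < p" for l
        using interval_family_disjoint[OF T in_T[OF p] in_T[OF p that], of l]
          interval_familyD(2)[OF T in_T[OF p that]] c(2)[of l "Suc l"] that by auto
    qed
    then show False using no by blast
  qed
  define par where "par i g = even (card {z \<in> X i. z < g})" for i g
  \<comment> \<open>The last nonempty blocks of a row have no successor of their parity; the end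
    \<open>t\<close> of the row takes its place.\<close>
  define N where "N i g = insert t {g' \<in> X i. g < g' \<and> par i g = par i g'}" for i g
  define h where "h = (\<lambda>(i, g). (i, g, Min (N i g)))"
  define F where "F c = {(i, g) \<in> P. par i g = c}" for c
  have finN: "finite (N i g)" for i g using finX by (simp add: N_def)
  have N: "g < Min (N i g)" "Min (N i g) \<le> t" if "g \<in> X i" for i g
    using that Xt[of i] finN[of i g] by (auto simp: N_def intro: Min_le)
  have cover: "y \<le> Min (N i g) * D" if xy: "(x, y) \<in> S i g" for x y i g
  proof -
    have in_T: "(i, x, y) \<in> T" and g: "g \<in> X i" using xy by (auto simp: S_def X_def)
    have "y \<le> g' * D" if "g' \<in> N i g" for g'
    proof (cases "g' = t")
      case True then show ?thesis using interval_familyD(3)[OF T in_T] by simp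
    next
      case False
      then have "g' \<in> X i" "g < g'" "par i g = par i g'" using that by (auto simp: N_def)
      then obtain z where z: "z \<in> X i" "g < z" "z < g'"
        using rank_parity_between[OF finX g] unfolding par_def by blast
      obtain u v where uv: "(u, v) \<in> S i z" using z(1) by (auto simp: X_def)
      have "Suc g * D \<le> z * D" "Suc z * D \<le> g' * D" using z by (intro mult_le_mono1, simp)+
      then have "x < u" "u < g' * D" using block[OF xy] block[OF uv] by linarith+
      then show ?thesis using interval_family_disjoint[OF T in_T, of u v] interval_familyD(2)[OF T, of i u v] uv
        by (auto simp: S_def)
    qed
    then show ?thesis using Min_in[OF finN[of i g]] by (auto simp: N_def)
  qed
  have main: "interval_family s t (h ` F c) \<and> \<not> interval_grid p (h ` F c) \<and> card (h ` F c) = card (F c)" for c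
  proof (intro conjI)
    have memh: "(i, x) \<in> F c \<and> y = Min (N i x)" if "(i, x, y) \<in> h ` F c" for i x y
      using that by (auto simp: h_def)
    have FX: "g \<in> X i" "i < s" "par i g = c" if "(i, g) \<in> F c" for i g
      using that P_sub by (auto simp: F_def P_def)
    show "interval_family s t (h ` F c)"
      unfolding interval_family_def
    proof (intro conjI allI impI ballI)
      fix z assume "z \<in> h ` F c"
      then obtain i g where "(i, g) \<in> F c" "z = (i, g, Min (N i g))" by (auto simp: h_def)
      then show "case z of (i, x, y) \<Rightarrow> i < s \<and> x < y \<and> y \<le> t" using FX[of i g] N by simp
    next
      fix i x y x' y' assume "(i, x, y) \<in> h ` F c \<and> (i, x', y') \<in> h ` F c"
      then have "(i, x) \<in> F c" "(i, x') \<in> F c" and y: "y = Min (N i x)" "y' = Min (N i x')"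
        using memh[of i x y] memh[of i x' y'] by auto
      then have "x < x' \<Longrightarrow> x' \<in> N i x" "x' < x \<Longrightarrow> x \<in> N i x'"
        using FX[of i x] FX[of i x'] by (auto simp: N_def)
      then have "x < x' \<Longrightarrow> y \<le> x'" "x' < x \<Longrightarrow> y' \<le> x" using finN y by (auto intro: Min_le)
      then show "(x, y) = (x', y') \<or> y \<le> x' \<or> y' \<le> x" using y by (cases x x' rule: linorder_cases) auto
    qed
    show "\<not> interval_grid p (h ` F c)"
    proof
      assume "interval_grid p (h ` F c)"
      then obtain a b where ab: "\<forall>k<p. \<forall>l<p. has_interval (h ` F c) (a k) (a (Suc k)) (b l) (b (Suc l))"
        by (rule interval_gridE)
      have "has_interval T (a k) (a (Suc k)) (b l * D) (b (Suc l) * D)"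
        if kl: "k < p" "l < p" for k l
      proof -
        obtain i g y where 1: "(i, g, y) \<in> h ` F c" "a k \<le> i" "i < a (Suc k)" "b l \<le> g" "y \<le> b (Suc l)"
          using ab[rule_format, OF kl] by (elim exE conjE)
        have "g \<in> X i" and y: "y = Min (N i g)" using memh[OF 1(1)] FX by auto
        then obtain u v where uv: "(u, v) \<in> S i g" by (auto simp: X_def)
        have "b l * D \<le> g * D" "y * D \<le> b (Suc l) * D" using 1(4,5) by (intro mult_le_mono1, simp)+
        then have "b l * D \<le> u" "v \<le> b (Suc l) * D"
          using block(1)[OF uv] cover[OF uv] unfolding y by linarith+
        moreover have "(i, u, v) \<in> T" using uv by (simp add: S_def)
        ultimately show ?thesis using 1 by blast
      qed
      then have "interval_grid p T" by (rule interval_gridI)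
      then show False using no by blast
    qed
    show "card (h ` F c) = card (F c)" by (rule card_image) (auto simp: inj_on_def h_def)
  qed
  \<comment> \<open>Disjointness of the joined intervals is only guaranteed within one parity class.
    Keeping the larger class costs the factor 2.\<close>
  have "P = F True \<union> F False" by (auto simp: F_def)
  then have "card P \<le> card (F True) + card (F False)" using card_Un_le by metis
  then have "card P \<le> 2 * card (h ` F True) \<or> card P \<le> 2 * card (h ` F False)"
    using main[of True] main[of False] by linarith
  then obtain c where c: "card P \<le> 2 * card (h ` F c)" by blast
  have "T \<subseteq> (\<Union>(i, g)\<in>P. Pair i ` S i g)" by (force simp: P_def X_def S_def)
  then have "card T \<le> card (\<Union>(i, g)\<in>P. Pair i ` S i g)" using finP finS by (intro card_mono) auto
  also have "\<dots> \<le> (\<Sum>(i, g)\<in>P. card (Pair i ` S i g))"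
    using card_UN_le[OF finP, of "\<lambda>(i, g). Pair i ` S i g"] by (simp add: case_prod_unfold)
  \<comment> \<open>Rich cells are charged D more; no cell has more than D intervals, as their
    starting points in the block are distinct.\<close>
  also have "\<dots> \<le> (\<Sum>(i, g)\<in>P. p + (if i \<in> rich g then D else 0))"
  proof (rule sum_mono, clarify)
    fix i g
    have "card (Pair i ` S i g) \<le> card (S i g)" by (rule card_image_le[OF finS])
    then show "card (Pair i ` S i g) \<le> p + (if i \<in> rich g then D else 0)"
      using cardS[of i g] card_S_S'[of i g] by (auto simp: rich_def)
  qed
  also have "\<dots> = p * card P + (\<Sum>(i, g)\<in>P. if i \<in> rich g then D else 0)"
    by (simp add: case_prod_unfold sum.distrib)
  also have "(\<Sum>(i, g)\<in>P. if i \<in> rich g then D else 0) \<le> (\<Sum>(i, g)\<in>{..<s} \<times> {..<t}. if i \<in> rich g then D else 0)"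
    by (rule sum_mono2) (use P_sub in auto)
  also have "\<dots> = (\<Sum>g<t. \<Sum>i<s. if i \<in> rich g then D else 0)"
    by (simp add: sum.cartesian_product[symmetric]) (rule sum.swap)
  also have "\<dots> = (\<Sum>g<t. card (rich g) * D)"
  proof (rule sum.cong[OF refl])
    fix g
    have "{..<s} \<inter> rich g = rich g" using rich_sub by blast
    then show "(\<Sum>i<s. if i \<in> rich g then D else 0) = card (rich g) * D"
      by (simp add: sum.If_cases)
  qed
  also have "\<dots> \<le> (\<Sum>g<t. (p - 1) * 2 ^ (Suc D)\<^sup>2 * D)"
    using card_rich by (intro sum_mono mult_le_mono1)
  also have "\<dots> = (p - 1) * 2 ^ (Suc D)\<^sup>2 * D * t" by simp
  also have "p * card P \<le> p * (2 * card (h ` F c))" using c by simp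
  finally have "card T \<le> 2 * p * card (h ` F c) + (p - 1) * 2 ^ (Suc D)\<^sup>2 * D * t" by (simp add: mult_ac)
  then show ?thesis using main[of c] by blast
qed

section \<open>Contracting groups of consecutive rows\<close>

lemma heaviest_row:
  fixes F :: "('r \<times> 'b) set" and p :: nat
  assumes "finite F" "card (fst ` F) \<le> p"
  shows "\<exists>i. card F \<le> p * card {e. (i, e) \<in> F}"
proof (cases "F = {}")
  case False
  define w where "w i = card {e. (i, e) \<in> F}" for i
  have finI: "finite (fst ` F)" using assms(1) by simp
  obtain i where i: "\<forall>j\<in>fst ` F. w j \<le> w i"
  proof -
    have "Max (w ` fst ` F) \<in> w ` fst ` F" using finI False by (intro Max_in) auto
    then obtain i where "w i = Max (w ` fst ` F)" by auto
    then have "\<forall>j\<in>fst ` F. w j \<le> w i" using finI by simp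
    then show ?thesis using that by blast
  qed
  have fin_e: "finite {e. (j, e) \<in> F}" for j
    by (rule finite_subset[OF _ finite_imageI[OF assms(1), of snd]]) force
  have "F = (\<Union>j\<in>fst ` F. Pair j ` {e. (j, e) \<in> F})" by force
  then have "card F \<le> (\<Sum>j\<in>fst ` F. card (Pair j ` {e. (j, e) \<in> F}))"
    using card_UN_le[OF finI, of "\<lambda>j. Pair j ` {e. (j, e) \<in> F}"] by simp
  also have "\<dots> \<le> (\<Sum>j\<in>fst ` F. w i)"
  proof (rule sum_mono)
    fix j assume "j \<in> fst ` F"
    then have "w j \<le> w i" using i by blast
    then show "card (Pair j ` {e. (j, e) \<in> F}) \<le> w i"
      using card_image_le[OF fin_e, of "Pair j" j] unfolding w_def by linarith
  qed
  also have "\<dots> \<le> p * w i" using assms(2) by simp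
  finally show ?thesis unfolding w_def by blast
qed simp

definition row_count :: "(nat \<times> nat \<times> nat) set \<Rightarrow> nat \<Rightarrow> nat \<Rightarrow> nat" where
  "row_count T u w = card {i. \<exists>x y. (i, x, y) \<in> T \<and> u \<le> x \<and> y \<le> w}"

text \<open>The set \<open>E\<close> becomes the single row that replaces the group
  \<open>R\<close>. Sweep from \<open>u\<close> and cut as soon as p rows have an interval inside
  the current segment. Just before the cut fewer than p rows do, so the heaviest of them keeps a
  share of 1/(p - 1); the cut itself loses at most one interval per row. Hence the loss is
  \<open>card R\<close> for each of the J completed segments.\<close>

lemma row_segments:
  fixes p :: nat
  assumes T: "interval_family s t T" and R: "fst ` T \<subseteq> R" "finite R" and p: "0 < p"
  shows "\<exists>J z E. z 0 = u \<and> (\<forall>j<J. z j \<le> z (Suc j) \<and> p \<le> row_count T (z j) (z (Suc j))) \<and>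
    E \<subseteq> {(x, y). u \<le> x \<and> (\<exists>i. (i, x, y) \<in> T)} \<and>
    pairwise_apart E \<and>
    card {(i, x, y) \<in> T. u \<le> x} \<le> (p - 1) * card E + card R * J"
proof (induction "t - u" arbitrary: u rule: less_induct)
  case less
  have fin: "finite T" using T by (rule finite_interval_family)
  have few: "\<exists>E. E \<subseteq> {(x, y). \<exists>i. (i, x, y) \<in> F} \<and>
      pairwise_apart E \<and>
      card F \<le> (p - 1) * card E"
    if F: "F \<subseteq> T" "F \<subseteq> {(i, x, y). u \<le> x \<and> y \<le> w}" "row_count T u w < p" for F w
  proof -
    have "finite F" using fin F(1) finite_subset by blast
    have "{i. \<exists>x y. (i, x, y) \<in> T \<and> u \<le> x \<and> y \<le> w} \<subseteq> fst ` T" by force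
    then have "finite {i. \<exists>x y. (i, x, y) \<in> T \<and> u \<le> x \<and> y \<le> w}" using fin finite_subset by blast
    then have "card (fst ` F) \<le> row_count T u w"
      unfolding row_count_def using F by (intro card_mono) force+
    then have "card (fst ` F) \<le> p - 1" using F(3) by linarith
    then obtain i where i: "card F \<le> (p - 1) * card {e. (i, e) \<in> F}"
      using heaviest_row[OF \<open>finite F\<close>] by blast
    show ?thesis
    proof (intro exI[of _ "{e. (i, e) \<in> F}"] conjI allI impI)
      show "{e. (i, e) \<in> F} \<subseteq> {(x, y). \<exists>i. (i, x, y) \<in> F}" by auto
      fix x y x' y' assume "(x, y) \<in> {e. (i, e) \<in> F} \<and> (x', y') \<in> {e. (i, e) \<in> F}"
      then show "(x, y) = (x', y') \<or> y \<le> x' \<or> y' \<le> x"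
        using F(1) interval_family_disjoint[OF T] by blast
    qed (rule i)
  qed
  show ?case
  proof (cases "p \<le> row_count T u t")
    case False
    have "{(i, x, y) \<in> T. u \<le> x} \<subseteq> {(i, x, y). u \<le> x \<and> y \<le> t}" using interval_familyD(3)[OF T] by auto
    then obtain E where E: "E \<subseteq> {(x, y). \<exists>i. (i, x, y) \<in> {(i, x, y) \<in> T. u \<le> x}}"
      "pairwise_apart E"
      "card {(i, x, y) \<in> T. u \<le> x} \<le> (p - 1) * card E"
    proof -
      have "{(i, x, y) \<in> T. u \<le> x} \<subseteq> T" "row_count T u t < p" using False by auto
      from few[OF this(1) \<open>{(i, x, y) \<in> T. u \<le> x} \<subseteq> {(i, x, y). u \<le> x \<and> y \<le> t}\<close> this(2)]
      show ?thesis by (elim exE conjE) (rule that)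
    qed
    show ?thesis
      by (rule exI[of _ 0], rule exI[of _ "\<lambda>_. u"], rule exI[of _ E]) (use E in auto)
  next
    case True
    define w where "w = (LEAST w. p \<le> row_count T u w)"
    have w: "p \<le> row_count T u w" unfolding w_def using True by (rule LeastI)
    have wt: "w \<le> t" unfolding w_def using True by (rule Least_le)
    have uw: "u < w"
    proof (rule ccontr)
      assume "\<not> u < w"
      then have "{i. \<exists>x y. (i, x, y) \<in> T \<and> u \<le> x \<and> y \<le> w} = {}" using interval_familyD(2)[OF T] by fastforce
      then show False using w p by (simp only: row_count_def) simp
    qed
    have w1: "row_count T u (w - 1) < p"
    proof (rule ccontr)
      assume "\<not> ?thesis"
      then have "w \<le> w - 1" unfolding w_def by (intro Least_le) simp
      then show False using uw by simp
    qed
    obtain J z E where IH: "z 0 = w" "\<forall>j<J. z j \<le> z (Suc j) \<and> p \<le> row_count T (z j) (z (Suc j))"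
      "E \<subseteq> {(x, y). w \<le> x \<and> (\<exists>i. (i, x, y) \<in> T)}"
      "pairwise_apart E"
      "card {(i, x, y) \<in> T. w \<le> x} \<le> (p - 1) * card E + card R * J"
    proof -
      have "t - w < t - u" using uw wt by simp
      from less[OF this] show ?thesis by (elim exE conjE) (rule that)
    qed
    define F where "F = {(i, x, y) \<in> T. u \<le> x \<and> y < w}"
    \<comment> \<open>All these intervals contain column w - 1, so each row has at most one of
      them.\<close>
    define X where "X = {(i, x, y) \<in> T. x < w \<and> w \<le> y}"
    obtain G where G: "G \<subseteq> {(x, y). \<exists>i. (i, x, y) \<in> F}"
      "pairwise_apart G"
      "card F \<le> (p - 1) * card G"
    proof -
      have "F \<subseteq> T" "F \<subseteq> {(i, x, y). u \<le> x \<and> y \<le> w - 1}" by (auto simp: F_def)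
      from few[OF this w1] show ?thesis by (elim exE conjE) (rule that)
    qed
    have cX: "card X \<le> card R"
    proof (rule card_inj_on_le)
      show "fst ` X \<subseteq> R" using R(1) by (force simp: X_def)
      show "finite R" by (rule R(2))
      show "inj_on fst X"
        using interval_family_disjoint[OF T] by (fastforce simp: inj_on_def X_def)
    qed
    have finE: "finite E"
      by (rule finite_subset[OF _ finite_imageI[OF fin, of snd]]) (use IH(3) in force)
    have finG: "finite G"
      by (rule finite_subset[OF _ finite_imageI[OF fin, of snd]]) (use G(1) in \<open>force simp: F_def\<close>)
    have Glt: "y < w \<and> u \<le> x \<and> x < y \<and> (\<exists>i. (i, x, y) \<in> T)" if "(x, y) \<in> G" for x y
      using that G(1) interval_familyD(2)[OF T] by (fastforce simp: F_def)
    have Ege: "w \<le> x \<and> x < y \<and> (\<exists>i. (i, x, y) \<in> T)" if "(x, y) \<in> E" for x y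
      using that IH(3) interval_familyD(2)[OF T] by fastforce
    have "G \<inter> E = {}" using Glt Ege by fastforce
    then have cGE: "card (G \<union> E) = card G + card E" using finE finG by (simp add: card_Un_disjoint)
    have "{(i, x, y) \<in> T. u \<le> x} \<subseteq> F \<union> X \<union> {(i, x, y) \<in> T. w \<le> x}"
      by (auto simp: F_def X_def)
    moreover have "finite (F \<union> X \<union> {(i, x, y) \<in> T. w \<le> x})"
      by (rule finite_subset[OF _ fin]) (auto simp: F_def X_def)
    ultimately have "card {(i, x, y) \<in> T. u \<le> x} \<le> card (F \<union> X \<union> {(i, x, y) \<in> T. w \<le> x})"
      by (intro card_mono)
    also have "\<dots> \<le> card F + card X + card {(i, x, y) \<in> T. w \<le> x}"
      by (meson add_le_mono1 card_Un_le le_trans)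
    also have "\<dots> \<le> (p - 1) * card G + card R + ((p - 1) * card E + card R * J)"
      using G(3) cX IH(5) by (intro add_mono)
    also have "\<dots> = (p - 1) * card (G \<union> E) + card R * Suc J" unfolding cGE by (simp add: algebra_simps)
    finally have card: "card {(i, x, y) \<in> T. u \<le> x} \<le> (p - 1) * card (G \<union> E) + card R * Suc J" .
    show ?thesis
    proof (rule exI[of _ "Suc J"], rule exI[of _ "case_nat u z"], rule exI[of _ "G \<union> E"], intro conjI)
      show "\<forall>j<Suc J. case_nat u z j \<le> case_nat u z (Suc j) \<and> p \<le> row_count T (case_nat u z j) (case_nat u z (Suc j))"
        using IH(1,2) w uw by (auto simp: less_Suc_eq_0_disj)
      show "G \<union> E \<subseteq> {(x, y). u \<le> x \<and> (\<exists>i. (i, x, y) \<in> T)}"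
        using Glt Ege uw by fastforce
      show "pairwise_apart (G \<union> E)"
      proof (intro allI impI)
        fix x y x' y' assume "(x, y) \<in> G \<union> E \<and> (x', y') \<in> G \<union> E"
        then consider "(x, y) \<in> G" "(x', y') \<in> G" | "(x, y) \<in> E" "(x', y') \<in> E"
          | "(x, y) \<in> G" "(x', y') \<in> E" | "(x, y) \<in> E" "(x', y') \<in> G" by blast
        then show "(x, y) = (x', y') \<or> y \<le> x' \<or> y' \<le> x"
        proof cases
          case 1 then show ?thesis using G(2) by blast
        next
          case 2 then show ?thesis using IH(4) by blast
        next
          case 3 then show ?thesis using Glt[of x y] Ege[of x' y'] by linarith
        next
          case 4 then show ?thesis using Glt[of x' y'] Ege[of x y] by linarith
        qed
      qed
    qed (use card in auto)
  qed
qed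

text \<open>Every segment determines a set of at least p rows of \<open>R\<close>. Among more than
  (p - 1) 2^|R| segments, p determine the same set, and p rows of this set form a grid with these
  segments.\<close>

lemma few_row_segments:
  assumes R: "fst ` T \<subseteq> R" "finite R" and no: "\<not> interval_grid p T" and p: "0 < p"
    and z: "\<forall>j<J. z j \<le> z (Suc j) \<and> p \<le> row_count T (z j) (z (Suc j))"
  shows "J \<le> (p - 1) * 2 ^ card R"
proof (rule ccontr)
  assume neg: "\<not> ?thesis"
  define f where "f j = {i. \<exists>x y. (i, x, y) \<in> T \<and> z j \<le> x \<and> y \<le> z (Suc j)}" for j
  have fR: "f j \<subseteq> R" for j using R(1) by (force simp: f_def)
  have "(p - 1) * card (Pow R) < card {..<J}" using neg R(2) by (simp add: card_Pow)
  then obtain W where W: "W \<in> Pow R" "p \<le> card {j \<in> {..<J}. f j = W}"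
    using pigeonhole_fibre[of "{..<J}" "Pow R" f p] fR R(2) by auto
  obtain g where g: "\<And>k. k < p \<Longrightarrow> g k \<in> {j \<in> {..<J}. f j = W}" "\<And>k l. k < l \<Longrightarrow> l < p \<Longrightarrow> g k < g l"
    using obtain_increasing[OF _ W(2)] by auto
  have "p \<le> card W"
    using g(1)[OF p] z unfolding row_count_def f_def by auto
  moreover have "finite W" using W(1) R(2) finite_subset by blast
  ultimately obtain r where r: "\<And>k. k < p \<Longrightarrow> r k \<in> W" "\<And>k l. k < l \<Longrightarrow> l < p \<Longrightarrow> r k < r l"
    using obtain_increasing by blast
  have mono: "z j \<le> z j'" if "j \<le> j'" "j' \<le> J" for j j'
    using that by (induction j' rule: dec_induct) (use z in \<open>auto intro: le_trans\<close>)
  have "interval_grid p T"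
  proof (rule interval_grid_of_segments)
    show "\<exists>x y. (r k, x, y) \<in> T \<and> z (g l) \<le> x \<and> y \<le> z (Suc (g l))" if "k < p" "l < p" for k l
      using r(1)[OF that(1)] g(1)[OF that(2)] by (auto simp: f_def)
    show "r k < r (Suc k)" if "Suc k < p" for k using r(2) that by simp
    show "z (Suc (g l)) \<le> z (g (Suc l))" if "Suc l < p" for l
      using g(2)[of l "Suc l"] g(1)[OF that] that by (intro mono) auto
  qed
  then show False using no by blast
qed

text \<open>A contracted row contains only intervals of original rows of its group, so a grid lifts
  by multiplying the row cuts by B. The additive term counts the intervals lost at cuts: B for each
  of at most (p - 1) 2^B cuts in each of the s groups.\<close>

lemma contract_rows:
  assumes T: "interval_family (s * B) t T" and no: "\<not> interval_grid p T" and B: "0 < B" and p: "0 < p"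
  shows "\<exists>T'. interval_family s t T' \<and> \<not> interval_grid p T' \<and>
    card T \<le> (p - 1) * card T' + B * ((p - 1) * 2 ^ B) * s"
proof -
  have fin: "finite T" using T by (rule finite_interval_family)
  define G where "G I = {(i, x, y) \<in> T. i div B = I}" for I
  have G_sub: "G I \<subseteq> T" for I by (auto simp: G_def)
  have R: "fst ` G I \<subseteq> {I * B..<(I + 1) * B}" for I
    using dividend_less_div_times[OF B] by (auto simp: G_def add.commute)
  have noG: "\<not> interval_grid p (G I)" for I
    using no G_sub[of I] interval_grid_mono by blast
  have ex: "\<forall>I. \<exists>E. E \<subseteq> {(x, y). \<exists>i. (i, x, y) \<in> G I} \<and>
    pairwise_apart E \<and>
    card (G I) \<le> (p - 1) * card E + B * ((p - 1) * 2 ^ B)"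
  proof
    fix I
    have cR: "card {I * B..<(I + 1) * B} = B" by simp
    have GI: "interval_family (s * B) t (G I)" by (rule interval_family_subset[OF T G_sub])
    from row_segments[OF GI R _ p, of 0] obtain J z E where
      z: "\<forall>j<J. z j \<le> z (Suc j) \<and> p \<le> row_count (G I) (z j) (z (Suc j))" and
      E: "E \<subseteq> {(x, y). 0 \<le> x \<and> (\<exists>i. (i, x, y) \<in> G I)}"
        "pairwise_apart E" and
      card: "card {(i, x, y) \<in> G I. 0 \<le> x} \<le> (p - 1) * card E + card {I * B..<(I + 1) * B} * J"
      by auto
    have "J \<le> (p - 1) * 2 ^ B" using few_row_segments[OF R _ noG p z] unfolding cR by simp
    then have "B * J \<le> B * ((p - 1) * 2 ^ B)" by simp
    moreover have "card (G I) \<le> (p - 1) * card E + B * J" using card unfolding cR by simp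
    ultimately have "card (G I) \<le> (p - 1) * card E + B * ((p - 1) * 2 ^ B)" by linarith
    then show "\<exists>E. E \<subseteq> {(x, y). \<exists>i. (i, x, y) \<in> G I} \<and>
      pairwise_apart E \<and>
      card (G I) \<le> (p - 1) * card E + B * ((p - 1) * 2 ^ B)"
      using E by (intro exI[of _ E]) simp
  qed
  obtain E where E': "\<forall>I. E I \<subseteq> {(x, y). \<exists>i. (i, x, y) \<in> G I} \<and>
    pairwise_apart (E I) \<and>
    card (G I) \<le> (p - 1) * card (E I) + B * ((p - 1) * 2 ^ B)"
    using choice[OF ex] by (elim exE)
  then have E: "\<And>I. E I \<subseteq> {(x, y). \<exists>i. (i, x, y) \<in> G I}"
    "\<And>I x y x' y'. (x, y) \<in> E I \<Longrightarrow> (x', y') \<in> E I \<Longrightarrow> (x, y) = (x', y') \<or> y \<le> x' \<or> y' \<le> x"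
    "\<And>I. card (G I) \<le> (p - 1) * card (E I) + B * ((p - 1) * 2 ^ B)"
    by simp_all
  define T' where "T' = (\<Union>I<s. Pair I ` E I)"
  have ET: "\<exists>i. (i, x, y) \<in> T \<and> i div B = I" if "(x, y) \<in> E I" for I x y
    using that E(1) by (fastforce simp: G_def)
  have fam: "interval_family s t T'"
    unfolding interval_family_def T'_def
  proof (intro conjI ballI allI impI)
    fix z assume "z \<in> (\<Union>I<s. Pair I ` E I)"
    then obtain I x y where "z = (I, x, y)" "I < s" "(x, y) \<in> E I" by auto
    then show "case z of (i, x, y) \<Rightarrow> i < s \<and> x < y \<and> y \<le> t"
      using ET[of x y I] interval_familyD[OF T] by auto
  next
    fix I x y x' y' assume "(I, x, y) \<in> (\<Union>I<s. Pair I ` E I) \<and> (I, x', y') \<in> (\<Union>I<s. Pair I ` E I)"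
    then show "(x, y) = (x', y') \<or> y \<le> x' \<or> y' \<le> x" using E(2) by blast
  qed
  moreover have "\<not> interval_grid p T'"
  proof
    assume "interval_grid p T'"
    then obtain a b where ab: "\<forall>k<p. \<forall>l<p. has_interval T' (a k) (a (Suc k)) (b l) (b (Suc l))"
      by (rule interval_gridE)
    have "has_interval T (a k * B) (a (Suc k) * B) (b l) (b (Suc l))"
      if kl: "k < p" "l < p" for k l
    proof -
      obtain I x y where 1: "(x, y) \<in> E I" "a k \<le> I" "I < a (Suc k)" "b l \<le> x" "y \<le> b (Suc l)"
        using ab[rule_format, OF kl] by (auto simp: T'_def)
      obtain i where i: "(i, x, y) \<in> T" "i div B = I" using ET[OF 1(1)] by blast
      have "a k * B \<le> I * B" using 1(2) by simp
      also have "I * B \<le> i" using i(2) by auto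
      finally have "a k * B \<le> i" .
      moreover have "i < a (Suc k) * B"
        using 1(3) i(2) B by (metis div_less_iff_less_mult)
      ultimately show ?thesis using 1 i by blast
    qed
    then have "interval_grid p T" by (rule interval_gridI)
    then show False using no by blast
  qed
  moreover have "card T \<le> (p - 1) * card T' + B * ((p - 1) * 2 ^ B) * s"
  proof -
    have "i div B < s" if "(i, x, y) \<in> T" for i x y
      using interval_familyD(1)[OF T that] B by (metis div_less_iff_less_mult)
    then have "(\<Union>I<s. G I) = T" by (auto simp: G_def)
    then have "card T \<le> (\<Sum>I<s. card (G I))" using card_UN_le[of "{..<s}" G] by simp
    also have "\<dots> \<le> (\<Sum>I<s. (p - 1) * card (E I) + B * ((p - 1) * 2 ^ B))" using E(3) by (rule sum_mono)
    also have "\<dots> = (p - 1) * (\<Sum>I<s. card (E I)) + B * ((p - 1) * 2 ^ B) * s"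
      by (simp add: sum.distrib sum_distrib_left)
    also have "(\<Sum>I<s. card (E I)) = card T'"
    proof -
      have "finite (E I)" for I
        by (rule finite_subset[OF _ finite_imageI[OF fin, of snd]]) (use ET in force)
      then have "card T' = (\<Sum>I<s. card (Pair I ` E I))"
        unfolding T'_def by (intro card_UN_disjoint) auto
      also have "\<dots> = (\<Sum>I<s. card (E I))" by (intro sum.cong) (auto simp: card_image inj_on_def)
      finally show ?thesis by simp
    qed
    finally show ?thesis .
  qed
  ultimately show ?thesis by blast
qed

text \<open>One round of both contractions divides the side length by B = 4p^2 but the number of
  intervals essentially only by 2(p - 1)p < 2p^2. So the inductive term uses at most half of the
  bound, and the other half pays for the additive terms, which are linear in the side
  length.\<close>

lemma interval_family_power_bound:
  assumes p: "0 < p"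
  defines "B \<equiv> 4 * p\<^sup>2"
  shows "\<exists>C. \<forall>m T. interval_family (B ^ m) (B ^ m) T \<longrightarrow> \<not> interval_grid p T \<longrightarrow> card T \<le> C * B ^ m"
proof -
  have B: "0 < B" using p by (simp add: B_def)
  define c1 where "c1 = B * ((p - 1) * 2 ^ B)"
  define c2 where "c2 = (p - 1) * 2 ^ (Suc B)\<^sup>2 * B"
  \<comment> \<open>The first two summands cover the additive losses of a round; the 1 covers the
    base case, a single row with a single column.\<close>
  define C where "C = c1 + p * c2 + 1"
  have "card T \<le> C * B ^ m" if "interval_family (B ^ m) (B ^ m) T" "\<not> interval_grid p T" for m T
    using that
  proof (induction m arbitrary: T)
    case 0
    then have "T \<subseteq> {(0, 0, 1)}" using interval_familyD[of 1 1 T] by fastforce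
    then have "card T \<le> 1" using card_mono[of "{(0, 0, 1)}" T] by simp
    then show ?case by (simp add: C_def)
  next
    case (Suc m)
    have T: "interval_family (B ^ m * B) (B ^ Suc m) T" using Suc.prems(1) by (simp add: mult.commute)
    obtain T1 where T1: "interval_family (B ^ m) (B ^ Suc m) T1" "\<not> interval_grid p T1"
      "card T \<le> (p - 1) * card T1 + c1 * B ^ m"
      using contract_rows[OF T Suc.prems(2) B p] unfolding c1_def by blast
    have T1': "interval_family (B ^ m) (B ^ m * B) T1" using T1(1) by (simp add: mult.commute)
    obtain T2 where T2: "interval_family (B ^ m) (B ^ m) T2" "\<not> interval_grid p T2"
      "card T1 \<le> 2 * p * card T2 + c2 * B ^ m"
      using contract_columns[OF T1' T1(2) B p] unfolding c2_def by blast
    have "card T \<le> (p - 1) * (2 * p * card T2 + c2 * B ^ m) + c1 * B ^ m"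
      using T1(3) T2(3) by (meson add_le_mono1 le_trans mult_le_mono2)
    also have "\<dots> = (p - 1) * (2 * p) * card T2 + (p - 1) * c2 * B ^ m + c1 * B ^ m"
      by (subst add_mult_distrib2) (simp only: mult.assoc)
    also have "\<dots> \<le> 2 * p\<^sup>2 * (C * B ^ m) + p * c2 * B ^ m + c1 * B ^ m"
    proof (rule add_le_mono1[OF add_le_mono])
      have "(p - 1) * (2 * p) \<le> 2 * p\<^sup>2" by (cases p) (simp_all add: power2_eq_square)
      moreover have "card T2 \<le> C * B ^ m" using Suc.IH T2 by blast
      ultimately show "(p - 1) * (2 * p) * card T2 \<le> 2 * p\<^sup>2 * (C * B ^ m)" by (rule mult_le_mono)
    qed simp
    also have "\<dots> \<le> 2 * p\<^sup>2 * (C * B ^ m) + C * B ^ m"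
      by (simp add: C_def algebra_simps)
    also have "\<dots> \<le> 2 * p\<^sup>2 * (C * B ^ m) + 2 * p\<^sup>2 * (C * B ^ m)"
      using p by (intro add_left_mono) simp
    also have "\<dots> = C * B ^ Suc m" by (simp add: B_def)
    finally show ?case .
  qed
  then show ?thesis by blast
qed

text \<open>A family of side n is also a family of side \<open>B ^ m\<close> for the least such
  power above n; this power is at most B n, which costs a factor B.\<close>

theorem interval_family_bound:
  fixes p :: nat
  shows "\<exists>C. \<forall>n T. interval_family n n T \<longrightarrow> \<not> interval_grid p T \<longrightarrow> card T \<le> C * n"
proof (cases "p = 0")
  case True then show ?thesis by (simp add: interval_grid_def)
next
  case False
  define B where "B = 4 * p\<^sup>2"
  have B: "2 \<le> B" using False by (simp add: B_def Suc_le_eq)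
  obtain C where C: "\<And>m T. interval_family (B ^ m) (B ^ m) T \<Longrightarrow> \<not> interval_grid p T \<Longrightarrow> card T \<le> C * B ^ m"
    using interval_family_power_bound[of p] False unfolding B_def by auto
  have "card T \<le> C * B * n" if T: "interval_family n n T" "\<not> interval_grid p T" for n T
  proof (cases "n = 0")
    case True
    then have "T = {}" using interval_familyD(1)[OF T(1)] by fastforce
    then show ?thesis by simp
  next
    case False
    define m where "m = (LEAST m. n \<le> B ^ m)"
    have "n \<le> B ^ n" using B by (metis less_imp_le_nat less_exp order_less_le_trans power_mono zero_le)
    then have nm: "n \<le> B ^ m" unfolding m_def by (rule LeastI)
    have "B ^ m \<le> B * n"
    proof (cases m)
      case 0 then show ?thesis using False B by simp
    next
      case (Suc k)
      have "\<not> n \<le> B ^ k" using not_less_Least[of k "\<lambda>m. n \<le> B ^ m"] Suc unfolding m_def by simp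
      then show ?thesis using Suc by simp
    qed
    moreover have "interval_family (B ^ m) (B ^ m) T"
      using T(1) nm unfolding interval_family_def by fastforce
    ultimately show ?thesis using C[OF _ T(2), of m] by (metis mult.assoc le_trans mult_le_mono2)
  qed
  then show ?thesis by blast
qed

section \<open>Building contraction sequences\<close>

definition red_degree_le :: "('u, 'p, 'r) binary_structure \<Rightarrow> nat \<Rightarrow> 'u set set \<Rightarrow> bool" where
  "red_degree_le S d \<P> \<longleftrightarrow> (\<forall>X\<in>\<P>. card {Y \<in> \<P>. red_adjacent S X Y} \<le> d)"

text \<open>Reachability avoids handling indices: the index of a partition in the final sequence is
  its number of parts. The singletons carry no degree condition because a pair of singletons has
  only one atomic type, so none are red-adjacent.\<close>

inductive contracts_to :: "('u, 'p, 'r) binary_structure \<Rightarrow> nat \<Rightarrow> 'u set set \<Rightarrow> bool" for S d where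
  singletons: "contracts_to S d ((\<lambda>u. {u}) ` domain S)"
| merge: "contracts_to S d \<P> \<Longrightarrow> X \<in> \<P> \<Longrightarrow> Y \<in> \<P> \<Longrightarrow> X \<noteq> Y \<Longrightarrow>
    red_degree_le S d (insert (X \<union> Y) (\<P> - {X, Y})) \<Longrightarrow>
    contracts_to S d (insert (X \<union> Y) (\<P> - {X, Y}))"

lemma partition_on_merge:
  assumes P: "partition_on U \<P>" and XY: "X \<in> \<P>" "Y \<in> \<P>" "X \<noteq> Y"
  shows "partition_on U (insert (X \<union> Y) (\<P> - {X, Y}))"
proof (rule partition_onI)
  show "\<Union> (insert (X \<union> Y) (\<P> - {X, Y})) = U"
    using partition_onD1[OF P] XY by auto
  show "{} \<notin> insert (X \<union> Y) (\<P> - {X, Y})"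
    using partition_onD3[OF P] XY by auto
  show "disjnt p q" if "p \<in> insert (X \<union> Y) (\<P> - {X, Y})" "q \<in> insert (X \<union> Y) (\<P> - {X, Y})" "p \<noteq> q" for p q
  proof -
    have d: "A \<inter> B = {}" if "A \<in> \<P>" "B \<in> \<P>" "A \<noteq> B" for A B
      using partition_onD2[OF P] that by (auto simp: disjoint_def)
    show ?thesis using that XY d unfolding disjnt_def by blast
  qed
qed

lemma union_notin_partition:
  assumes P: "partition_on U \<P>" and XY: "X \<in> \<P>" "Y \<in> \<P>" "X \<noteq> Y"
  shows "X \<union> Y \<notin> \<P>"
proof
  assume "X \<union> Y \<in> \<P>"
  moreover have "A \<inter> B = {}" if "A \<in> \<P>" "B \<in> \<P>" "A \<noteq> B" for A B
    using partition_onD2[OF P] that by (auto simp: disjoint_def)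
  moreover have "X \<noteq> {}" "Y \<noteq> {}" using partition_onD3[OF P] XY by auto
  ultimately show False using XY by blast
qed

lemma card_merge:
  assumes P: "partition_on U \<P>" and XY: "X \<in> \<P>" "Y \<in> \<P>" "X \<noteq> Y" and fin: "finite \<P>"
  shows "Suc (card (insert (X \<union> Y) (\<P> - {X, Y}))) = card \<P>"
proof -
  have "card (insert (X \<union> Y) (\<P> - {X, Y})) = Suc (card (\<P> - {X, Y}))"
    using fin union_notin_partition[OF P XY] by simp
  also have "card (\<P> - {X, Y}) = card \<P> - 2"
    using XY by (subst card_Diff_subset) auto
  finally have "card (insert (X \<union> Y) (\<P> - {X, Y})) = Suc (card \<P> - 2)" .
  moreover have "2 \<le> card \<P>"
    using card_mono[OF fin, of "{X, Y}"] XY by simp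
  ultimately show ?thesis by simp
qed

lemma contracts_to_partition: "contracts_to S d \<P> \<Longrightarrow> partition_on (domain S) \<P>"
proof (induction rule: contracts_to.induct)
  case singletons
  show ?case by (auto simp: partition_on_def disjoint_def)
qed (rule partition_on_merge)

lemma finite_partition: "finite U \<Longrightarrow> partition_on U \<P> \<Longrightarrow> finite \<P>"
  using finite_elements by blast

lemma contracts_to_sequence:
  assumes fin: "finite (domain S)" and "contracts_to S d \<P>"
  shows "card \<P> \<le> card (domain S) \<and> (\<exists>P. P (card \<P>) = \<P> \<and>
    P (card (domain S)) = (\<lambda>u. {u}) ` domain S \<and>
    (\<forall>i\<in>{card \<P>..card (domain S)}. partition_on (domain S) (P i) \<and> red_degree_le S d (P i)) \<and>
    (\<forall>i\<in>{Suc (card \<P>)..card (domain S)}. \<exists>X\<in>P i. \<exists>Y\<in>P i. X \<noteq> Y \<and> P (i - 1) = insert (X \<union> Y) (P i - {X, Y})))"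
  using assms(2)
proof (induction rule: contracts_to.induct)
  case singletons
  let ?P = "(\<lambda>u. {u}) ` domain S"
  have card: "card ?P = card (domain S)" by (rule card_image) simp
  have part: "partition_on (domain S) ?P" by (rule contracts_to_partition[OF contracts_to.singletons])
  have "\<not> red_adjacent S X Y" if "X \<in> ?P" "Y \<in> ?P" for X Y
    using that by (auto simp: red_adjacent_def)
  then have "{Y \<in> ?P. red_adjacent S X Y} = {}" if "X \<in> ?P" for X using that by blast
  then have "red_degree_le S d ?P" unfolding red_degree_le_def by (metis (no_types, lifting) card.empty le0)
  then show ?case unfolding card using part by (intro conjI exI[of _ "\<lambda>_. ?P"]) auto
next
  case (merge \<P> X Y)
  let ?Q = "insert (X \<union> Y) (\<P> - {X, Y})"
  have P: "partition_on (domain S) \<P>" by (rule contracts_to_partition[OF merge.hyps(1)])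
  have card: "card \<P> = Suc (card ?Q)"
    using card_merge[OF P merge.hyps(2-4) finite_partition[OF fin P]] by simp
  have part: "partition_on (domain S) ?Q" by (rule partition_on_merge[OF P merge.hyps(2-4)])
  obtain F where F: "card \<P> \<le> card (domain S)" "F (card \<P>) = \<P>" "F (card (domain S)) = (\<lambda>u. {u}) ` domain S"
    "\<forall>i\<in>{card \<P>..card (domain S)}. partition_on (domain S) (F i) \<and> red_degree_le S d (F i)"
    "\<forall>i\<in>{Suc (card \<P>)..card (domain S)}. \<exists>X\<in>F i. \<exists>Y\<in>F i. X \<noteq> Y \<and> F (i - 1) = insert (X \<union> Y) (F i - {X, Y})"
    using merge.IH by (elim exE conjE) (rule that)
  define G where "G i = (if i = card ?Q then ?Q else F i)" for i
  show ?case
  proof (intro conjI exI[of _ G] ballI)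
    show "card ?Q \<le> card (domain S)" using F(1) card by simp
    show "G (card ?Q) = ?Q" by (simp add: G_def)
    show "G (card (domain S)) = (\<lambda>u. {u}) ` domain S" using F(1,3) card by (simp add: G_def)
  next
    fix i assume i: "i \<in> {card ?Q..card (domain S)}"
    show "partition_on (domain S) (G i)" "red_degree_le S d (G i)"
    proof -
      have "i = card ?Q \<or> i \<in> {card \<P>..card (domain S)}" using i card by auto
      then have "partition_on (domain S) (G i) \<and> red_degree_le S d (G i)"
        using F(4) part merge.hyps(5) by (cases "i = card ?Q") (auto simp: G_def)
      then show "partition_on (domain S) (G i)" "red_degree_le S d (G i)" by auto
    qed
  next
    fix i assume i: "i \<in> {Suc (card ?Q)..card (domain S)}"
    show "\<exists>X\<in>G i. \<exists>Y\<in>G i. X \<noteq> Y \<and> G (i - 1) = insert (X \<union> Y) (G i - {X, Y})"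
    proof (cases "i = card \<P>")
      case True
      have "G i = \<P>" "G (i - 1) = ?Q" using True F(2) card by (simp_all add: G_def)
      then show ?thesis using merge.hyps(2-4) by (intro bexI[of _ X] bexI[of _ Y]) auto
    next
      case False
      then have "i \<in> {Suc (card \<P>)..card (domain S)}" "G i = F i" "G (i - 1) = F (i - 1)"
        using i card by (auto simp: G_def)
      then show ?thesis using F(5) by simp
    qed
  qed
qed

lemma twin_width_le_if_contracts:
  assumes fin: "finite (domain S)" and c: "contracts_to S d {domain S}"
  shows "twin_width S \<le> d"
proof -
  have 1: "card {domain S} = 1" and 2: "Suc 1 = (2 :: nat)" by simp_all
  obtain P where P: "P 1 = {domain S}" "P (card (domain S)) = (\<lambda>u. {u}) ` domain S"
    "\<forall>i\<in>{1..card (domain S)}. partition_on (domain S) (P i) \<and> red_degree_le S d (P i)"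
    "\<forall>i\<in>{2..card (domain S)}. \<exists>X\<in>P i. \<exists>Y\<in>P i. X \<noteq> Y \<and> P (i - 1) = insert (X \<union> Y) (P i - {X, Y})"
    using contracts_to_sequence[OF fin c] unfolding 1 2 by (elim exE conjE) (rule that)
  have "d_sequence S d P"
    unfolding d_sequence_def contraction_sequence_def using P by (simp add: red_degree_le_def)
  then show ?thesis unfolding twin_width_def by (intro Least_le) blast
qed

text \<open>This case is separate because from the empty partition no merge is possible, so
  \<open>{domain S}\<close>, which is \<open>{{}}\<close> here, cannot be reached.\<close>

lemma twin_width_empty:
  assumes "domain S = {}"
  shows "twin_width S = 0"
proof -
  have "d_sequence S 0 (\<lambda>i. if i = 0 then {} else {{}})"
    using assms by (simp add: d_sequence_def contraction_sequence_def)
  then show ?thesis unfolding twin_width_def by (intro Least_eq_0) blast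
qed

lemma red_adjacent_mono:
  "red_adjacent S X Y \<Longrightarrow> X \<subseteq> X' \<Longrightarrow> Y \<subseteq> Y' \<Longrightarrow> X' \<noteq> Y' \<Longrightarrow> red_adjacent S X' Y'"
  unfolding red_adjacent_def by blast

text \<open>Red adjacency survives enlarging two parts unless they become equal. So red neighbours
  of \<open>X\<close> lie in the part of \<open>\<Q>\<close> around \<open>X\<close>, which accounts
  for the summand 1, or in one of its e red neighbours.\<close>

lemma red_degree_le_between:
  assumes finP: "finite \<P>" and finQ: "finite \<Q>"
    and ref: "\<And>X. X \<in> \<P> \<Longrightarrow> \<exists>Z\<in>\<Q>. X \<subseteq> Z"
    and m: "\<And>Z. Z \<in> \<Q> \<Longrightarrow> card {X \<in> \<P>. X \<subseteq> Z} \<le> m"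
    and deg: "red_degree_le S e \<Q>"
  shows "red_degree_le S ((e + 1) * m) \<P>"
  unfolding red_degree_le_def
proof
  fix X assume "X \<in> \<P>"
  then obtain Z where Z: "Z \<in> \<Q>" "X \<subseteq> Z" using ref by blast
  define N where "N = insert Z {W \<in> \<Q>. red_adjacent S Z W}"
  have finN: "finite N" using finQ by (simp add: N_def)
  have NQ: "N \<subseteq> \<Q>" using Z by (auto simp: N_def)
  have "card N \<le> Suc (card {W \<in> \<Q>. red_adjacent S Z W})"
    unfolding N_def by (rule card_insert_le_m1) simp_all
  then have cN: "card N \<le> e + 1" using deg Z(1) by (force simp: red_degree_le_def)
  have "{Y \<in> \<P>. red_adjacent S X Y} \<subseteq> (\<Union>W\<in>N. {Y \<in> \<P>. Y \<subseteq> W})"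
  proof
    fix Y assume Y: "Y \<in> {Y \<in> \<P>. red_adjacent S X Y}"
    then obtain W where W: "W \<in> \<Q>" "Y \<subseteq> W" using ref by blast
    have "W \<in> N"
    proof (cases "W = Z")
      case False
      then have "red_adjacent S Z W" using Y W Z red_adjacent_mono by blast
      then show ?thesis using W by (simp add: N_def)
    qed (simp add: N_def)
    then show "Y \<in> (\<Union>W\<in>N. {Y \<in> \<P>. Y \<subseteq> W})" using Y W by blast
  qed
  then have "card {Y \<in> \<P>. red_adjacent S X Y} \<le> card (\<Union>W\<in>N. {Y \<in> \<P>. Y \<subseteq> W})"
    using finN finP by (intro card_mono) auto
  also have "\<dots> \<le> (\<Sum>W\<in>N. card {Y \<in> \<P>. Y \<subseteq> W})" by (rule card_UN_le[OF finN])
  also have "\<dots> \<le> (\<Sum>W\<in>N. m)" using m NQ by (intro sum_mono) blast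
  also have "\<dots> \<le> (e + 1) * m" using cN unfolding sum_constant of_nat_id by (rule mult_le_mono1)
  finally show "card {Y \<in> \<P>. red_adjacent S X Y} \<le> (e + 1) * m" .
qed

text \<open>Merges inside the parts of \<open>\<Q>\<close> may be done in any order: every
  intermediate partition still refines \<open>\<Q>\<close> with at most m pieces per part, so the
  previous lemma bounds its red degree.\<close>

lemma contracts_to_coarser:
  assumes fin: "finite (domain S)" and c: "contracts_to S d \<P>" and Q: "partition_on (domain S) \<Q>"
    and ref: "\<And>X. X \<in> \<P> \<Longrightarrow> \<exists>Z\<in>\<Q>. X \<subseteq> Z"
    and m: "\<And>Z. Z \<in> \<Q> \<Longrightarrow> card {X \<in> \<P>. X \<subseteq> Z} \<le> m"
    and deg: "red_degree_le S e \<Q>" and d: "(e + 1) * m \<le> d"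
  shows "contracts_to S d \<Q>"
  using c ref m
proof (induction "card \<P>" arbitrary: \<P> rule: less_induct)
  case less
  have P: "partition_on (domain S) \<P>" by (rule contracts_to_partition[OF less.prems(1)])
  have finP: "finite \<P>" by (rule finite_partition[OF fin P])
  have finQ: "finite \<Q>" by (rule finite_partition[OF fin Q])
  have disjP: "A = B" if "A \<in> \<P>" "B \<in> \<P>" "x \<in> A" "x \<in> B" for A B x
    using partition_onD2[OF P] that unfolding disjoint_def by blast
  have disjQ: "A = B" if "A \<in> \<Q>" "B \<in> \<Q>" "x \<in> A" "x \<in> B" for A B x
    using partition_onD2[OF Q] that unfolding disjoint_def by blast
  show ?case
  proof (cases "\<exists>Z\<in>\<Q>. \<exists>X\<in>\<P>. \<exists>Y\<in>\<P>. X \<noteq> Y \<and> X \<subseteq> Z \<and> Y \<subseteq> Z")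
    case True
    then obtain Z X Y where XY: "Z \<in> \<Q>" "X \<in> \<P>" "Y \<in> \<P>" "X \<noteq> Y" "X \<subseteq> Z" "Y \<subseteq> Z" by blast
    let ?P = "insert (X \<union> Y) (\<P> - {X, Y})"
    have ref': "\<exists>Z\<in>\<Q>. A \<subseteq> Z" if "A \<in> ?P" for A
      using that XY less.prems(2) by blast
    have m': "card {A \<in> ?P. A \<subseteq> W} \<le> m" if W: "W \<in> \<Q>" for W
    proof -
      define f where "f A = (if A = X \<union> Y then X else A)" for A
      have "card {A \<in> ?P. A \<subseteq> W} \<le> card {A \<in> \<P>. A \<subseteq> W}"
      proof (rule card_inj_on_le)
        show "inj_on f {A \<in> ?P. A \<subseteq> W}" by (auto simp: inj_on_def f_def)
        show "f ` {A \<in> ?P. A \<subseteq> W} \<subseteq> {A \<in> \<P>. A \<subseteq> W}" using XY by (auto simp: f_def)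
        show "finite {A \<in> \<P>. A \<subseteq> W}" using finP by simp
      qed
      then show ?thesis using less.prems(3)[OF W] by simp
    qed
    have "red_degree_le S ((e + 1) * m) ?P"
      using finP by (intro red_degree_le_between[OF _ finQ ref' m' deg]) auto
    then have "red_degree_le S d ?P" using d unfolding red_degree_le_def by (meson le_trans)
    then have c': "contracts_to S d ?P" using contracts_to.merge[OF less.prems(1) XY(2,3,4)] by blast
    have "card ?P < card \<P>" using card_merge[OF P XY(2,3,4) finP] by simp
    from less.hyps[OF this c' ref' m'] show ?thesis .
  next
    case False
    have "\<P> \<subseteq> \<Q>"
    proof
      fix X assume X: "X \<in> \<P>"
      obtain Z where Z: "Z \<in> \<Q>" "X \<subseteq> Z" using less.prems(2)[OF X] by blast
      have "Z \<subseteq> X"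
      proof
        fix z assume z: "z \<in> Z"
        then have "z \<in> domain S" using Z partition_onD1[OF Q] by blast
        then obtain Y where Y: "Y \<in> \<P>" "z \<in> Y" using partition_onD1[OF P] by blast
        obtain W where W: "W \<in> \<Q>" "Y \<subseteq> W" using less.prems(2)[OF Y(1)] by blast
        have "W = Z" using disjQ[OF W(1) Z(1), of z] W(2) Y(2) z by blast
        then have "Y = X" using False X Y Z W by blast
        then show "z \<in> X" using Y by simp
      qed
      then show "X \<in> \<Q>" using Z by (metis subset_antisym)
    qed
    moreover have "\<Q> \<subseteq> \<P>"
    proof
      fix Z assume Z: "Z \<in> \<Q>"
      then obtain z where z: "z \<in> Z" using partition_onD3[OF Q] by fastforce
      then have "z \<in> domain S" using Z partition_onD1[OF Q] by blast
      then obtain Y where Y: "Y \<in> \<P>" "z \<in> Y" using partition_onD1[OF P] by blast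
      then have "Y \<in> \<Q>" using \<open>\<P> \<subseteq> \<Q>\<close> by blast
      then show "Z \<in> \<P>" using disjQ[OF _ Z Y(2) z] Y by blast
    qed
    ultimately have "\<P> = \<Q>" by (rule subset_antisym)
    then show ?thesis using less.prems(1) by simp
  qed
qed

section \<open>Partitions given by the level sets of a key\<close>

definition fibres :: "('u \<Rightarrow> 'k) \<Rightarrow> 'u set \<Rightarrow> 'u set set" where
  "fibres f U = (\<lambda>u. {v \<in> U. f v = f u}) ` U"

lemma partition_on_fibres: "partition_on U (fibres f U)"
  by (auto simp: partition_on_def fibres_def disjoint_def)

lemma fibres_inj_on: "inj_on f U \<Longrightarrow> fibres f U = (\<lambda>u. {u}) ` U"
  unfolding fibres_def by (intro image_cong) (auto dest: inj_onD)

lemma card_fibres_le: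
  assumes "finite U" "\<F> \<subseteq> fibres f U" "V \<subseteq> U" "\<And>u. u \<in> U \<Longrightarrow> {v \<in> U. f v = f u} \<in> \<F> \<Longrightarrow> u \<in> V"
  shows "card \<F> \<le> card (f ` V)"
proof -
  have "\<F> \<subseteq> (\<lambda>k. {v \<in> U. f v = k}) ` f ` V"
    using assms(2,4) unfolding fibres_def by blast
  moreover have "finite (f ` V)" using finite_subset[OF assms(3,1)] by simp
  ultimately show ?thesis by (rule surj_card_le[rotated])
qed

text \<open>With keys, refinement becomes an implication between equalities, and the pieces of a
  coarse part are counted by the key values that occur in it.\<close>

lemma contracts_to_coarser_fibres:
  assumes fin: "finite (domain S)" and c: "contracts_to S d (fibres f (domain S))"
    and coarser: "\<And>u v. u \<in> domain S \<Longrightarrow> v \<in> domain S \<Longrightarrow> f u = f v \<Longrightarrow> f' u = f' v"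
    and m: "\<And>u. u \<in> domain S \<Longrightarrow> card (f ` {v \<in> domain S. f' v = f' u}) \<le> m"
    and deg: "red_degree_le S e (fibres f' (domain S))" and d: "(e + 1) * m \<le> d"
  shows "contracts_to S d (fibres f' (domain S))"
proof (rule contracts_to_coarser[OF fin c partition_on_fibres _ _ deg d])
  show "\<exists>Z\<in>fibres f' (domain S). X \<subseteq> Z" if X: "X \<in> fibres f (domain S)" for X
  proof -
    obtain u where u: "u \<in> domain S" "X = {v \<in> domain S. f v = f u}"
      using X unfolding fibres_def by (elim imageE)
    have "X \<subseteq> {v \<in> domain S. f' v = f' u}" using coarser u(1) unfolding u(2) by blast
    moreover have "{v \<in> domain S. f' v = f' u} \<in> fibres f' (domain S)" using u(1) unfolding fibres_def by (rule imageI)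
    ultimately show ?thesis by (rule bexI)
  qed
  show "card {X \<in> fibres f (domain S). X \<subseteq> Z} \<le> m" if Z: "Z \<in> fibres f' (domain S)" for Z
  proof -
    obtain u where u: "u \<in> domain S" "Z = {v \<in> domain S. f' v = f' u}"
      using Z unfolding fibres_def by (elim imageE)
    have "card {X \<in> fibres f (domain S). X \<subseteq> Z} \<le> card (f ` Z)"
      by (rule card_fibres_le[OF fin]) (use u in auto)
    then show ?thesis using m[OF u(1)] u(2) by simp
  qed
qed

section \<open>Linear minors as bilinear contractions\<close>

definition bilinear_contraction ::
  "nat \<Rightarrow> nat \<Rightarrow> (nat \<Rightarrow> nat) \<Rightarrow> (nat \<Rightarrow> nat) \<Rightarrow> (nat \<Rightarrow> 'a) \<Rightarrow> (nat \<Rightarrow> 'a) \<Rightarrow> 'a::field mat \<Rightarrow> 'a mat" where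
  "bilinear_contraction p q \<phi> \<psi> u v M = mat p q (\<lambda>(i, j).
     \<Sum>k<dim_row M. \<Sum>l<dim_col M. if \<phi> k = i \<and> \<psi> l = j then u k * v l * M $$ (k, l) else 0)"

text \<open>Monotone surjections encode the divisions of m indices into p nonempty
  intervals.\<close>

definition mono_onto :: "nat \<Rightarrow> nat \<Rightarrow> (nat \<Rightarrow> nat) \<Rightarrow> bool" where
  "mono_onto m p \<phi> \<longleftrightarrow> (\<forall>k l. k \<le> l \<longrightarrow> l < m \<longrightarrow> \<phi> k \<le> \<phi> l) \<and> \<phi> ` {..<m} = {..<p}"

lemma sum_merge_consecutive:
  fixes g g' :: "nat \<Rightarrow> 'a::comm_monoid_add"
  assumes "r < n" "\<And>k. k < r \<Longrightarrow> g' k = g k" "g' r = g r + g (Suc r)" "\<And>k. r < k \<Longrightarrow> k < n \<Longrightarrow> g' k = g (Suc k)"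
  shows "sum g' {..<n} = sum g {..<Suc n}"
proof -
  have "Suc r \<le> n" using assms(1) by simp
  then show ?thesis using assms(4)
  proof (induction n rule: dec_induct)
    case base
    have "sum g' {..<r} = sum g {..<r}" using assms(2) by simp
    then show ?case using assms(3) by (simp add: add.assoc)
  next
    case (step n)
    then show ?case by simp
  qed
qed

lemma bilinear_contraction_transpose:
  "bilinear_contraction p q \<phi> \<psi> u v M = transpose_mat (bilinear_contraction q p \<psi> \<phi> v u (transpose_mat M))"
proof (rule eq_matI)
  fix i j
  assume ij: "i < dim_row (transpose_mat (bilinear_contraction q p \<psi> \<phi> v u (transpose_mat M)))"
    "j < dim_col (transpose_mat (bilinear_contraction q p \<psi> \<phi> v u (transpose_mat M)))"
  have "(\<Sum>k<dim_row M. \<Sum>l<dim_col M. if \<phi> k = i \<and> \<psi> l = j then u k * v l * M $$ (k, l) else 0) =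
    (\<Sum>l<dim_col M. \<Sum>k<dim_row M. if \<psi> l = j \<and> \<phi> k = i then v l * u k * transpose_mat M $$ (l, k) else 0)"
    by (subst sum.swap) (auto intro!: sum.cong)
  then show "bilinear_contraction p q \<phi> \<psi> u v M $$ (i, j) =
    transpose_mat (bilinear_contraction q p \<psi> \<phi> v u (transpose_mat M)) $$ (i, j)"
    using ij by (simp add: bilinear_contraction_def)
qed (simp_all add: bilinear_contraction_def)

lemma sum_cols_transpose: "sum_cols \<alpha> \<beta> j M = transpose_mat (sum_rows \<alpha> \<beta> j (transpose_mat M))"
  by (rule eq_matI) (auto simp: sum_cols_def sum_rows_def)

lemma linear_minor_transpose:
  assumes "linear_minor N M"
  shows "linear_minor (transpose_mat N) (transpose_mat M)"
  using assms unfolding linear_minor_def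
proof (induction rule: rtranclp_induct)
  case (step A B)
  have "weighted_sum_operation (transpose_mat A) (transpose_mat B)"
    using step.hyps(2)
  proof cases
    case (rows i \<alpha> \<beta>)
    then show ?thesis
      using weighted_sum_operation.cols[of i "transpose_mat A" \<alpha> \<beta>] by (simp add: sum_cols_transpose)
  next
    case (cols i \<alpha> \<beta>)
    then show ?thesis
      using weighted_sum_operation.rows[of i "transpose_mat A" \<alpha> \<beta>] by (simp add: sum_cols_transpose)
  qed
  then show ?case using step.IH by (rule rtranclp.rtrancl_into_rtrancl[rotated])
qed simp

text \<open>An operation is undone by splitting the summed row: both original rows join its part,
  and their weights are its weight times \<alpha> and times \<beta>.\<close>

lemma bilinear_contraction_sum_rows:
  fixes M :: "'a::field mat"
  assumes r: "Suc r < dim_row M"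
    and phi: "\<And>k. k \<le> r \<Longrightarrow> \<phi>' k = \<phi> k" "\<And>k. r \<le> k \<Longrightarrow> Suc k < dim_row M \<Longrightarrow> \<phi>' (Suc k) = \<phi> k"
    and u: "\<And>k. k < r \<Longrightarrow> u' k = u k" "u' r = u r * \<alpha>" "u' (Suc r) = u r * \<beta>" "\<And>k. r < k \<Longrightarrow> u' (Suc k) = u k"
  shows "bilinear_contraction p q \<phi> \<psi> u v (sum_rows \<alpha> \<beta> r M) = bilinear_contraction p q \<phi>' \<psi> u' v M"
proof (rule eq_matI)
  fix i j
  assume ij: "i < dim_row (bilinear_contraction p q \<phi>' \<psi> u' v M)" "j < dim_col (bilinear_contraction p q \<phi>' \<psi> u' v M)"
  define M' where "M' = sum_rows \<alpha> \<beta> r M"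
  define n where "n = dim_row M - 1"
  have n: "dim_row M = Suc n" "r < n" using r by (auto simp: n_def)
  have dim: "dim_row M' = n" "dim_col M' = dim_col M" by (simp_all add: M'_def sum_rows_def n_def)
  define g' where "g' k = (\<Sum>l<dim_col M. if \<phi> k = i \<and> \<psi> l = j then u k * v l * M' $$ (k, l) else 0)" for k
  define g where "g k = (\<Sum>l<dim_col M. if \<phi>' k = i \<and> \<psi> l = j then u' k * v l * M $$ (k, l) else 0)" for k
  have "sum g' {..<n} = sum g {..<Suc n}"
  proof (rule sum_merge_consecutive[OF n(2)])
    show "g' k = g k" if "k < r" for k
      unfolding g_def g'_def using that phi u n by (intro sum.cong) (auto simp: M'_def sum_rows_def)
    show "g' k = g (Suc k)" if "r < k" "k < n" for k
      unfolding g_def g'_def using that phi u n by (intro sum.cong) (auto simp: M'_def sum_rows_def)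
    have e: "\<phi>' r = \<phi> r" "\<phi>' (Suc r) = \<phi> r" using phi n by auto
    have M'r: "M' $$ (r, l) = \<alpha> * M $$ (r, l) + \<beta> * M $$ (Suc r, l)" if "l < dim_col M" for l
      using that n by (simp add: M'_def sum_rows_def)
    show "g' r = g r + g (Suc r)"
      unfolding g_def g'_def sum.distrib[symmetric] e u
      by (intro sum.cong refl) (simp add: M'r algebra_simps)
  qed
  then show "bilinear_contraction p q \<phi> \<psi> u v (sum_rows \<alpha> \<beta> r M) $$ (i, j) = bilinear_contraction p q \<phi>' \<psi> u' v M $$ (i, j)"
    unfolding M'_def[symmetric] using ij n(1)
    by (simp add: bilinear_contraction_def dim g_def g'_def)
qed (simp_all add: bilinear_contraction_def)

lemma mono_onto_split:
  assumes "mono_onto n p \<phi>" "r < n"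
  shows "mono_onto (Suc n) p (\<lambda>k. if k \<le> r then \<phi> k else \<phi> (k - 1))"
  unfolding mono_onto_def
proof (intro conjI allI impI)
  fix k l :: nat assume "k \<le> l" "l < Suc n"
  then show "(if k \<le> r then \<phi> k else \<phi> (k - 1)) \<le> (if l \<le> r then \<phi> l else \<phi> (l - 1))"
    using assms by (auto simp: mono_onto_def)
next
  have "(\<lambda>k. if k \<le> r then \<phi> k else \<phi> (k - 1)) ` {..<Suc n} = \<phi> ` {..<n}"
  proof (intro subset_antisym subsetI)
    fix x assume "x \<in> (\<lambda>k. if k \<le> r then \<phi> k else \<phi> (k - 1)) ` {..<Suc n}"
    then show "x \<in> \<phi> ` {..<n}" using assms(2) by (auto split: if_splits)
  next
    fix x assume "x \<in> \<phi> ` {..<n}"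
    then obtain k where k: "k < n" "x = \<phi> k" by auto
    show "x \<in> (\<lambda>k. if k \<le> r then \<phi> k else \<phi> (k - 1)) ` {..<Suc n}"
      using k by (intro image_eqI[of _ _ "if k \<le> r then k else Suc k"]) auto
  qed
  then show "(\<lambda>k. if k \<le> r then \<phi> k else \<phi> (k - 1)) ` {..<Suc n} = {..<p}"
    using assms(1) by (simp add: mono_onto_def)
qed

lemma sum_rows_bilinear_contraction:
  fixes M :: "'a::field mat"
  assumes r: "Suc r < dim_row M" and phi: "mono_onto (dim_row (sum_rows \<alpha> \<beta> r M)) p \<phi>"
  shows "\<exists>\<phi>' u'. mono_onto (dim_row M) p \<phi>' \<and>
    bilinear_contraction p q \<phi> \<psi> u v (sum_rows \<alpha> \<beta> r M) = bilinear_contraction p q \<phi>' \<psi> u' v M"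
proof -
  let ?u = "\<lambda>k. if k < r then u k else if k = r then u r * \<alpha> else if k = Suc r then u r * \<beta> else u (k - 1)"
  have "mono_onto (Suc (dim_row M - 1)) p (\<lambda>k. if k \<le> r then \<phi> k else \<phi> (k - 1))"
    using phi r by (intro mono_onto_split) (auto simp: sum_rows_def)
  moreover have "bilinear_contraction p q \<phi> \<psi> u v (sum_rows \<alpha> \<beta> r M) =
    bilinear_contraction p q (\<lambda>k. if k \<le> r then \<phi> k else \<phi> (k - 1)) \<psi> ?u v M"
    by (rule bilinear_contraction_sum_rows[OF r]) auto
  ultimately show ?thesis using r by (intro exI[of _ ?u] exI) auto
qed

text \<open>The induction starts at \<open>N\<close>, with all weights 1 and singleton parts, and
  pulls parts and weights back through the operations towards \<open>M\<close>. Column operations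
  are row operations on the transpose.\<close>

lemma linear_minor_imp_bilinear_contraction:
  fixes M :: "'a::field mat"
  assumes "linear_minor N M"
  shows "\<exists>\<phi> \<psi> u v. mono_onto (dim_row M) (dim_row N) \<phi> \<and> mono_onto (dim_col M) (dim_col N) \<psi> \<and>
    N = bilinear_contraction (dim_row N) (dim_col N) \<phi> \<psi> u v M"
  using assms unfolding linear_minor_def
proof (induction rule: converse_rtranclp_induct)
  case base
  have "N = bilinear_contraction (dim_row N) (dim_col N) id id (\<lambda>_. 1) (\<lambda>_. 1) N"
  proof (rule eq_matI)
    fix i j assume "i < dim_row (bilinear_contraction (dim_row N) (dim_col N) id id (\<lambda>_. 1) (\<lambda>_. 1) N)"
      "j < dim_col (bilinear_contraction (dim_row N) (dim_col N) id id (\<lambda>_. 1) (\<lambda>_. 1) N)"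
    then have ij: "i < dim_row N" "j < dim_col N" by (simp_all add: bilinear_contraction_def)
    have "(\<Sum>k<dim_row N. \<Sum>l<dim_col N. if k = i \<and> l = j then 1 * 1 * N $$ (k, l) else 0) =
      (\<Sum>k<dim_row N. if k = i then (\<Sum>l<dim_col N. if l = j then N $$ (i, l) else 0) else 0)"
      by (intro sum.cong) auto
    also have "\<dots> = N $$ (i, j)" using ij by simp
    finally show "N $$ (i, j) = bilinear_contraction (dim_row N) (dim_col N) id id (\<lambda>_. 1) (\<lambda>_. 1) N $$ (i, j)"
      using ij by (simp add: bilinear_contraction_def)
  qed (simp_all add: bilinear_contraction_def)
  moreover have "mono_onto n n id" for n by (simp add: mono_onto_def)
  ultimately show ?case by blast
next
  case (step M M')
  obtain \<phi> \<psi> u v where IH: "mono_onto (dim_row M') (dim_row N) \<phi>" "mono_onto (dim_col M') (dim_col N) \<psi>"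
    "N = bilinear_contraction (dim_row N) (dim_col N) \<phi> \<psi> u v M'"
    using step.IH by (elim exE conjE) (rule that)
  from step.hyps(1) show ?case
  proof cases
    case (rows i \<alpha> \<beta>)
    have d: "dim_col M' = dim_col M" unfolding rows by (simp add: sum_rows_def)
    have "mono_onto (dim_row (sum_rows \<alpha> \<beta> i M)) (dim_row N) \<phi>"
      using IH(1) unfolding rows(1) .
    from sum_rows_bilinear_contraction[OF rows(2) this, of "dim_col N" \<psi> u v]
    obtain \<phi>' u' where "mono_onto (dim_row M) (dim_row N) \<phi>'"
      "bilinear_contraction (dim_row N) (dim_col N) \<phi> \<psi> u v M' = bilinear_contraction (dim_row N) (dim_col N) \<phi>' \<psi> u' v M"
      unfolding rows(1)[symmetric] by (elim exE conjE)
    then show ?thesis using IH(2,3) unfolding d by metis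
  next
    case (cols j \<alpha> \<beta>)
    let ?T = "transpose_mat M"
    have d: "dim_row M' = dim_row M" unfolding cols by (simp add: sum_cols_def)
    have j: "Suc j < dim_row ?T" using cols by simp
    have M'T: "transpose_mat M' = sum_rows \<alpha> \<beta> j ?T" unfolding cols by (simp add: sum_cols_transpose)
    have "mono_onto (dim_row (sum_rows \<alpha> \<beta> j ?T)) (dim_col N) \<psi>"
      using IH(2) unfolding M'T[symmetric] by simp
    from sum_rows_bilinear_contraction[OF j this, of "dim_row N" \<phi> v u]
    obtain \<psi>' v' where psi: "mono_onto (dim_row ?T) (dim_col N) \<psi>'"
      "bilinear_contraction (dim_col N) (dim_row N) \<psi> \<phi> v u (sum_rows \<alpha> \<beta> j ?T) =
       bilinear_contraction (dim_col N) (dim_row N) \<psi>' \<phi> v' u ?T"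
      by (elim exE conjE)
    have "N = bilinear_contraction (dim_row N) (dim_col N) \<phi> \<psi>' u v' M"
      by (subst IH(3), subst (1 2) bilinear_contraction_transpose) (simp add: M'T psi(2))
    then show ?thesis using IH(1) psi(1) unfolding d by (intro exI conjI) simp_all
  qed
qed

section \<open>Realizing prescribed weights by operations\<close>

lemma mono_onto_inj_id:
  assumes "mono_onto m p \<phi>" "inj_on \<phi> {..<m}"
  shows "p = m" "\<And>k. k < m \<Longrightarrow> \<phi> k = k"
proof -
  have mono: "\<phi> k \<le> \<phi> l" if "k \<le> l" "l < m" for k l using assms(1) that by (simp add: mono_onto_def)
  have img: "\<phi> ` {..<m} = {..<p}" using assms(1) by (simp add: mono_onto_def)
  show "p = m" using card_image[OF assms(2)] img by simp
  show "\<phi> k = k" if k: "k < m" for k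
  proof -
    have "\<phi> ` {..<k} = {..<\<phi> k}"
    proof (intro subset_antisym subsetI)
      fix x assume "x \<in> \<phi> ` {..<k}"
      then obtain l where l: "l < k" "x = \<phi> l" by auto
      have "\<phi> l \<noteq> \<phi> k" using inj_onD[OF assms(2), of l k] l k by auto
      then show "x \<in> {..<\<phi> k}" using mono[of l k] l k by simp
    next
      fix x assume x: "x \<in> {..<\<phi> k}"
      have "\<phi> k < p" using img k by auto
      then have "x \<in> \<phi> ` {..<m}" using x img by auto
      then obtain l where l: "l < m" "x = \<phi> l" by auto
      have "l < k" using mono[of k l] l x by (cases "l < k") auto
      then show "x \<in> \<phi> ` {..<k}" using l by auto
    qed
    moreover have "card (\<phi> ` {..<k}) = k"
      using inj_on_subset[OF assms(2), of "{..<k}"] k by (subst card_image) auto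
    ultimately show ?thesis by simp
  qed
qed

definition row_contraction :: "nat \<Rightarrow> (nat \<Rightarrow> nat) \<Rightarrow> (nat \<Rightarrow> 'a) \<Rightarrow> 'a::field mat \<Rightarrow> 'a mat" where
  "row_contraction p \<phi> u M = mat p (dim_col M) (\<lambda>(i, j). \<Sum>k<dim_row M. if \<phi> k = i then u k * M $$ (k, j) else 0)"

text \<open>A single row cannot be rescaled, so the weight of a row that is alone in its part must be \<open>1\<close>.\<close>

lemma linear_minor_row_contraction:
  fixes M :: "'a::field mat"
  assumes "mono_onto (dim_row M) p \<phi>"
    and "\<And>k. k < dim_row M \<Longrightarrow> (\<And>l. l < dim_row M \<Longrightarrow> \<phi> l = \<phi> k \<Longrightarrow> l = k) \<Longrightarrow> u k = 1"
  shows "linear_minor (row_contraction p \<phi> u M) M"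
  using assms
proof (induction "dim_row M" arbitrary: M \<phi> u rule: less_induct)
  case less
  show ?case
  proof (cases "inj_on \<phi> {..<dim_row M}")
    case True
    have id: "p = dim_row M" "\<And>k. k < dim_row M \<Longrightarrow> \<phi> k = k"
      using mono_onto_inj_id[OF less.prems(1) True] by auto
    have u1: "u k = 1" if "k < dim_row M" for k
      using that id(2) by (intro less.prems(2)) auto
    have "row_contraction p \<phi> u M = M"
    proof (rule eq_matI)
      fix i j assume ij: "i < dim_row M" "j < dim_col M"
      have "(\<Sum>k<dim_row M. if \<phi> k = i then u k * M $$ (k, j) else 0) = (\<Sum>k<dim_row M. if k = i then M $$ (k, j) else 0)"
        using id u1 by (intro sum.cong) auto
      then show "row_contraction p \<phi> u M $$ (i, j) = M $$ (i, j)" using ij id(1) by (simp add: row_contraction_def)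
    qed (simp_all add: row_contraction_def id(1))
    then show ?thesis by (simp add: linear_minor_def)
  next
    case False
    then obtain k l where kl: "k < l" "l < dim_row M" "\<phi> k = \<phi> l"
      unfolding inj_on_def by (metis lessThan_iff linorder_neqE_nat)
    have mono: "\<phi> k \<le> \<phi> l" if "k \<le> l" "l < dim_row M" for k l
      using less.prems(1) that by (simp add: mono_onto_def)
    have "\<phi> k \<le> \<phi> (Suc k)" "\<phi> (Suc k) \<le> \<phi> l" using mono[of k "Suc k"] mono[of "Suc k" l] kl by simp_all
    then have eq: "\<phi> (Suc k) = \<phi> k" using kl by simp
    have r: "Suc k < dim_row M" using kl by simp
    define n where "n = dim_row M - 1"
    have n: "dim_row M = Suc n" "k < n" using r by (auto simp: n_def)
    \<comment> \<open>Two neighbours of one part are summed with their own weights. Their sum then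
      carries weight 1, which is admissible even if it has become the only row of its part.\<close>
    define M' where "M' = sum_rows (u k) (u (Suc k)) k M"
    define \<phi>' where "\<phi>' i = (if i \<le> k then \<phi> i else \<phi> (Suc i))" for i
    define u' where "u' i = (if i < k then u i else if i = k then 1 else u (Suc i))" for i
    have dim: "dim_row M' = n" "dim_col M' = dim_col M" by (simp_all add: M'_def sum_rows_def n_def)
    have "row_contraction p \<phi>' u' M' = row_contraction p \<phi> u M"
    proof (rule eq_matI)
      fix i j assume "i < dim_row (row_contraction p \<phi> u M)" "j < dim_col (row_contraction p \<phi> u M)"
      then have ij: "i < p" "j < dim_col M" by (simp_all add: row_contraction_def)
      have "(\<Sum>t<n. if \<phi>' t = i then u' t * M' $$ (t, j) else 0) = (\<Sum>t<Suc n. if \<phi> t = i then u t * M $$ (t, j) else 0)"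
        by (rule sum_merge_consecutive[OF n(2)])
          (use n ij eq in \<open>auto simp: \<phi>'_def u'_def M'_def sum_rows_def\<close>)
      then show "row_contraction p \<phi>' u' M' $$ (i, j) = row_contraction p \<phi> u M $$ (i, j)"
        using ij by (simp add: row_contraction_def dim n(1))
    qed (simp_all add: row_contraction_def dim)
    moreover have "linear_minor (row_contraction p \<phi>' u' M') M'"
    proof (rule less.hyps)
      show "dim_row M' < dim_row M" using n dim by simp
      show "mono_onto (dim_row M') p \<phi>'"
        unfolding mono_onto_def
      proof (intro conjI allI impI)
        fix i j assume "i \<le> j" "j < dim_row M'"
        then show "\<phi>' i \<le> \<phi>' j" using mono n dim by (auto simp: \<phi>'_def)
      next
        have "\<phi>' ` {..<dim_row M'} = \<phi> ` {..<dim_row M}"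
        proof (intro subset_antisym subsetI)
          fix x assume "x \<in> \<phi>' ` {..<dim_row M'}"
          then show "x \<in> \<phi> ` {..<dim_row M}" using n dim by (auto simp: \<phi>'_def)
        next
          fix x assume "x \<in> \<phi> ` {..<dim_row M}"
          then obtain t where t: "t < Suc n" "x = \<phi> t" using n by auto
          show "x \<in> \<phi>' ` {..<dim_row M'}"
          proof (cases "t \<le> k")
            case True
            then show ?thesis using t n dim by (intro image_eqI[of _ _ t]) (auto simp: \<phi>'_def)
          next
            case False
            have "x = \<phi>' (t - 1)"
            proof (cases "t = Suc k")
              case True then show ?thesis using t eq by (simp add: \<phi>'_def)
            next
              case neq: False
              then have "\<not> t - 1 \<le> k" "Suc (t - 1) = t" using False by auto
              then show ?thesis using t by (simp add: \<phi>'_def)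
            qed
            then show ?thesis using t n dim False by (intro image_eqI[of _ _ "t - 1"]) auto
          qed
        qed
        then show "\<phi>' ` {..<dim_row M'} = {..<p}" using less.prems(1) by (simp add: mono_onto_def)
      qed
      show "u' i = 1" if i: "i < dim_row M'" "\<And>l. l < dim_row M' \<Longrightarrow> \<phi>' l = \<phi>' i \<Longrightarrow> l = i" for i
      proof (cases "i = k")
        case True then show ?thesis by (simp add: u'_def)
      next
        case False
        define t where "t = (if i < k then i else Suc i)"
        have t: "t < dim_row M" "\<phi>' i = \<phi> t" "u' i = u t"
          using i(1) False n dim by (auto simp: t_def \<phi>'_def u'_def)
        have "u t = 1"
        proof (rule less.prems(2)[OF t(1)])
          fix l assume l: "l < dim_row M" "\<phi> l = \<phi> t"
          define s where "s = (if l \<le> k then l else l - 1)"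
          have "s < dim_row M'" using l(1) n dim by (auto simp: s_def)
          moreover have "\<phi>' s = \<phi> l"
          proof (cases "l \<le> Suc k")
            case True then show ?thesis using eq by (auto simp: s_def \<phi>'_def le_Suc_eq)
          next
            case False
            then have "\<not> l \<le> k" "\<not> l - 1 \<le> k" "Suc (l - 1) = l" by auto
            then show ?thesis by (simp add: s_def \<phi>'_def)
          qed
          ultimately have s: "s < dim_row M'" "\<phi>' s = \<phi> l" by auto
          then have "s = i" using i(2) t l by metis
          then show "l = t" using False by (auto simp: s_def t_def split: if_splits)
        qed
        then show ?thesis using t by simp
      qed
    qed
    moreover have "weighted_sum_operation M M'" unfolding M'_def by (rule weighted_sum_operation.rows[OF r])
    ultimately show ?thesis unfolding linear_minor_def by (metis converse_rtranclp_into_rtranclp)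
  qed
qed

text \<open>When no part is a singleton, the restriction on lone rows is vacuous and all weights are
  free. Columns are contracted before rows.\<close>

lemma linear_minor_bilinear_contraction:
  fixes M :: "'a::field mat"
  assumes phi: "mono_onto (dim_row M) p \<phi>" and psi: "mono_onto (dim_col M) q \<psi>"
    and u: "\<And>k. k < dim_row M \<Longrightarrow> \<exists>l<dim_row M. \<phi> l = \<phi> k \<and> l \<noteq> k"
    and v: "\<And>k. k < dim_col M \<Longrightarrow> \<exists>l<dim_col M. \<psi> l = \<psi> k \<and> l \<noteq> k"
  shows "linear_minor (bilinear_contraction p q \<phi> \<psi> u v M) M"
proof -
  define A where "A = transpose_mat (row_contraction q \<psi> v (transpose_mat M))"
  have "linear_minor (row_contraction q \<psi> v (transpose_mat M)) (transpose_mat M)"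
    by (rule linear_minor_row_contraction) (use psi v in auto)
  then have A: "linear_minor A M" unfolding A_def using linear_minor_transpose by fastforce
  have dim: "dim_row A = dim_row M" "dim_col A = q" by (simp_all add: A_def row_contraction_def)
  have "linear_minor (row_contraction p \<phi> u A) A"
    by (rule linear_minor_row_contraction) (use phi u dim in auto)
  then have "linear_minor (row_contraction p \<phi> u A) M"
    using A unfolding linear_minor_def by (meson rtranclp_trans)
  moreover have "row_contraction p \<phi> u A = bilinear_contraction p q \<phi> \<psi> u v M"
  proof (rule eq_matI)
    fix i j assume "i < dim_row (bilinear_contraction p q \<phi> \<psi> u v M)" "j < dim_col (bilinear_contraction p q \<phi> \<psi> u v M)"
    then have ij: "i < p" "j < q" by (simp_all add: bilinear_contraction_def)
    have "(if \<phi> k = i then u k * A $$ (k, j) else 0) =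
      (\<Sum>l<dim_col M. if \<phi> k = i \<and> \<psi> l = j then u k * v l * M $$ (k, l) else 0)" if "k < dim_row M" for k
    proof -
      have "A $$ (k, j) = (\<Sum>l<dim_col M. if \<psi> l = j then v l * M $$ (k, l) else 0)"
        using ij that by (auto simp: A_def row_contraction_def intro!: sum.cong)
      then show ?thesis by (auto simp: sum_distrib_left mult.assoc intro!: sum.cong)
    qed
    then show "row_contraction p \<phi> u A $$ (i, j) = bilinear_contraction p q \<phi> \<psi> u v M $$ (i, j)"
      using ij by (simp add: row_contraction_def bilinear_contraction_def dim)
  qed (simp_all add: row_contraction_def bilinear_contraction_def dim)
  ultimately show ?thesis by simp
qed

section \<open>Solving for the weights\<close>

text \<open>Linearly independent vectors admit any prescribed inner products. In the induction step
  a vector orthogonal to the first n of them but not to the last one is needed; if there were none,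
  the last one would be a combination of the others.\<close>

lemma independent_imp_dual:
  fixes w :: "nat \<Rightarrow> 'k \<Rightarrow> 'a::field"
  assumes "finite X" and "\<And>c. (\<forall>x\<in>X. (\<Sum>j<n. c j * w j x) = 0) \<Longrightarrow> \<forall>j<n. c j = 0"
  shows "\<exists>u. \<forall>j<n. (\<Sum>x\<in>X. u x * w j x) = t j"
  using assms(2)
proof (induction n arbitrary: t)
  case (Suc n)
  define ip where "ip u j = (\<Sum>x\<in>X. u x * w j x)" for u j
  have ind: "\<forall>j<n. c j = 0" if c: "\<forall>x\<in>X. (\<Sum>j<n. c j * w j x) = 0" for c
  proof -
    have "\<forall>j<Suc n. (c(n := 0)) j = 0"
      by (rule Suc.prems) (use c in \<open>simp add: sum.lessThan_Suc\<close>)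
    then show ?thesis by (auto simp: less_Suc_eq split: if_splits)
  qed
  have "\<forall>i. \<exists>u. \<forall>j<n. ip u j = (if j = i then 1 else 0)"
    unfolding ip_def by (rule allI, rule Suc.IH[OF ind])
  from choice[OF this] obtain e where "\<forall>i. \<forall>j<n. ip (e i) j = (if j = i then 1 else 0)"
    by (elim exE)
  then have e: "\<And>i j. j < n \<Longrightarrow> ip (e i) j = (if j = i then 1 else 0)" by blast
  have "\<exists>z. (\<forall>j<n. ip z j = 0) \<and> ip z n \<noteq> 0"
  proof (rule ccontr)
    assume neg: "\<not> ?thesis"
    \<comment> \<open>The candidate relation expresses \<open>w n\<close> through the other vectors,
      with coefficients read off from the dual family \<open>e\<close>; its entry -1 contradicts
      independence.\<close>
    define c where "c j = (if j < n then ip (e j) n else -1)" for j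
    have "(\<Sum>j<Suc n. c j * w j x) = 0" if x: "x \<in> X" for x
    proof -
      \<comment> \<open>This is the unit vector at \<open>x\<close> made orthogonal to the first n
        vectors. Its product with \<open>w n\<close>, which vanishes by assumption, is coordinate
        \<open>x\<close> of the relation.\<close>
      define z where "z y = (if y = x then 1 else 0) - (\<Sum>i<n. w i x * e i y)" for y
      have ipz: "ip z j = w j x - (\<Sum>i<n. w i x * ip (e i) j)" for j
      proof -
        have "ip z j = (\<Sum>y\<in>X. (if y = x then w j y else 0)) - (\<Sum>y\<in>X. \<Sum>i<n. w i x * (e i y * w j y))"
          unfolding ip_def z_def sum_subtractf[symmetric]
          by (intro sum.cong) (auto simp: left_diff_distrib sum_distrib_right mult.assoc)
        also have "(\<Sum>y\<in>X. (if y = x then w j y else 0)) = w j x" using x assms(1) by simp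
        also have "(\<Sum>y\<in>X. \<Sum>i<n. w i x * (e i y * w j y)) = (\<Sum>i<n. w i x * ip (e i) j)"
          unfolding ip_def by (subst sum.swap) (simp add: sum_distrib_left)
        finally show ?thesis .
      qed
      have "ip z j = 0" if "j < n" for j
      proof -
        have "(\<Sum>i<n. w i x * ip (e i) j) = (\<Sum>i<n. if i = j then w i x else 0)"
          using e[OF that] by (intro sum.cong) auto
        then show ?thesis using that by (simp add: ipz)
      qed
      then have "ip z n = 0" using neg by blast
      then have "w n x = (\<Sum>i<n. w i x * ip (e i) n)" using ipz[of n] by simp
      also have "\<dots> = (\<Sum>i<n. c i * w i x)" by (intro sum.cong) (auto simp: c_def)
      finally show ?thesis by (simp add: c_def)
    qed
    then have "c n = 0" using Suc.prems[of c] by blast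
    then show False by (simp add: c_def)
  qed
  then obtain z where z: "\<And>j. j < n \<Longrightarrow> ip z j = 0" "ip z n \<noteq> 0" by blast
  have "\<exists>u. \<forall>j<n. ip u j = t j" unfolding ip_def by (rule Suc.IH[OF ind])
  then obtain u0 where u0: "\<And>j. j < n \<Longrightarrow> ip u0 j = t j" by blast
  define s where "s = (t n - ip u0 n) / ip z n"
  have "ip (\<lambda>x. u0 x + s * z x) j = ip u0 j + s * ip z j" for j
    by (simp add: ip_def distrib_right sum.distrib sum_distrib_left mult.assoc)
  then have "\<forall>j<Suc n. ip (\<lambda>x. u0 x + s * z x) j = t j"
    using z u0 by (auto simp: less_Suc_eq s_def)
  then show ?case unfolding ip_def by (rule exI[of _ "\<lambda>x. u0 x + s * z x"])
qed simp

text \<open>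
  Adding the unit vectors of pairwise distinct columns to the solutions of a linear system moves
  them to pairwise distinct vectors, which bounds the number of solutions.
\<close>

lemma card_annihilated_le:
  fixes f :: "nat \<Rightarrow> 'k \<Rightarrow> 'a::{field, finite}"
  assumes W: "W \<subseteq> {..<n}" "\<And>l l'. l \<in> W \<Longrightarrow> l' \<in> W \<Longrightarrow> (\<forall>k\<in>X. f l k = f l' k) \<Longrightarrow> l = l'"
  shows "card {v \<in> {..<n} \<rightarrow>\<^sub>E UNIV. \<forall>k\<in>X. (\<Sum>l<n. v l * f l k) = 0} * card W \<le> CARD('a) ^ n"
proof -
  let ?B = "{v \<in> {..<n} \<rightarrow>\<^sub>E UNIV. \<forall>k\<in>X. (\<Sum>l<n. v l * f l k) = 0}"
  let ?h = "\<lambda>(v, w). v(w := v w + 1)"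
  have shift: "(\<Sum>l<n. (v(w := v w + 1)) l * f l k) = f w k"
    if "v \<in> ?B" "w \<in> W" "k \<in> X" for v w k
  proof -
    have w: "w < n" using that W by auto
    have "(\<Sum>l<n. (v(w := v w + 1)) l * f l k) = (\<Sum>l<n. v l * f l k + (if l = w then f l k else 0))"
      by (intro sum.cong) (auto simp: distrib_right)
    also have "\<dots> = f w k" using that w by (simp add: sum.distrib)
    finally show ?thesis .
  qed
  have "inj_on ?h (?B \<times> W)"
  proof (rule inj_onI, clarify)
    fix v w v' w' assume a: "v \<in> {..<n} \<rightarrow>\<^sub>E UNIV" "\<forall>k\<in>X. (\<Sum>l<n. v l * f l k) = 0" "w \<in> W"
      "v' \<in> {..<n} \<rightarrow>\<^sub>E UNIV" "\<forall>k\<in>X. (\<Sum>l<n. v' l * f l k) = 0" "w' \<in> W"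
      and eq: "v(w := v w + 1) = v'(w' := v' w' + 1)"
    have "f w k = f w' k" if "k \<in> X" for k
      using shift[of v w k] shift[of v' w' k] a that eq by simp
    then have ww: "w = w'" using W(2) a by blast
    have "v l = v' l" for l
      using fun_cong[OF eq, of l] ww by (cases "l = w") auto
    then show "v = v' \<and> w = w'" using ww by auto
  qed
  moreover have "?h ` (?B \<times> W) \<subseteq> {..<n} \<rightarrow>\<^sub>E UNIV"
    using W(1) by (fastforce simp: PiE_iff extensional_def)
  ultimately have "card (?B \<times> W) \<le> card ({..<n} \<rightarrow>\<^sub>E (UNIV :: 'a set))"
    by (intro card_inj_on_le[of ?h]) (auto intro: finite_PiE)
  then show ?thesis by (simp add: card_cartesian_product card_PiE)
qed

text \<open>One \<open>v\<close> must serve all row parts, whereas \<open>u\<close> can be chosen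
  separately on each of them. For each row part and each nonzero coefficient vector at most a
  fraction 1/K of all v is bad, and K exceeds the number of such pairs.\<close>

lemma exists_weights:
  fixes M :: "nat \<Rightarrow> nat \<Rightarrow> 'a::{field, finite}"
  assumes psi: "\<And>l. l < n \<Longrightarrow> \<psi> l < q"
    and zone: "\<And>i j. i < p \<Longrightarrow> j < q \<Longrightarrow> \<exists>W. W \<subseteq> {l. l < n \<and> \<psi> l = j} \<and> p * CARD('a) ^ q < card W \<and>
      (\<forall>l\<in>W. \<forall>l'\<in>W. (\<forall>k. k < m \<and> \<phi> k = i \<longrightarrow> M k l = M k l') \<longrightarrow> l = l')"
  shows "\<exists>u v. \<forall>i<p. \<forall>j<q. (\<Sum>k<m. \<Sum>l<n. if \<phi> k = i \<and> \<psi> l = j then u k * v l * M k l else 0) = N i j"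
proof -
  define R where "R i = {k. k < m \<and> \<phi> k = i}" for i
  have finR: "finite (R i)" for i by (simp add: R_def)
  define V where "V = ({..<n} \<rightarrow>\<^sub>E (UNIV :: 'a set))"
  define \<Lambda> where "\<Lambda> = {c \<in> {..<q} \<rightarrow>\<^sub>E (UNIV :: 'a set). \<exists>j<q. c j \<noteq> 0}"
  \<comment> \<open>For these v, the vector \<open>c\<close> is a linear relation between the
    products Z v of the zones in row part i. The distinct columns of a zone with a nonzero
    coefficient remain distinct after scaling, which makes such v rare.\<close>
  define bad where "bad i c = {v \<in> V. \<forall>k\<in>R i. (\<Sum>l<n. v l * (c (\<psi> l) * M k l)) = 0}" for i c
  define K where "K = Suc (p * CARD('a) ^ q)"
  have cV: "card V = CARD('a) ^ n" by (simp add: V_def card_PiE)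
  have finV: "finite V" by (simp add: V_def finite_PiE)
  have fin\<Lambda>: "finite \<Lambda>" by (rule finite_subset[of _ "{..<q} \<rightarrow>\<^sub>E UNIV"]) (auto simp: \<Lambda>_def finite_PiE)
  have c\<Lambda>: "card \<Lambda> \<le> CARD('a) ^ q"
  proof -
    have "card \<Lambda> \<le> card ({..<q} \<rightarrow>\<^sub>E (UNIV :: 'a set))"
      by (rule card_mono) (auto simp: \<Lambda>_def finite_PiE)
    then show ?thesis by (simp add: card_PiE)
  qed
  have bad_le: "card (bad i c) * K \<le> CARD('a) ^ n" if i: "i < p" and c: "c \<in> \<Lambda>" for i c
  proof -
    obtain j where j: "j < q" "c j \<noteq> 0" using c by (auto simp: \<Lambda>_def)
    obtain W where W: "W \<subseteq> {l. l < n \<and> \<psi> l = j}" "p * CARD('a) ^ q < card W"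
      "\<forall>l\<in>W. \<forall>l'\<in>W. (\<forall>k. k < m \<and> \<phi> k = i \<longrightarrow> M k l = M k l') \<longrightarrow> l = l'"
      using zone[OF i j(1)] by (elim exE conjE)
    have "card (bad i c) * card W \<le> CARD('a) ^ n"
      unfolding bad_def V_def
    proof (rule card_annihilated_le)
      show "W \<subseteq> {..<n}" using W(1) by auto
      fix l l' assume l: "l \<in> W" "l' \<in> W" "\<forall>k\<in>R i. c (\<psi> l) * M k l = c (\<psi> l') * M k l'"
      have "\<psi> l = j" "\<psi> l' = j" using l W(1) by auto
      then have "\<forall>k. k < m \<and> \<phi> k = i \<longrightarrow> M k l = M k l'" using l(3) j(2) by (simp add: R_def)
      then show "l = l'" using W(3) l by blast
    qed
    moreover have "card (bad i c) * K \<le> card (bad i c) * card W"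
      using W(2) by (intro mult_le_mono2) (simp add: K_def)
    ultimately show ?thesis by (rule le_trans[rotated])
  qed
  have "\<exists>v\<in>V. \<forall>i<p. \<forall>c\<in>\<Lambda>. v \<notin> bad i c"
  proof (rule ccontr)
    assume "\<not> ?thesis"
    then have "V \<subseteq> (\<Union>(i, c)\<in>{..<p} \<times> \<Lambda>. bad i c)" by blast
    moreover have "finite (\<Union>(i, c)\<in>{..<p} \<times> \<Lambda>. bad i c)"
      by (rule finite_subset[OF _ finV]) (auto simp: bad_def)
    ultimately have "card V \<le> card (\<Union>(i, c)\<in>{..<p} \<times> \<Lambda>. bad i c)" by (rule card_mono[rotated])
    also have "\<dots> \<le> (\<Sum>(i, c)\<in>{..<p} \<times> \<Lambda>. card (bad i c))"
      using card_UN_le[of "{..<p} \<times> \<Lambda>" "\<lambda>(i, c). bad i c"] fin\<Lambda> by (simp add: case_prod_unfold)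
    finally have "card V * K \<le> (\<Sum>(i, c)\<in>{..<p} \<times> \<Lambda>. card (bad i c)) * K" by simp
    also have "\<dots> = (\<Sum>(i, c)\<in>{..<p} \<times> \<Lambda>. card (bad i c) * K)"
      by (simp add: sum_distrib_right case_prod_unfold)
    also have "\<dots> \<le> (\<Sum>(i, c)\<in>{..<p} \<times> \<Lambda>. card V)"
      using bad_le cV by (intro sum_mono) auto
    also have "\<dots> = card V * (p * card \<Lambda>)" by (simp add: card_cartesian_product)
    also have "\<dots> \<le> card V * (p * CARD('a) ^ q)" using c\<Lambda> by simp
    finally have "card V * K \<le> card V * (p * CARD('a) ^ q)" .
    moreover have "0 < card V" unfolding cV by (simp add: card_gt_0_iff)
    ultimately show False by (simp add: K_def)
  qed
  then obtain v where v: "v \<in> V" "\<And>i c. i < p \<Longrightarrow> c \<in> \<Lambda> \<Longrightarrow> v \<notin> bad i c" by blast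
  define w where "w j k = (\<Sum>l<n. if \<psi> l = j then v l * M k l else 0)" for j k
  have dual: "\<exists>u. \<forall>j<q. (\<Sum>k\<in>R i. u k * w j k) = N i j" if i: "i < p" for i
  proof (rule independent_imp_dual[OF finR])
    fix c assume c: "\<forall>k\<in>R i. (\<Sum>j<q. c j * w j k) = 0"
    show "\<forall>j<q. c j = 0"
    proof (rule ccontr)
      assume "\<not> ?thesis"
      then have L: "restrict c {..<q} \<in> \<Lambda>" by (auto simp: \<Lambda>_def)
      have "(\<Sum>l<n. v l * (restrict c {..<q} (\<psi> l) * M k l)) = 0" if k: "k \<in> R i" for k
      proof -
        have "(\<Sum>j<q. c j * w j k) = (\<Sum>l<n. \<Sum>j<q. if \<psi> l = j then c j * (v l * M k l) else 0)"
          unfolding w_def by (subst sum.swap) (auto simp: sum_distrib_left intro!: sum.cong)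
        also have "\<dots> = (\<Sum>l<n. v l * (restrict c {..<q} (\<psi> l) * M k l))"
          using psi by (intro sum.cong) auto
        finally show ?thesis using c k by simp
      qed
      then have "v \<in> bad i (restrict c {..<q})" using v(1) by (simp add: bad_def)
      then show False using v(2)[OF i L] by simp
    qed
  qed
  have "\<forall>i. \<exists>u. i < p \<longrightarrow> (\<forall>j<q. (\<Sum>k\<in>R i. u k * w j k) = N i j)" using dual by simp
  from choice[OF this] obtain U where "\<forall>i. i < p \<longrightarrow> (\<forall>j<q. (\<Sum>k\<in>R i. U i k * w j k) = N i j)"
    by (elim exE)
  then have U: "\<And>i j. i < p \<Longrightarrow> j < q \<Longrightarrow> (\<Sum>k\<in>R i. U i k * w j k) = N i j" by blast
  have "(\<Sum>k<m. \<Sum>l<n. if \<phi> k = i \<and> \<psi> l = j then U (\<phi> k) k * v l * M k l else 0) = N i j"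
    if ij: "i < p" "j < q" for i j
  proof -
    have "(\<Sum>k<m. \<Sum>l<n. if \<phi> k = i \<and> \<psi> l = j then U (\<phi> k) k * v l * M k l else 0) =
      (\<Sum>k<m. if \<phi> k = i then U i k * w j k else 0)"
      unfolding w_def by (auto simp: sum_distrib_left mult.assoc intro!: sum.cong)
    also have "\<dots> = (\<Sum>k\<in>R i. U i k * w j k)"
      by (simp add: R_def sum.If_cases Int_def lessThan_def)
    finally show ?thesis using U ij by simp
  qed
  then have "\<forall>i<p. \<forall>j<q. (\<Sum>k<m. \<Sum>l<n. if \<phi> k = i \<and> \<psi> l = j then U (\<phi> k) k * v l * M k l else 0) = N i j"
    by blast
  then show ?thesis by (rule exI[of _ v, THEN exI[of _ "\<lambda>k. U (\<phi> k) k"]])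
qed

section \<open>Bounded twin-width excludes a linear minor\<close>

text \<open>A row of block (j, l) of the contraction depends only on the total weight that its row
  part gives to each type. There are at most |F|^D such weight vectors but w rows, so two rows of
  the block agree, which is impossible in an identity matrix.\<close>

lemma few_row_types_contradiction:
  fixes F :: "nat \<Rightarrow> nat \<Rightarrow> 'a::{field, finite}" and \<tau> :: "nat \<Rightarrow> 't"
  assumes w: "CARD('a) ^ D < w"
    and eq: "\<And>i J. i div w = j \<Longrightarrow> J div w = l \<Longrightarrow>
      (\<Sum>r<m. \<Sum>c<n. if \<phi> r = i \<and> \<psi> c = J then u r * v c * F r c else 0) = (if i mod w = J mod w then 1 else 0)"
    and types: "card (\<tau> ` {r. r < m \<and> \<phi> r div w = j}) \<le> D"
    and same: "\<And>r r' c. r < m \<Longrightarrow> \<phi> r div w = j \<Longrightarrow> r' < m \<Longrightarrow> \<phi> r' div w = j \<Longrightarrow> \<tau> r = \<tau> r' \<Longrightarrow>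
      c < n \<Longrightarrow> \<psi> c div w = l \<Longrightarrow> F r c = F r' c"
  shows False
proof -
  have w0: "0 < w" using w by simp
  define R where "R = {r. r < m \<and> \<phi> r div w = j}"
  define T where "T = \<tau> ` R"
  have finT: "finite T" by (simp add: T_def R_def)
  define co where "co i = restrict (\<lambda>t. \<Sum>r<m. if \<phi> r = i \<and> \<tau> r = t then u r else 0) T" for i
  define I where "I = {j * w..<Suc j * w}"
  have Idiv: "i div w = j" if "i \<in> I" for i
    using that w0 unfolding I_def by (intro div_nat_eqI) (auto simp: mult.commute)
  have "card (co ` I) \<le> card (T \<rightarrow>\<^sub>E (UNIV :: 'a set))"
    by (rule card_mono) (auto simp: co_def finT finite_PiE)
  also have "\<dots> = CARD('a) ^ card T" by (simp add: card_PiE finT)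
  also have "\<dots> \<le> CARD('a) ^ D"
    using types unfolding T_def R_def by (intro power_increasing) (auto simp: Suc_le_eq card_gt_0_iff)
  also have "\<dots> < card I" using w by (simp add: I_def)
  finally have "\<not> inj_on co I" using card_image by fastforce
  then obtain i i' where i: "i \<in> I" "i' \<in> I" "i \<noteq> i'" "co i = co i'" unfolding inj_on_def by blast
  define H where "H J r = (\<Sum>c<n. if \<psi> c = J then v c * F r c else 0)" for J r
  define rep where "rep t = (SOME r. r \<in> R \<and> \<tau> r = t)" for t
  have rep: "rep t \<in> R" "\<tau> (rep t) = t" if "t \<in> T" for t
    using someI_ex[of "\<lambda>r. r \<in> R \<and> \<tau> r = t"] that unfolding rep_def T_def by auto
  have entry_sum: "(\<Sum>t\<in>T. co i t * H J (rep t)) = (if i mod w = J mod w then 1 else 0)"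
    if i: "i \<in> I" and J: "J div w = l" for i J
  proof -
    have H: "H J r = H J (rep (\<tau> r))" if r: "r \<in> R" for r
    proof -
      have t: "\<tau> r \<in> T" using r by (simp add: T_def)
      show ?thesis unfolding H_def
      proof (intro sum.cong refl)
        fix c assume "c \<in> {..<n}"
        then show "(if \<psi> c = J then v c * F r c else 0) = (if \<psi> c = J then v c * F (rep (\<tau> r)) c else 0)"
          using same[of r "rep (\<tau> r)" c] r rep[OF t] J by (auto simp: R_def)
      qed
    qed
    have "(\<Sum>t\<in>T. co i t * H J (rep t)) = (\<Sum>t\<in>T. \<Sum>r<m. if \<phi> r = i \<and> \<tau> r = t then u r * H J (rep t) else 0)"
      by (auto simp: co_def sum_distrib_right intro!: sum.cong)
    also have "\<dots> = (\<Sum>r<m. \<Sum>t\<in>T. if \<phi> r = i \<and> \<tau> r = t then u r * H J (rep t) else 0)"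
      by (rule sum.swap)
    also have "\<dots> = (\<Sum>r<m. \<Sum>c<n. if \<phi> r = i \<and> \<psi> c = J then u r * v c * F r c else 0)"
    proof (rule sum.cong[OF refl])
      fix r assume r: "r \<in> {..<m}"
      show "(\<Sum>t\<in>T. if \<phi> r = i \<and> \<tau> r = t then u r * H J (rep t) else 0) =
        (\<Sum>c<n. if \<phi> r = i \<and> \<psi> c = J then u r * v c * F r c else 0)"
      proof (cases "\<phi> r = i")
        case True
        then have R: "r \<in> R" using r Idiv[OF i] by (simp add: R_def)
        then have "\<tau> r \<in> T" by (simp add: T_def)
        then have "(\<Sum>t\<in>T. if \<phi> r = i \<and> \<tau> r = t then u r * H J (rep t) else 0) = u r * H J (rep (\<tau> r))"
          using True finT by simp
        also have "\<dots> = u r * H J r" using H[OF R] by simp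
        also have "\<dots> = (\<Sum>c<n. if \<phi> r = i \<and> \<psi> c = J then u r * v c * F r c else 0)"
          unfolding H_def using True by (auto simp: sum_distrib_left mult.assoc intro!: sum.cong)
        finally show ?thesis .
      qed simp
    qed
    also have "\<dots> = (if i mod w = J mod w then 1 else 0)" by (rule eq[OF Idiv[OF i] J])
    finally show ?thesis .
  qed
  \<comment> \<open>In this column of block l the rows \<open>i\<close> and \<open>i'\<close> of the
    identity have the entries 1 and 0.\<close>
  define J where "J = l * w + i mod w"
  have J: "J div w = l" "J mod w = i mod w" using w0 by (simp_all add: J_def)
  have "i mod w \<noteq> i' mod w" using i Idiv by (metis div_mult_mod_eq)
  then show False using entry_sum[OF i(1) J(1)] entry_sum[OF i(2) J(1)] i(4) J(2) by simp
qed

text \<open>Elements on both sides of group \<open>j\<close> are what counts: by the order, every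
  other part meeting that group is then red-adjacent to \<open>X\<close>. The embedding \<iota> lets
  one argument treat rows and columns.\<close>

definition spans :: "(nat \<Rightarrow> 'u) \<Rightarrow> (nat \<Rightarrow> nat) \<Rightarrow> nat \<Rightarrow> 'u set \<Rightarrow> bool" where
  "spans \<iota> g m X \<longleftrightarrow> (\<exists>r1 r2 j. r1 < m \<and> r2 < m \<and> \<iota> r1 \<in> X \<and> \<iota> r2 \<in> X \<and> g r1 < j \<and> j < g r2)"

text \<open>The side of the spanning part is A, the opposite side is B. Two elements of group
  \<open>j\<close> in the same part can differ at an element of B only if its part is red-adjacent
  or equal to theirs. Such parts reach too few of the k groups of B, and on a group not reached the
  parts serve as row types.\<close>

lemma spanning_part_contradiction:
  fixes \<iota>A \<iota>B :: "nat \<Rightarrow> 'u" and F :: "nat \<Rightarrow> nat \<Rightarrow> 'a::{field, finite}"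
  assumes fin: "finite U" and P: "partition_on U \<P>" and deg: "red_degree_le S d \<P>"
    and A: "\<And>r. r < m \<Longrightarrow> \<iota>A r \<in> U" and B: "\<And>c. c < n \<Longrightarrow> \<iota>B c \<in> U"
    and order: "\<And>r y r'. r < y \<Longrightarrow> y < r' \<Longrightarrow> r' < m \<Longrightarrow> atomic_type S (\<iota>A r) (\<iota>A y) \<noteq> atomic_type S (\<iota>A r') (\<iota>A y)"
    and entry: "\<And>r r' c. r < m \<Longrightarrow> r' < m \<Longrightarrow> c < n \<Longrightarrow> F r c \<noteq> F r' c \<Longrightarrow>
      atomic_type S (\<iota>A r) (\<iota>B c) \<noteq> atomic_type S (\<iota>A r') (\<iota>B c)"
    and X: "X \<in> \<P>" "spans \<iota>A (\<lambda>r. \<phi> r div w) m X" and phi: "mono_onto m (k * w) \<phi>"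
    and small: "\<And>Y. Y \<in> \<P> \<Longrightarrow> card ((\<lambda>c. \<psi> c div w) ` {c. c < n \<and> \<iota>B c \<in> Y}) \<le> 4"
    and k: "4 * ((d + 1) * (d + 1)) < k" and w: "CARD('a) ^ (d + 1) < w"
    and eq: "\<And>i J. i < k * w \<Longrightarrow> J < k * w \<Longrightarrow>
      (\<Sum>r<m. \<Sum>c<n. if \<phi> r = i \<and> \<psi> c = J then u r * v c * F r c else 0) = (if i mod w = J mod w then 1 else 0)"
  shows False
proof -
  obtain ra rb j where r: "ra < m" "rb < m" "\<iota>A ra \<in> X" "\<iota>A rb \<in> X" "\<phi> ra div w < j" "j < \<phi> rb div w"
    using X(2) unfolding spans_def by (elim exE conjE)
  have w0: "0 < w" using w by simp
  have between: "ra < r \<and> r < rb" if "r < m" "\<phi> r div w = j" for r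
  proof -
    have mono: "\<phi> a div w \<le> \<phi> b div w" if "a \<le> b" "b < m" for a b
      using phi that by (simp add: mono_onto_def div_le_mono)
    show ?thesis using mono[of r ra] mono[of rb r] r that by (metis not_le)
  qed
  have finP: "finite \<P>" by (rule finite_partition[OF fin P])
  have ex: "\<exists>Y. Y \<in> \<P> \<and> x \<in> Y" if "x \<in> U" for x using that partition_onD1[OF P] by blast
  define part where "part x = (SOME Y. Y \<in> \<P> \<and> x \<in> Y)" for x
  have part: "part x \<in> \<P>" "x \<in> part x" if "x \<in> U" for x
    using someI_ex[OF ex[OF that]] unfolding part_def by auto
  define N where "N Z = insert Z {Y \<in> \<P>. red_adjacent S Z Y}" for Z
  have finN: "finite (N Z)" for Z using finP by (simp add: N_def)
  have NP: "N Z \<subseteq> \<P>" if "Z \<in> \<P>" for Z using that by (auto simp: N_def)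
  have cN: "card (N Z) \<le> d + 1" if "Z \<in> \<P>" for Z
  proof -
    have "card (N Z) \<le> Suc (card {Y \<in> \<P>. red_adjacent S Z Y})"
      unfolding N_def by (rule card_insert_le_m1) simp_all
    then show ?thesis using deg that by (force simp: red_degree_le_def)
  qed
  have near: "part (\<iota>A x) \<in> N X" if x: "x < m" "\<phi> x div w = j" for x
  proof (cases "part (\<iota>A x) = X")
    case False
    have "ra < x" "x < rb" using between[OF x] by auto
    then have "atomic_type S (\<iota>A ra) (\<iota>A x) \<noteq> atomic_type S (\<iota>A rb) (\<iota>A x)" using order r(2) by blast
    then have "red_adjacent S X (part (\<iota>A x))"
      using r(3,4) part[OF A[OF x(1)]] False unfolding red_adjacent_def by blast
    then show ?thesis using part[OF A[OF x(1)]] by (simp add: N_def)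
  qed (simp add: N_def)
  \<comment> \<open>Group \<open>j\<close> is covered by the at most d + 1 parts in
    \<open>N X\<close>; \<open>Q\<close> collects them and all their red neighbours.\<close>
  define Q where "Q = (\<Union>Z\<in>N X. N Z)"
  have finQ: "finite Q" using finN by (simp add: Q_def)
  have QP: "Q \<subseteq> \<P>" using NP[OF X(1)] NP unfolding Q_def by blast
  have "card Q \<le> (\<Sum>Z\<in>N X. card (N Z))" unfolding Q_def by (rule card_UN_le[OF finN])
  also have "\<dots> \<le> (\<Sum>Z\<in>N X. d + 1)" using cN NP[OF X(1)] by (intro sum_mono) blast
  also have "\<dots> = card (N X) * (d + 1)" by simp
  also have "\<dots> \<le> (d + 1) * (d + 1)" using cN[OF X(1)] by (rule mult_le_mono1)
  finally have cQ: "card Q \<le> (d + 1) * (d + 1)" .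
  define hit where "hit = (\<Union>Y\<in>Q. (\<lambda>c. \<psi> c div w) ` {c. c < n \<and> \<iota>B c \<in> Y})"
  have finhit: "finite hit" using finQ by (simp add: hit_def)
  have "card hit \<le> (\<Sum>Y\<in>Q. card ((\<lambda>c. \<psi> c div w) ` {c. c < n \<and> \<iota>B c \<in> Y}))" unfolding hit_def by (rule card_UN_le[OF finQ])
  also have "\<dots> \<le> (\<Sum>Y\<in>Q. 4)" using small QP by (intro sum_mono) blast
  also have "\<dots> < k" using cQ k by simp
  finally have "card hit < card {..<k}" by simp
  \<comment> \<open>In block (j, l) every part is homogeneous on group \<open>j\<close>.\<close>
  then obtain l where l: "l < k" "l \<notin> hit" using card_mono[OF finhit, of "{..<k}"] by fastforce
  define \<tau> where "\<tau> r = part (\<iota>A r)" for r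
  have "card (\<tau> ` {r. r < m \<and> \<phi> r div w = j}) \<le> card (N X)"
    using near finN by (intro card_mono) (auto simp: \<tau>_def)
  then have 1: "card (\<tau> ` {r. r < m \<and> \<phi> r div w = j}) \<le> d + 1" using cN[OF X(1)] by simp
  have 2: "F r c = F r' c"
    if x: "r < m" "\<phi> r div w = j" "r' < m" "\<phi> r' div w = j" "\<tau> r = \<tau> r'" and c: "c < n" "\<psi> c div w = l" for r r' c
  proof (rule ccontr)
    assume "F r c \<noteq> F r' c"
    then have "atomic_type S (\<iota>A r) (\<iota>B c) \<noteq> atomic_type S (\<iota>A r') (\<iota>B c)" using entry x c by blast
    moreover have "\<iota>A r \<in> \<tau> r" "\<iota>A r' \<in> \<tau> r" using part A x unfolding \<tau>_def by metis+
    moreover have "\<iota>B c \<in> part (\<iota>B c)" "part (\<iota>B c) \<in> \<P>" using part[OF B[OF c(1)]] by auto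
    ultimately have "part (\<iota>B c) \<in> N (\<tau> r)" unfolding N_def red_adjacent_def by blast
    then have "part (\<iota>B c) \<in> Q" using near[OF x(1,2)] unfolding Q_def \<tau>_def by blast
    then have "l \<in> hit" using c \<open>\<iota>B c \<in> part (\<iota>B c)\<close> unfolding hit_def by blast
    then show False using l by blast
  qed
  have "\<phi> rb < k * w" using phi r(2) by (auto simp: mono_onto_def)
  then have "\<phi> rb div w < k" by (simp add: less_mult_imp_div_less)
  then have j: "j < k" using r(6) by simp
  have block: "i < k * w" if "i div w < k" for i using that w0 by (simp add: div_less_iff_less_mult)
  show False
  proof (rule few_row_types_contradiction[OF w _ 1])
    show "F r c = F r' c" if "r < m" "\<phi> r div w = j" "r' < m" "\<phi> r' div w = j" "\<tau> r = \<tau> r'"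
      "c < n" "\<psi> c div w = l" for r r' c using that by (rule 2)
    show "(\<Sum>r<m. \<Sum>c<n. if \<phi> r = i \<and> \<psi> c = J then u r * v c * F r c else 0) =
      (if i mod w = J mod w then 1 else 0)" if "i div w = j" "J div w = l" for i J
      using eq block that j l(1) by simp
  qed
qed

text \<open>No integer fits strictly between two elements, so at most two consecutive ones occur.
  This is the source of the 2 groups met by a part that does not span.\<close>

lemma card_no_gap:
  fixes G :: "nat set"
  assumes "finite G" "\<And>a b j. a \<in> G \<Longrightarrow> b \<in> G \<Longrightarrow> a < j \<Longrightarrow> \<not> j < b"
  shows "card G \<le> 2"
proof (cases "G = {}")
  case False
  have "G \<subseteq> {Min G, Suc (Min G)}"
  proof
    fix b assume b: "b \<in> G"
    have "\<not> Suc (Min G) < b" using assms(2)[OF Min_in[OF assms(1) False] b, of "Suc (Min G)"] by simp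
    moreover have "Min G \<le> b" using assms(1) b by simp
    ultimately show "b \<in> {Min G, Suc (Min G)}" by auto
  qed
  then have "card G \<le> card {Min G, Suc (Min G)}" by (intro card_mono) auto
  then show ?thesis by simp
qed simp

lemma card_groups_not_spans:
  assumes "\<not> spans \<iota> g m X"
  shows "card (g ` {r. r < m \<and> \<iota> r \<in> X}) \<le> 2"
  by (rule card_no_gap) (use assms in \<open>auto simp: spans_def\<close>)

section \<open>How order and entries show in atomic types\<close>

lemma domain_matrix_structure [simp]:
  "domain (matrix_structure M) = {..<dim_row M} <+> {..<dim_col M}"
  by (simp add: matrix_structure_def)

lemma atomic_type_rows:
  assumes "r < y" "y < r'" "r' < dim_row M"
  shows "atomic_type (matrix_structure M) (Inl r) (Inl y) \<noteq> atomic_type (matrix_structure M) (Inl r') (Inl y)"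
proof -
  have "Less \<in> {x. (Inl r, Inl y) \<in> binary (matrix_structure M) x}"
    "Less \<notin> {x. (Inl r', Inl y) \<in> binary (matrix_structure M) x}"
    using assms by (auto simp: matrix_structure_def)
  then show ?thesis unfolding atomic_type_def by blast
qed

lemma atomic_type_cols:
  assumes "r < y" "y < r'" "r' < dim_col M"
  shows "atomic_type (matrix_structure M) (Inr r) (Inr y) \<noteq> atomic_type (matrix_structure M) (Inr r') (Inr y)"
proof -
  have "Less \<in> {x. (Inr r, Inr y) \<in> binary (matrix_structure M) x}"
    "Less \<notin> {x. (Inr r', Inr y) \<in> binary (matrix_structure M) x}"
    using assms by (auto simp: matrix_structure_def)
  then show ?thesis unfolding atomic_type_def by blast
qed

lemma atomic_type_row_entry:
  assumes "r < dim_row M" "r' < dim_row M" "c < dim_col M" "M $$ (r, c) \<noteq> M $$ (r', c)"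
  shows "atomic_type (matrix_structure M) (Inl r) (Inr c) \<noteq> atomic_type (matrix_structure M) (Inl r') (Inr c)"
proof -
  have "Entry (M $$ (r, c)) \<in> {x. (Inl r, Inr c) \<in> binary (matrix_structure M) x}"
    "Entry (M $$ (r, c)) \<notin> {x. (Inl r', Inr c) \<in> binary (matrix_structure M) x}"
    using assms by (auto simp: matrix_structure_def)
  then show ?thesis unfolding atomic_type_def by blast
qed

lemma atomic_type_col_entry:
  assumes "r < dim_row M" "c < dim_col M" "c' < dim_col M" "M $$ (r, c) \<noteq> M $$ (r, c')"
  shows "atomic_type (matrix_structure M) (Inr c) (Inl r) \<noteq> atomic_type (matrix_structure M) (Inr c') (Inl r)"
proof -
  have "Entry (M $$ (r, c)) \<in> {x. (Inl r, Inr c) \<in> binary (matrix_structure M) x}"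
    "Entry (M $$ (r, c)) \<notin> {x. (Inl r, Inr c') \<in> binary (matrix_structure M) x}"
    using assms by (auto simp: matrix_structure_def)
  then show ?thesis unfolding atomic_type_def by blast
qed

text \<open>Indices decrease along a contraction, so the first moment is the largest index with a
  big part. One step earlier no part was big, so every part is now a union of two parts that are not
  big, an unchanged part being \<open>Z \<union> Z\<close>.\<close>

lemma first_spanning_merge:
  assumes seq: "d_sequence S d P" and whole: "big (domain S)"
    and single: "\<And>u. u \<in> domain S \<Longrightarrow> \<not> big {u}" and ne: "finite (domain S)" "domain S \<noteq> {}"
  shows "\<exists>i X. partition_on (domain S) (P i) \<and> red_degree_le S d (P i) \<and> X \<in> P i \<and> big X \<and>
    (\<forall>Z\<in>P i. \<exists>A B. Z = A \<union> B \<and> \<not> big A \<and> \<not> big B)"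
proof -
  define n where "n = card (domain S)"
  have n: "1 \<le> n" using ne by (simp add: n_def Suc_le_eq card_gt_0_iff)
  have cs: "\<And>i. i \<in> {1..n} \<Longrightarrow> partition_on (domain S) (P i)" "P n = (\<lambda>u. {u}) ` domain S" "P 1 = {domain S}"
    "\<And>i. i \<in> {2..n} \<Longrightarrow> \<exists>X\<in>P i. \<exists>Y\<in>P i. X \<noteq> Y \<and> P (i - 1) = insert (X \<union> Y) (P i - {X, Y})"
    "\<And>i. i \<in> {1..n} \<Longrightarrow> red_degree_le S d (P i)"
    using seq unfolding d_sequence_def contraction_sequence_def n_def red_degree_le_def by simp_all
  define I where "I = {i \<in> {1..n}. \<exists>X\<in>P i. big X}"
  have "1 \<in> I" using n cs(3) whole by (simp add: I_def)
  moreover have finI: "finite I" by (simp add: I_def)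
  ultimately have i: "Max I \<in> I" by (intro Max_in) auto
  define i where "i = Max I"
  have iI: "i \<in> I" using i by (simp add: i_def)
  have "n \<notin> I" using cs(2) single by (auto simp: I_def)
  then have "i < n" using iI by (cases "i = n") (auto simp: I_def)
  have "Suc i \<notin> I"
  proof
    assume "Suc i \<in> I"
    then have "Suc i \<le> i" unfolding i_def using finI by (rule Max_ge[rotated])
    then show False by simp
  qed
  then have none: "\<not> big Z" if "Z \<in> P (Suc i)" for Z using that \<open>i < n\<close> by (auto simp: I_def)
  have "Suc i \<in> {2..n}" using iI \<open>i < n\<close> by (simp add: I_def)
  from cs(4)[OF this] obtain X Y where XY: "X \<in> P (Suc i)" "Y \<in> P (Suc i)" "P i = insert (X \<union> Y) (P (Suc i) - {X, Y})"
    by auto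
  have "\<exists>A B. Z = A \<union> B \<and> \<not> big A \<and> \<not> big B" if Z: "Z \<in> P i" for Z
  proof (cases "Z = X \<union> Y")
    case True then show ?thesis using none XY by blast
  next
    case False then have "Z \<in> P (Suc i)" using Z XY by blast
    then show ?thesis using none by (intro exI[of _ Z]) simp
  qed
  moreover obtain Z where "Z \<in> P i" "big Z" using iI by (auto simp: I_def)
  moreover have "partition_on (domain S) (P i)" "red_degree_le S d (P i)" using cs(1,5) iI by (simp_all add: I_def)
  ultimately show ?thesis by blast
qed

text \<open>The block size \<open>w\<close> exceeds the number of weight vectors for d + 1 types. At
  most (d + 1)^2 parts, each meeting at most 4 groups, must leave some group free, whence the main
  term of \<open>k\<close>; the summand 3 provides groups 0, 1 and 2, so that the whole domain spans
  group 1.\<close>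

lemma twin_width_excludes_linear_minor:
  fixes d :: nat
  defines "w \<equiv> Suc (CARD('a::{field, finite}) ^ (d + 1))" and "k \<equiv> 4 * ((d + 1) * (d + 1)) + 3"
  defines "N \<equiv> mat (k * w) (k * w) (\<lambda>(i, j). if i mod w = j mod w then 1 else 0 :: 'a)"
  assumes tww: "twin_width (matrix_structure M) \<le> d"
  shows "\<not> linear_minor N M"
proof
  let ?S = "matrix_structure M"
  assume "linear_minor N M"
  from linear_minor_imp_bilinear_contraction[OF this]
  obtain \<phi> \<psi> u v where phi: "mono_onto (dim_row M) (k * w) \<phi>" and psi: "mono_onto (dim_col M) (k * w) \<psi>"
    and N: "N = bilinear_contraction (k * w) (k * w) \<phi> \<psi> u v M"
    by (elim exE conjE) (simp add: N_def)
  define m where "m = dim_row M"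
  define n where "n = dim_col M"
  have w: "CARD('a) ^ (d + 1) < w" "0 < w" by (simp_all add: w_def)
  have eq: "(\<Sum>r<m. \<Sum>c<n. if \<phi> r = i \<and> \<psi> c = J then u r * v c * M $$ (r, c) else 0) =
      (if i mod w = J mod w then 1 else 0)" if "i < k * w" "J < k * w" for i J
  proof -
    have "N $$ (i, J) = (if i mod w = J mod w then 1 else 0)" using that by (simp add: N_def)
    moreover have "N $$ (i, J) = (\<Sum>r<m. \<Sum>c<n. if \<phi> r = i \<and> \<psi> c = J then u r * v c * M $$ (r, c) else 0)"
      by (subst N) (use that in \<open>simp add: bilinear_contraction_def m_def n_def\<close>)
    ultimately show ?thesis by simp
  qed
  define gA where "gA r = \<phi> r div w" for r
  define gB where "gB c = \<psi> c div w" for c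
  define big where "big X \<longleftrightarrow> spans Inl gA m X \<or> spans Inr gB n X" for X
  have fin: "finite (domain ?S)" by simp
  have whole: "big (domain ?S)"
  proof -
    have "0 < k * w" "2 * w < k * w" using w(2) by (simp_all add: k_def)
    then have "0 \<in> \<phi> ` {..<m}" "2 * w \<in> \<phi> ` {..<m}" using phi unfolding mono_onto_def m_def by auto
    then obtain r1 r2 where "r1 < m" "\<phi> r1 = 0" "r2 < m" "\<phi> r2 = 2 * w" by (metis imageE lessThan_iff)
    then have "spans Inl gA m (domain ?S)"
      unfolding spans_def using w(2) by (intro exI[of _ r1] exI[of _ r2] exI[of _ 1]) (auto simp: gA_def m_def)
    then show ?thesis by (simp add: big_def)
  qed
  have ne: "domain ?S \<noteq> {}" using whole by (auto simp: big_def spans_def)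
  have single: "\<not> big {x}" for x by (auto simp: big_def spans_def)
  obtain P where "d_sequence ?S (twin_width ?S) P" using twin_width_attained[OF fin] by (elim exE)
  from first_spanning_merge[OF this whole single fin ne]
  obtain \<P> X where P: "partition_on (domain ?S) \<P>" "red_degree_le ?S (twin_width ?S) \<P>" "X \<in> \<P>" "big X"
    "\<forall>Z\<in>\<P>. \<exists>A B. Z = A \<union> B \<and> \<not> big A \<and> \<not> big B" by (elim exE conjE)
  have deg: "red_degree_le ?S d \<P>" using P(2) tww unfolding red_degree_le_def by (meson le_trans)
  \<comment> \<open>Two parts that do not span meet at most two groups each on either side.\<close>
  have small: "card (gA ` {r. r < m \<and> Inl r \<in> Z}) \<le> 4" "card (gB ` {r. r < n \<and> Inr r \<in> Z}) \<le> 4" if Z: "Z \<in> \<P>" for Z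
  proof -
    obtain A B where AB: "Z = A \<union> B" "\<not> big A" "\<not> big B"
      using P(5)[rule_format, OF Z] by (elim exE conjE)
    have "gA ` {r. r < m \<and> Inl r \<in> Z} = gA ` {r. r < m \<and> Inl r \<in> A} \<union> gA ` {r. r < m \<and> Inl r \<in> B}"
      "gB ` {r. r < n \<and> Inr r \<in> Z} = gB ` {r. r < n \<and> Inr r \<in> A} \<union> gB ` {r. r < n \<and> Inr r \<in> B}"
      using AB(1) by auto
    moreover have "card (gA ` {r. r < m \<and> Inl r \<in> A}) \<le> 2" "card (gA ` {r. r < m \<and> Inl r \<in> B}) \<le> 2"
      "card (gB ` {r. r < n \<and> Inr r \<in> A}) \<le> 2" "card (gB ` {r. r < n \<and> Inr r \<in> B}) \<le> 2"
      using AB(2,3) by (auto simp: big_def intro: card_groups_not_spans)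
    ultimately show "card (gA ` {r. r < m \<and> Inl r \<in> Z}) \<le> 4" "card (gB ` {r. r < n \<and> Inr r \<in> Z}) \<le> 4"
      using card_Un_le[of "gA ` {r. r < m \<and> Inl r \<in> A}" "gA ` {r. r < m \<and> Inl r \<in> B}"]
        card_Un_le[of "gB ` {r. r < n \<and> Inr r \<in> A}" "gB ` {r. r < n \<and> Inr r \<in> B}"] by simp_all
  qed
  have k: "4 * ((d + 1) * (d + 1)) < k" by (simp add: k_def)
  consider "spans Inl gA m X" | "spans Inr gB n X" using P(4) by (auto simp: big_def)
  then show False
  proof cases
    case 1
    show False
    proof (rule spanning_part_contradiction[OF fin P(1) deg _ _ _ _ P(3) 1[unfolded gA_def] phi[folded m_def] _ k w(1) eq])
      show "atomic_type ?S (Inl r) (Inl y) \<noteq> atomic_type ?S (Inl r') (Inl y)" if "r < y" "y < r'" "r' < m" for r y r'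
        using that unfolding m_def by (rule atomic_type_rows)
      show "atomic_type ?S (Inl r) (Inr c) \<noteq> atomic_type ?S (Inl r') (Inr c)"
        if "r < m" "r' < m" "c < n" "M $$ (r, c) \<noteq> M $$ (r', c)" for r r' c
        using that unfolding m_def n_def by (rule atomic_type_row_entry)
      show "card ((\<lambda>c. \<psi> c div w) ` {c. c < n \<and> Inr c \<in> Y}) \<le> 4" if "Y \<in> \<P>" for Y
        using small(2)[OF that] unfolding gB_def .
    qed (auto simp: m_def n_def)
  next
    case 2
    show False
    proof (rule spanning_part_contradiction[OF fin P(1) deg _ _ _ _ P(3) 2[unfolded gB_def] psi[folded n_def] _ k w(1)])
      show "atomic_type ?S (Inr r) (Inr y) \<noteq> atomic_type ?S (Inr r') (Inr y)" if "r < y" "y < r'" "r' < n" for r y r'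
        using that unfolding n_def by (rule atomic_type_cols)
      show "atomic_type ?S (Inr r) (Inl c) \<noteq> atomic_type ?S (Inr r') (Inl c)"
        if "r < n" "r' < n" "c < m" "M $$ (c, r) \<noteq> M $$ (c, r')" for r r' c
        using that(3,1,2,4) unfolding m_def n_def by (rule atomic_type_col_entry)
      show "card ((\<lambda>c. \<phi> c div w) ` {c. c < m \<and> Inl c \<in> Y}) \<le> 4" if "Y \<in> \<P>" for Y
        using small(1)[OF that] unfolding gA_def .
      show "(\<Sum>c<n. \<Sum>r<m. if \<psi> c = i \<and> \<phi> r = J then v c * u r * M $$ (r, c) else 0) =
        (if i mod w = J mod w then 1 else 0)" if "i < k * w" "J < k * w" for i J
      proof -
        have "(\<Sum>c<n. \<Sum>r<m. if \<psi> c = i \<and> \<phi> r = J then v c * u r * M $$ (r, c) else 0) =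
          (\<Sum>r<m. \<Sum>c<n. if \<phi> r = J \<and> \<psi> c = i then u r * v c * M $$ (r, c) else 0)"
          by (subst sum.swap) (auto intro!: sum.cong)
        also have "\<dots> = (if J mod w = i mod w then 1 else 0)" using eq that by simp
        finally show ?thesis by (simp add: eq_commute)
      qed
    qed (auto simp: m_def n_def)
  qed
qed

section \<open>Greedy contraction of divisions\<close>

text \<open>Taking consecutive instead of just disjoint intervals loses nothing: complexity survives
  enlargement, so gaps can be absorbed.\<close>

definition chain :: "(nat \<Rightarrow> nat \<Rightarrow> bool) \<Rightarrow> nat \<Rightarrow> nat \<Rightarrow> nat \<Rightarrow> bool" where
  "chain cx g u t \<longleftrightarrow> (\<exists>x. u \<le> x 0 \<and> x g \<le> t \<and> (\<forall>k<g. cx (x k) (x (Suc k))))"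

text \<open>This is all that the greedy argument uses about complexity. Unlike the count of distinct
  columns, it is symmetric in rows and columns; finiteness is demanded because cardinalities are
  monotone only for finite sets.\<close>

definition zone_predicate :: "(nat set \<Rightarrow> nat set \<Rightarrow> bool) \<Rightarrow> bool" where
  "zone_predicate cz \<longleftrightarrow>
     (\<forall>R C R' C'. cz R C \<longrightarrow> R \<subseteq> R' \<longrightarrow> C \<subseteq> C' \<longrightarrow> finite R' \<longrightarrow> finite C' \<longrightarrow> cz R' C') \<and>
     (\<forall>R C. cz R C \<longrightarrow> R \<noteq> {} \<and> C \<noteq> {})"

definition segment :: "nat \<Rightarrow> (nat \<Rightarrow> nat) \<Rightarrow> nat \<Rightarrow> nat \<Rightarrow> nat set" where
  "segment m \<rho> x y = {r. r < m \<and> x \<le> \<rho> r \<and> \<rho> r < y}"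

text \<open>
  A division is given by the maps \<open>\<rho>\<close> and \<open>\<gamma>\<close> that send rows and columns to the indices of their
  parts; \<open>s\<close> and \<open>t\<close> bound these indices.
\<close>

definition poor :: "nat \<Rightarrow> (nat set \<Rightarrow> nat set \<Rightarrow> bool) \<Rightarrow>
    nat \<Rightarrow> (nat \<Rightarrow> nat) \<Rightarrow> nat \<Rightarrow> nat \<Rightarrow> (nat \<Rightarrow> nat) \<Rightarrow> nat \<Rightarrow> bool" where
  "poor g cz m \<rho> s n \<gamma> t \<longleftrightarrow>
     (\<forall>a<s. \<not> chain (\<lambda>x y. cz (segment m \<rho> a (Suc a)) (segment n \<gamma> x y)) g 0 t) \<and>
     (\<forall>b<t. \<not> chain (\<lambda>x y. cz (segment m \<rho> x y) (segment n \<gamma> b (Suc b))) g 0 s)"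

definition zone_grid :: "nat \<Rightarrow> (nat set \<Rightarrow> nat set \<Rightarrow> bool) \<Rightarrow>
    nat \<Rightarrow> (nat \<Rightarrow> nat) \<Rightarrow> nat \<Rightarrow> (nat \<Rightarrow> nat) \<Rightarrow> bool" where
  "zone_grid p cz m \<rho> n \<gamma> \<longleftrightarrow> (\<exists>\<alpha> \<beta>. \<forall>k<p. \<forall>l<p.
     cz (segment m \<rho> (\<alpha> k) (\<alpha> (Suc k))) (segment n \<gamma> (\<beta> l) (\<beta> (Suc l))))"

definition merge_parts :: "nat \<Rightarrow> (nat \<Rightarrow> nat) \<Rightarrow> nat \<Rightarrow> nat" where
  "merge_parts a \<rho> r = (if \<rho> r \<le> a then \<rho> r else \<rho> r - 1)"

lemma finite_segment [simp]: "finite (segment m \<rho> x y)"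
  by (simp add: segment_def)

lemma segment_mono: "x' \<le> x \<Longrightarrow> y \<le> y' \<Longrightarrow> segment m \<rho> x y \<subseteq> segment m \<rho> x' y'"
  by (auto simp: segment_def)

lemma segment_nonempty: "segment m \<rho> x y \<noteq> {} \<Longrightarrow> x < y"
  by (auto simp: segment_def)

lemma zone_mono:
  assumes "zone_predicate cz" "cz R C" "R \<subseteq> R'" "C \<subseteq> C'" "finite R'" "finite C'"
  shows "cz R' C'"
  using assms unfolding zone_predicate_def by blast

lemma zone_nonempty:
  assumes "zone_predicate cz" "cz R C"
  shows "R \<noteq> {}" "C \<noteq> {}"
  using assms unfolding zone_predicate_def by blast+

lemma zone_predicate_swap: "zone_predicate cz \<Longrightarrow> zone_predicate (\<lambda>C R. cz R C)"
  unfolding zone_predicate_def by blast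

lemma poor_swap: "poor g cz m \<rho> s n \<gamma> t \<longleftrightarrow> poor g (\<lambda>C R. cz R C) n \<gamma> t m \<rho> s"
  unfolding poor_def by (rule conj_commute)

lemma zone_grid_swap:
  assumes "zone_grid p (\<lambda>C R. cz R C) n \<gamma> m \<rho>"
  shows "zone_grid p cz m \<rho> n \<gamma>"
proof -
  obtain \<alpha> \<beta> where "\<forall>k<p. \<forall>l<p. cz (segment m \<rho> (\<beta> l) (\<beta> (Suc l))) (segment n \<gamma> (\<alpha> k) (\<alpha> (Suc k)))"
    using assms unfolding zone_grid_def by (elim exE)
  then have "\<forall>k<p. \<forall>l<p. cz (segment m \<rho> (\<beta> k) (\<beta> (Suc k))) (segment n \<gamma> (\<alpha> l) (\<alpha> (Suc l)))" by simp
  then show ?thesis unfolding zone_grid_def by (rule exI[of _ \<alpha>, THEN exI[of _ \<beta>]])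
qed

text \<open>The boundary between the parts a and a + 1 disappears, so the boundaries behind it are
  renumbered by one.\<close>

lemma segment_merge_parts:
  "segment m (merge_parts a \<rho>) x y =
   segment m \<rho> (if x \<le> a then x else Suc x) (if y \<le> a then y else Suc y)"
  unfolding segment_def merge_parts_def by (intro Collect_cong) auto

lemma chain_unmerge:
  assumes "chain (\<lambda>x y. cx (if x \<le> a then x else Suc x) (if y \<le> a then y else Suc y)) g 0 (s - 1)" and "Suc a < s"
  shows "chain cx g 0 s"
proof -
  obtain x where x: "x g \<le> s - 1"
    "\<forall>k<g. cx (if x k \<le> a then x k else Suc (x k)) (if x (Suc k) \<le> a then x (Suc k) else Suc (x (Suc k)))"
    using assms(1) unfolding chain_def by (elim exE conjE)
  show ?thesis
    unfolding chain_def
    by (intro exI[of _ "\<lambda>k. if x k \<le> a then x k else Suc (x k)"] conjI) (use x assms(2) in auto)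
qed

text \<open>Only the united part can violate the invariant. For the opposite parts, a chain over the
  coarser division is also one over the finer division.\<close>

lemma poor_merge:
  assumes poor: "poor g cz m \<rho> s n \<gamma> t" and a: "Suc a < s"
    and merged: "\<not> chain (\<lambda>x y. cz (segment m \<rho> a (Suc (Suc a))) (segment n \<gamma> x y)) g 0 t"
  shows "poor g cz m (merge_parts a \<rho>) (s - 1) n \<gamma> t"
  unfolding poor_def segment_merge_parts
proof (intro conjI allI impI)
  fix a' assume a': "a' < s - 1"
  consider "a' < a" | "a' = a" | "a < a'" by linarith
  then show "\<not> chain (\<lambda>x y. cz (segment m \<rho> (if a' \<le> a then a' else Suc a') (if Suc a' \<le> a then Suc a' else Suc (Suc a')))
      (segment n \<gamma> x y)) g 0 t"
    using poor a' merged a unfolding poor_def by cases auto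
next
  fix b assume b: "b < t"
  show "\<not> chain (\<lambda>x y. cz (segment m \<rho> (if x \<le> a then x else Suc x) (if y \<le> a then y else Suc y)) (segment n \<gamma> b (Suc b))) g 0 (s - 1)"
  proof
    assume "chain (\<lambda>x y. cz (segment m \<rho> (if x \<le> a then x else Suc x) (if y \<le> a then y else Suc y)) (segment n \<gamma> b (Suc b))) g 0 (s - 1)"
    then have "chain (\<lambda>x y. cz (segment m \<rho> x y) (segment n \<gamma> b (Suc b))) g 0 s"
      by (rule chain_unmerge[OF _ a, where cx = "\<lambda>x y. cz (segment m \<rho> x y) (segment n \<gamma> b (Suc b))"])
    then show False using poor b by (simp add: poor_def)
  qed
qed

text \<open>The pairs of parts 2i and 2i + 1 are disjoint, and each pair carries g intervals. With h
  = s div 2 pairs, \<open>s \<le> 3 * h\<close> holds as s is at least 2, so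
  \<open>3 * C < g\<close> gives more than C s intervals in a square of side s;
  \<open>t \<le> s\<close> makes them fit.\<close>

lemma stuck_imp_zone_grid:
  assumes cz: "zone_predicate cz"
    and C: "\<And>n T. interval_family n n T \<Longrightarrow> \<not> interval_grid p T \<Longrightarrow> card T \<le> C * n"
    and g: "3 * C < g" and ts: "t \<le> s" "2 \<le> s"
    and stuck: "\<And>a. Suc a < s \<Longrightarrow> chain (\<lambda>x y. cz (segment m \<rho> a (Suc (Suc a))) (segment n \<gamma> x y)) g 0 t"
  shows "zone_grid p cz m \<rho> n \<gamma>"
proof -
  define h where "h = s div 2"
  have h: "s \<le> 3 * h" "2 * h \<le> s" using ts by (auto simp: h_def)
  have "\<forall>i. \<exists>x. i < h \<longrightarrow> x g \<le> t \<and> (\<forall>k<g. cz (segment m \<rho> (2 * i) (Suc (Suc (2 * i)))) (segment n \<gamma> (x k) (x (Suc k))))"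
  proof
    fix i
    show "\<exists>x. i < h \<longrightarrow> x g \<le> t \<and> (\<forall>k<g. cz (segment m \<rho> (2 * i) (Suc (Suc (2 * i)))) (segment n \<gamma> (x k) (x (Suc k))))"
    proof (cases "i < h")
      case True
      then have "Suc (2 * i) < s" using h by simp
      from stuck[OF this] show ?thesis unfolding chain_def by (elim exE conjE) (intro exI impI conjI)
    qed simp
  qed
  from choice[OF this] obtain x where "\<forall>i. i < h \<longrightarrow> x i g \<le> t \<and>
      (\<forall>k<g. cz (segment m \<rho> (2 * i) (Suc (Suc (2 * i)))) (segment n \<gamma> (x i k) (x i (Suc k))))" by (elim exE)
  then have x: "x i g \<le> t"
    "\<And>k. k < g \<Longrightarrow> cz (segment m \<rho> (2 * i) (Suc (Suc (2 * i)))) (segment n \<gamma> (x i k) (x i (Suc k)))" if "i < h" for i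
    using that by simp_all
  have less: "x i k < x i (Suc k)" if "i < h" "k < g" for i k
    using zone_nonempty(2)[OF cz x(2)[OF that]] by (rule segment_nonempty)
  have mono: "x i k \<le> x i l" if "i < h" "k \<le> l" "l \<le> g" for i k l
    using that(2,3)
  proof (induction l rule: dec_induct)
    case (step l)
    then show ?case using less[OF that(1), of l] by simp
  qed simp
  define T where "T = (\<lambda>(i, k). (i, x i k, x i (Suc k))) ` ({..<h} \<times> {..<g})"
  have TE: "\<exists>k<g. i < h \<and> y = x i k \<and> z = x i (Suc k)" if "(i, y, z) \<in> T" for i y z
    using that by (auto simp: T_def)
  have fam: "interval_family s s T"
    unfolding interval_family_def
  proof (intro conjI ballI allI impI)
    fix e assume e: "e \<in> T"
    obtain i y z where [simp]: "e = (i, y, z)" by (cases e)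
    have "(i, y, z) \<in> T" using e by simp
    from TE[OF this] obtain k where k: "k < g" "i < h" "y = x i k" "z = x i (Suc k)" by blast
    have "x i (Suc k) \<le> x i g" using mono k by simp
    then show "case e of (i, x, y) \<Rightarrow> i < s \<and> x < y \<and> y \<le> s"
      using k less x(1)[of i] h ts by auto
  next
    fix i y z y' z' assume "(i, y, z) \<in> T \<and> (i, y', z') \<in> T"
    then obtain k k' where k: "k < g" "i < h" "y = x i k" "z = x i (Suc k)"
      "k' < g" "y' = x i k'" "z' = x i (Suc k')" using TE by blast
    consider "k = k'" | "Suc k \<le> k'" | "Suc k' \<le> k" by linarith
    then show "(y, z) = (y', z') \<or> z \<le> y' \<or> z' \<le> y"
    proof cases
      case 2 then show ?thesis using mono[OF k(2), of "Suc k" k'] k by simp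
    next
      case 3 then show ?thesis using mono[OF k(2), of "Suc k'" k] k by simp
    qed (use k in simp)
  qed
  have "inj_on (\<lambda>(i, k). (i, x i k, x i (Suc k))) ({..<h} \<times> {..<g})"
  proof (rule inj_onI)
    fix e e' assume e: "e \<in> {..<h} \<times> {..<g}" "e' \<in> {..<h} \<times> {..<g}"
      "(\<lambda>(i, k). (i, x i k, x i (Suc k))) e = (\<lambda>(i, k). (i, x i k, x i (Suc k))) e'"
    obtain i k i' k' where [simp]: "e = (i, k)" "e' = (i', k')" by (cases e, cases e')
    have i: "i < h" "i' = i" and kk: "k < g" "k' < g" "x i k = x i k'" using e by auto
    have "\<not> k < k'" using less[of i k] mono[of i "Suc k" k'] i kk by auto
    moreover have "\<not> k' < k" using less[of i k'] mono[of i "Suc k'" k] i kk by auto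
    ultimately show "e = e'" using i by simp
  qed
  then have "card T = h * g" unfolding T_def by (simp add: card_image card_cartesian_product)
  moreover have "C * s < h * g"
  proof -
    have "C * s \<le> C * (3 * h)" using h(1) by simp
    also have "\<dots> = h * (3 * C)" by simp
    also have "\<dots> < h * g" using g h(1) ts(2) by (intro mult_strict_left_mono) auto
    finally show ?thesis .
  qed
  ultimately have "interval_grid p T" using C[OF fam] by fastforce
  then obtain a b where ab: "\<forall>k<p. \<forall>l<p. \<exists>i x y. (i, x, y) \<in> T \<and> a k \<le> i \<and> i < a (Suc k) \<and> b l \<le> x \<and> y \<le> b (Suc l)"
    by (rule interval_gridE)
  \<comment> \<open>Row i of the family stands for two parts, so the row cuts are doubled.\<close>
  have "cz (segment m \<rho> (2 * a k) (2 * a (Suc k))) (segment n \<gamma> (b l) (b (Suc l)))" if kl: "k < p" "l < p" for k l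
  proof -
    obtain i y z where i: "(i, y, z) \<in> T" "a k \<le> i" "i < a (Suc k)" "b l \<le> y" "z \<le> b (Suc l)"
      using ab[rule_format, OF kl] by (elim exE conjE)
    obtain j where j: "j < g" "i < h" "y = x i j" "z = x i (Suc j)" using TE[OF i(1)] by (elim exE conjE)
    show ?thesis
    proof (rule zone_mono[OF cz x(2)[OF j(2,1)]])
      show "segment m \<rho> (2 * i) (Suc (Suc (2 * i))) \<subseteq> segment m \<rho> (2 * a k) (2 * a (Suc k))"
        using i by (intro segment_mono) auto
      show "segment n \<gamma> (x i j) (x i (Suc j)) \<subseteq> segment n \<gamma> (b l) (b (Suc l))"
        using i j by (intro segment_mono) auto
    qed simp_all
  qed
  then show ?thesis unfolding zone_grid_def
    by (intro exI[of _ "\<lambda>k. 2 * a k"] exI[of _ b]) simp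
qed

text \<open>A merge is sought on the side with more parts, since the extremal bound is linear in the
  larger side of the family.\<close>

lemma merge_or_zone_grid:
  assumes cz: "zone_predicate cz"
    and C: "\<And>n T. interval_family n n T \<Longrightarrow> \<not> interval_grid p T \<Longrightarrow> card T \<le> C * n"
    and g: "3 * C < g" and poor: "poor g cz m \<rho> s n \<gamma> t" and big: "2 \<le> s \<or> 2 \<le> t"
  shows "zone_grid p cz m \<rho> n \<gamma> \<or> (\<exists>a. Suc a < s \<and> poor g cz m (merge_parts a \<rho>) (s - 1) n \<gamma> t) \<or>
    (\<exists>b. Suc b < t \<and> poor g cz m \<rho> s n (merge_parts b \<gamma>) (t - 1))"
proof (cases "t \<le> s")
  case True
  show ?thesis
  proof (cases "\<exists>a. Suc a < s \<and> \<not> chain (\<lambda>x y. cz (segment m \<rho> a (Suc (Suc a))) (segment n \<gamma> x y)) g 0 t")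
    case True
    then show ?thesis using poor_merge[OF poor] by blast
  next
    case False
    then have "zone_grid p cz m \<rho> n \<gamma>"
      using \<open>t \<le> s\<close> big by (intro stuck_imp_zone_grid[OF cz C g, where s = s and t = t]) auto
    then show ?thesis by blast
  qed
next
  case False
  have poor': "poor g (\<lambda>C R. cz R C) n \<gamma> t m \<rho> s" using poor by (simp only: poor_swap[of g cz])
  show ?thesis
  proof (cases "\<exists>b. Suc b < t \<and> \<not> chain (\<lambda>x y. cz (segment m \<rho> x y) (segment n \<gamma> b (Suc (Suc b)))) g 0 s")
    case True
    then obtain b where b: "Suc b < t" "\<not> chain (\<lambda>x y. cz (segment m \<rho> x y) (segment n \<gamma> b (Suc (Suc b)))) g 0 s" by blast
    have "poor g (\<lambda>C R. cz R C) n (merge_parts b \<gamma>) (t - 1) m \<rho> s"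
      by (rule poor_merge[OF poor' b])
    then have "poor g cz m \<rho> s n (merge_parts b \<gamma>) (t - 1)" by (simp only: poor_swap[of g cz])
    then show ?thesis using b(1) by blast
  next
    case stuck: False
    have "zone_grid p (\<lambda>C R. cz R C) n \<gamma> m \<rho>"
      using \<open>\<not> t \<le> s\<close> big stuck
      by (intro stuck_imp_zone_grid[OF zone_predicate_swap[OF cz] C g, where s = t and t = s]) auto
    then show ?thesis using zone_grid_swap by blast
  qed
qed

section \<open>Counting classes of rows\<close>

lemma card_image_le_of_determined:
  assumes "finite R" "\<And>r r'. r \<in> R \<Longrightarrow> r' \<in> R \<Longrightarrow> f r = f r' \<Longrightarrow> h r = h r'"
  shows "card (h ` R) \<le> card (f ` R)"
proof (rule surj_card_le)
  show "finite (f ` R)" using assms(1) by simp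
  show "h ` R \<subseteq> (\<lambda>y. h (SOME r. r \<in> R \<and> f r = y)) ` f ` R"
  proof
    fix y assume "y \<in> h ` R"
    then obtain r where r: "r \<in> R" "y = h r" by blast
    define r' where "r' = (SOME r'. r' \<in> R \<and> f r' = f r)"
    have "r' \<in> R \<and> f r' = f r" unfolding r'_def by (rule someI[of _ r]) (use r in simp)
    then have "y = h r'" using assms(2)[of r r'] r by simp
    then show "y \<in> (\<lambda>y. h (SOME r. r \<in> R \<and> f r = y)) ` f ` R" using r(1) unfolding r'_def by blast
  qed
qed

lemma card_image_le_mult:
  assumes "finite R" "\<And>r r'. r \<in> R \<Longrightarrow> r' \<in> R \<Longrightarrow> f r = f r' \<Longrightarrow> e r = e r' \<Longrightarrow> h r = h r'"
  shows "card (h ` R) \<le> card (f ` R) * card (e ` R)"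
proof -
  have "card (h ` R) \<le> card ((\<lambda>r. (f r, e r)) ` R)"
  proof (rule card_image_le_of_determined[OF assms(1)])
    show "h r = h r'" if "r \<in> R" "r' \<in> R" "(f r, e r) = (f r', e r')" for r r'
      using that(3) by (intro assms(2)[OF that(1,2)]) simp_all
  qed
  also have "\<dots> \<le> card (f ` R \<times> e ` R)" using assms(1) by (intro card_mono) auto
  finally show ?thesis by (simp add: card_cartesian_product)
qed

text \<open>
  Cut off the shortest complex prefix of the columns: without its last part it is not complex, and
  what remains has a shorter chain.
\<close>

lemma card_types_le_of_no_chain:
  fixes val :: "nat \<Rightarrow> nat \<Rightarrow> 'v" and L :: nat
  assumes R: "finite R" and L: "1 \<le> L"
    and cx: "\<And>x y x' y'. cx x y \<Longrightarrow> x' \<le> x \<Longrightarrow> y \<le> y' \<Longrightarrow> cx x' y'" "\<And>x y. cx x y \<Longrightarrow> x < y"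
    and small: "\<And>x y. \<not> cx x y \<Longrightarrow> card ((\<lambda>r. restrict (val r) {x..<y}) ` R) \<le> L"
    and no: "\<not> chain cx g u t"
  shows "card ((\<lambda>r. restrict (val r) {b. u \<le> b \<and> b < t \<and> \<not> cx b (Suc b)}) ` R) \<le> L ^ (2 * g)"
  using no
proof (induction g arbitrary: u)
  case 0
  \<comment> \<open>A chain of length 0 is a single point, which exists whenever
    \<open>u \<le> t\<close>.\<close>
  have "\<not> u \<le> t" using 0 by (auto simp: chain_def)
  then have empty: "{b. u \<le> b \<and> b < t \<and> \<not> cx b (Suc b)} = {}" by auto
  have "card ((\<lambda>r. restrict (val r) {}) ` R) \<le> card {\<lambda>_ :: nat. undefined :: 'v}"
    by (rule card_mono) auto
  also have "\<dots> = L ^ (2 * 0)" by simp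
  finally show ?case unfolding empty .
next
  case (Suc g)
  have eq_on: "val r b = val r' b" if "restrict (val r) A = restrict (val r') A" "b \<in> A" for r r' b A
    using that by (metis restrict_apply')
  define N where "N u = {b. u \<le> b \<and> b < t \<and> \<not> cx b (Suc b)}" for u
  show ?case
  proof (cases "cx u t")
    case False
    have "card ((\<lambda>r. restrict (val r) (N u)) ` R) \<le> card ((\<lambda>r. restrict (val r) {u..<t}) ` R)"
    proof (rule card_image_le_of_determined[OF R])
      fix r r' assume e: "restrict (val r) {u..<t} = restrict (val r') {u..<t}"
      show "restrict (val r) (N u) = restrict (val r') (N u)"
        by (rule restrict_ext, rule eq_on[OF e]) (auto simp: N_def)
    qed
    also have "\<dots> \<le> L" by (rule small[OF False])
    also have "\<dots> = L ^ 1" by simp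
    also have "\<dots> \<le> L ^ (2 * Suc g)" by (rule power_increasing[OF _ L]) simp
    finally show ?thesis unfolding N_def .
  next
    case True
    define z where "z = (LEAST z. cx u z)"
    have z: "cx u z" unfolding z_def by (rule LeastI[of "cx u", OF True])
    have zt: "z \<le> t" unfolding z_def by (rule Least_le[of "cx u", OF True])
    have uz: "u < z" by (rule cx(2)[OF z])
    have z1: "\<not> cx u (z - 1)"
    proof
      assume "cx u (z - 1)"
      then have "z \<le> z - 1" unfolding z_def by (rule Least_le)
      then show False using uz by simp
    qed
    have noz: "\<not> chain cx g z t"
    proof
      assume "chain cx g z t"
      then obtain x where x: "z \<le> x 0" "x g \<le> t" "\<forall>k<g. cx (x k) (x (Suc k))"
        unfolding chain_def by (elim exE conjE)
      have "chain cx (Suc g) u t" unfolding chain_def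
      proof (intro exI[of _ "case_nat u x"] conjI allI impI)
        fix k assume "k < Suc g"
        then show "cx (case_nat u x k) (case_nat u x (Suc k))"
          using x cx(1)[OF z, of u "x 0"] by (cases k) auto
      qed (use x in auto)
      then show False using Suc.prems by simp
    qed
    define A where "A = {u..<z - 1}"
    \<comment> \<open>The prefix and its last part each contribute a factor L, hence the exponent
      2g. A last part that is itself complex lies outside the counted positions.\<close>
    define B where "B = (if cx (z - 1) z then {} else {z - 1..<z})"
    have cA: "card ((\<lambda>r. restrict (val r) A) ` R) \<le> L" unfolding A_def by (rule small[OF z1])
    have cB: "card ((\<lambda>r. restrict (val r) B) ` R) \<le> L"
    proof (cases "cx (z - 1) z")
      case True
      have "card ((\<lambda>r. restrict (val r) B) ` R) \<le> card {\<lambda>_ :: nat. undefined :: 'v}"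
        by (rule card_mono) (use True in \<open>auto simp: B_def\<close>)
      then show ?thesis using L by simp
    next
      case False
      then show ?thesis using small[OF False] by (simp add: B_def)
    qed
    have split: "b \<in> A \<or> b \<in> B \<or> b \<in> N z" if "b \<in> N u" for b
    proof -
      consider "b < z - 1" | "b = z - 1" | "z \<le> b" by linarith
      then show ?thesis using that uz by cases (auto simp: A_def B_def N_def)
    qed
    have "card ((\<lambda>r. restrict (val r) (N u)) ` R) \<le>
      card ((\<lambda>r. (restrict (val r) A, restrict (val r) B)) ` R) * card ((\<lambda>r. restrict (val r) (N z)) ` R)"
    proof (rule card_image_le_mult[OF R])
      fix r r' assume e: "(restrict (val r) A, restrict (val r) B) = (restrict (val r') A, restrict (val r') B)"
        "restrict (val r) (N z) = restrict (val r') (N z)"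
      show "restrict (val r) (N u) = restrict (val r') (N u)"
      proof (rule restrict_ext)
        fix b assume "b \<in> N u"
        then consider "b \<in> A" | "b \<in> B" | "b \<in> N z" using split by blast
        then show "val r b = val r' b"
          using e eq_on[of r A r' b] eq_on[of r B r' b] eq_on[of r "N z" r' b] by cases auto
      qed
    qed
    also have "\<dots> \<le> (L * L) * L ^ (2 * g)"
    proof (rule mult_le_mono)
      have "card ((\<lambda>r. (restrict (val r) A, restrict (val r) B)) ` R) \<le>
        card ((\<lambda>r. restrict (val r) A) ` R) * card ((\<lambda>r. restrict (val r) B) ` R)"
        by (rule card_image_le_mult[OF R]) simp
      also have "\<dots> \<le> L * L" using cA cB by (rule mult_le_mono)
      finally show "card ((\<lambda>r. (restrict (val r) A, restrict (val r) B)) ` R) \<le> L * L" .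
      show "card ((\<lambda>r. restrict (val r) (N z)) ` R) \<le> L ^ (2 * g)"
        unfolding N_def by (rule Suc.IH[OF noz])
    qed
    also have "\<dots> = L ^ (2 * Suc g)" by (simp add: mult.assoc)
    finally show ?thesis unfolding N_def .
  qed
qed

text \<open>Complex single parts can be extended to the right until they are consecutive, which
  makes them a chain.\<close>

lemma card_singletons_of_no_chain:
  assumes cx: "\<And>x y x' y'. cx x y \<Longrightarrow> x' \<le> x \<Longrightarrow> y \<le> y' \<Longrightarrow> cx x' y'"
    and no: "\<not> chain cx g 0 t"
  shows "card {b. b < t \<and> cx b (Suc b)} \<le> g"
proof (rule ccontr)
  assume "\<not> ?thesis"
  then have g: "g \<le> card {b. b < t \<and> cx b (Suc b)}" by simp
  obtain f where f: "\<And>k. k < g \<Longrightarrow> f k \<in> {b. b < t \<and> cx b (Suc b)}" "\<And>k l. k < l \<Longrightarrow> l < g \<Longrightarrow> f k < f l"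
    by (rule obtain_increasing[OF _ g]) auto
  have "chain cx g 0 t" unfolding chain_def
  \<comment> \<open>Each link runs from one chosen part to the start of the next; the last link ends
    at \<open>t\<close>.\<close>
  proof (intro exI[of _ "\<lambda>k. if k < g then f k else t"] conjI allI impI)
    fix k assume k: "k < g"
    have "Suc (f k) \<le> (if Suc k < g then f (Suc k) else t)"
      using f(1)[OF k] f(2)[of k "Suc k"] by auto
    then show "cx (if k < g then f k else t) (if Suc k < g then f (Suc k) else t)"
      using cx[of "f k" "Suc (f k)"] f(1)[OF k] k by simp
  qed simp_all
  then show False using no by blast
qed

section \<open>Complex zones\<close>

text \<open>Counting only columns costs no more than a constant: few distinct columns also force few
  distinct rows, by \<open>card_row_types_le\<close>.\<close>

definition complex_zone :: "nat \<Rightarrow> 'a mat \<Rightarrow> nat set \<Rightarrow> nat set \<Rightarrow> bool" where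
  "complex_zone Q M R C \<longleftrightarrow> Q \<le> card ((\<lambda>c. restrict (\<lambda>r. M $$ (r, c)) R) ` C)"

lemma restrict_eqD: "restrict f A = restrict h A \<Longrightarrow> x \<in> A \<Longrightarrow> f x = h x"
  by (metis restrict_apply')

text \<open>The bound 2 excludes empty zones: over an empty set of rows all columns coincide, which
  still counts as one column.\<close>

lemma zone_predicate_complex_zone:
  assumes "2 \<le> Q"
  shows "zone_predicate (complex_zone Q M)"
  unfolding zone_predicate_def
proof (intro conjI allI impI)
  fix R C R' C' :: "nat set"
  assume z: "complex_zone Q M R C" and sub: "R \<subseteq> R'" "C \<subseteq> C'" and fin: "finite R'" "finite C'"
  let ?f = "\<lambda>R c. restrict (\<lambda>r. M $$ (r, c)) R"
  have "Q \<le> card (?f R ` C)" using z by (simp add: complex_zone_def)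
  also have "\<dots> \<le> card (?f R' ` C)"
  proof (rule card_image_le_of_determined)
    show "finite C" using sub fin by (auto intro: finite_subset)
    fix c c' assume e: "?f R' c = ?f R' c'"
    show "?f R c = ?f R c'"
      by (rule restrict_ext, rule restrict_eqD[OF e]) (use sub in blast)
  qed
  also have "\<dots> \<le> card (?f R' ` C')" using sub fin by (intro card_mono) auto
  finally show "complex_zone Q M R' C'" by (simp add: complex_zone_def)
next
  fix R C assume z: "complex_zone Q M R C"
  show "C \<noteq> {}" using z assms by (auto simp: complex_zone_def)
  show "R \<noteq> {}"
  proof
    assume [simp]: "R = {}"
    have "card ((\<lambda>c. restrict (\<lambda>r. M $$ (r, c)) R) ` C) \<le> card {\<lambda>_ :: nat. undefined :: 'a}"
      by (rule card_mono) auto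
    then show False using z assms by (simp add: complex_zone_def)
  qed
qed

text \<open>A row is determined by its entries in one representative of each distinct column, and
  there are fewer than Q of these.\<close>

lemma card_row_types_le:
  fixes M :: "'a::finite mat"
  assumes fin: "finite R" "finite C" and z: "\<not> complex_zone Q M R C"
  shows "card ((\<lambda>r. restrict (\<lambda>c. M $$ (r, c)) C) ` R) \<le> CARD('a) ^ Q"
proof -
  let ?f = "\<lambda>c. restrict (\<lambda>r. M $$ (r, c)) R"
  define F where "F = ?f ` C"
  have finF: "finite F" using fin by (simp add: F_def)
  define rep where "rep f = (SOME c. c \<in> C \<and> ?f c = f)" for f
  have rep: "?f (rep (?f c)) = ?f c" if "c \<in> C" for c
    using someI[of "\<lambda>c'. c' \<in> C \<and> ?f c' = ?f c" c] that unfolding rep_def by simp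
  define e where "e r = restrict (\<lambda>f. M $$ (r, rep f)) F" for r
  have "card ((\<lambda>r. restrict (\<lambda>c. M $$ (r, c)) C) ` R) \<le> card (e ` R)"
  proof (rule card_image_le_of_determined[OF fin(1)])
    fix r r' assume r: "r \<in> R" "r' \<in> R" "e r = e r'"
    show "restrict (\<lambda>c. M $$ (r, c)) C = restrict (\<lambda>c. M $$ (r', c)) C"
    proof (rule restrict_ext)
      fix c assume c: "c \<in> C"
      have "M $$ (r, rep (?f c)) = M $$ (r', rep (?f c))"
        by (rule restrict_eqD[OF r(3)[unfolded e_def]]) (use c in \<open>simp add: F_def\<close>)
      moreover have "M $$ (r, rep (?f c)) = M $$ (r, c)" by (rule restrict_eqD[OF rep[OF c] r(1)])
      moreover have "M $$ (r', rep (?f c)) = M $$ (r', c)" by (rule restrict_eqD[OF rep[OF c] r(2)])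
      ultimately show "M $$ (r, c) = M $$ (r', c)" by simp
    qed
  qed
  also have "\<dots> \<le> card (F \<rightarrow>\<^sub>E (UNIV :: 'a set))"
    by (rule card_mono) (auto simp: e_def finF finite_PiE)
  also have "\<dots> = CARD('a) ^ card F" by (simp add: card_PiE finF)
  also have "\<dots> \<le> CARD('a) ^ Q"
    using z by (intro power_increasing) (auto simp: F_def complex_zone_def Suc_le_eq card_gt_0_iff)
  finally show ?thesis .
qed

text \<open>Thus a single row is never complex when Q exceeds the field size. This makes the finest
  division admissible and forces the parts of a complex grid to contain two rows.\<close>

lemma card_columns_of_row_le:
  fixes M :: "'a::finite mat"
  shows "card ((\<lambda>c. restrict (\<lambda>r. M $$ (r, c)) {r0}) ` C) \<le> CARD('a)"
proof -
  have "(\<lambda>c. restrict (\<lambda>r. M $$ (r, c)) {r0}) ` C \<subseteq> (\<lambda>a. restrict (\<lambda>_. a) {r0}) ` (UNIV :: 'a set)"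
  proof
    fix f assume "f \<in> (\<lambda>c. restrict (\<lambda>r. M $$ (r, c)) {r0}) ` C"
    then obtain c where "f = restrict (\<lambda>r. M $$ (r, c)) {r0}" by blast
    then have "f = restrict (\<lambda>_. M $$ (r0, c)) {r0}" by (simp only:) (rule restrict_ext, simp)
    then show "f \<in> (\<lambda>a. restrict (\<lambda>_. a) {r0}) ` UNIV" by blast
  qed
  then have "card ((\<lambda>c. restrict (\<lambda>r. M $$ (r, c)) {r0}) ` C) \<le> card ((\<lambda>a. restrict (\<lambda>_. a) {r0}) ` (UNIV :: 'a set))"
    by (rule card_mono[rotated]) simp
  also have "\<dots> \<le> CARD('a)" by (rule card_image_le) simp
  finally show ?thesis .
qed

section \<open>From divisions to partitions\<close>

definition part_zone :: "nat \<Rightarrow> 'a mat \<Rightarrow> (nat \<Rightarrow> nat) \<Rightarrow> (nat \<Rightarrow> nat) \<Rightarrow> nat \<Rightarrow> nat \<Rightarrow> bool" where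
  "part_zone Q M \<rho> \<gamma> a b \<longleftrightarrow>
     complex_zone Q M (segment (dim_row M) \<rho> a (Suc a)) (segment (dim_col M) \<gamma> b (Suc b))"

text \<open>
  Rows of one part are identified when they agree outside the complex zones of that part. Unlike
  equality outside some choice of a few column parts, this relation only grows when parts are merged.
\<close>

definition class_key :: "nat \<Rightarrow> 'a mat \<Rightarrow> (nat \<Rightarrow> nat) \<Rightarrow> (nat \<Rightarrow> nat) \<Rightarrow> nat + nat \<Rightarrow> bool \<times> nat \<times> (nat \<Rightarrow> 'a)" where
  "class_key Q M \<rho> \<gamma> x = (case x of
       Inl r \<Rightarrow> (False, \<rho> r, restrict (\<lambda>c. M $$ (r, c)) {c. c < dim_col M \<and> \<not> part_zone Q M \<rho> \<gamma> (\<rho> r) (\<gamma> c)})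
     | Inr c \<Rightarrow> (True, \<gamma> c, restrict (\<lambda>r. M $$ (r, c)) {r. r < dim_row M \<and> \<not> part_zone Q M \<rho> \<gamma> (\<rho> r) (\<gamma> c)}))"

abbreviation key_class where
  "key_class U Q M \<rho> \<gamma> u \<equiv> {x \<in> U. class_key Q M \<rho> \<gamma> x = class_key Q M \<rho> \<gamma> u}"

abbreviation key_classes where
  "key_classes Q M \<rho> \<gamma> \<equiv> fibres (class_key Q M \<rho> \<gamma>) (domain (matrix_structure M))"

abbreviation poor_division where
  "poor_division g Q M \<rho> s \<gamma> t \<equiv> poor g (complex_zone Q M) (dim_row M) \<rho> s (dim_col M) \<gamma> t"

lemma segment_part: "r \<in> segment m \<rho> a (Suc a) \<longleftrightarrow> r < m \<and> \<rho> r = a"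
  by (auto simp: segment_def)

text \<open>The types bound is applied with parts of the other side as positions:
  \<open>val i b\<close> is the whole restriction of line i to part b. The abstract
  \<open>cx\<close> covers rows and columns alike.\<close>

lemma card_classes_le:
  fixes e :: "nat \<Rightarrow> nat \<Rightarrow> 'v" and L :: nat
  assumes fin: "finite I" and L: "1 \<le> L"
    and cx: "\<And>x y x' y'. cx x y \<Longrightarrow> x' \<le> x \<Longrightarrow> y \<le> y' \<Longrightarrow> cx x' y'" "\<And>x y. cx x y \<Longrightarrow> x < y"
    and small: "\<And>x y. \<not> cx x y \<Longrightarrow> card ((\<lambda>i. restrict (e i) (segment n \<delta> x y)) ` I) \<le> L"
    and no: "\<not> chain cx g 0 t" and t: "\<And>j. j < n \<Longrightarrow> \<delta> j < t"
    and key: "\<And>i i'. i \<in> I \<Longrightarrow> i' \<in> I \<Longrightarrow> (\<And>j. j < n \<Longrightarrow> \<not> cx (\<delta> j) (Suc (\<delta> j)) \<Longrightarrow> e i j = e i' j) \<Longrightarrow> key i = key i'"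
  shows "card (key ` I) \<le> L ^ (2 * g)"
proof -
  define val where "val i b = restrict (e i) (segment n \<delta> b (Suc b))" for i b
  define B where "B = {b. 0 \<le> b \<and> b < t \<and> \<not> cx b (Suc b)}"
  have "card (key ` I) \<le> card ((\<lambda>i. restrict (val i) B) ` I)"
  proof (rule card_image_le_of_determined[OF fin])
    fix i i' assume i: "i \<in> I" "i' \<in> I" and eq: "restrict (val i) B = restrict (val i') B"
    show "key i = key i'"
    proof (rule key[OF i])
      fix j assume j: "j < n" "\<not> cx (\<delta> j) (Suc (\<delta> j))"
      have "val i (\<delta> j) = val i' (\<delta> j)" by (rule restrict_eqD[OF eq]) (use j t in \<open>simp add: B_def\<close>)
      then show "e i j = e i' j" unfolding val_def by (rule restrict_eqD) (use j in \<open>simp add: segment_part\<close>)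
    qed
  qed
  also have "\<dots> \<le> L ^ (2 * g)"
    unfolding B_def
  proof (rule card_types_le_of_no_chain[OF fin L cx _ no])
    show "card ((\<lambda>i. restrict (val i) {x..<y}) ` I) \<le> L" if "\<not> cx x y" for x y
    proof -
      have "card ((\<lambda>i. restrict (val i) {x..<y}) ` I) \<le> card ((\<lambda>i. restrict (e i) (segment n \<delta> x y)) ` I)"
      proof (rule card_image_le_of_determined[OF fin])
        fix i i' assume eq: "restrict (e i) (segment n \<delta> x y) = restrict (e i') (segment n \<delta> x y)"
        show "restrict (val i) {x..<y} = restrict (val i') {x..<y}"
          unfolding val_def by (intro restrict_ext, rule restrict_eqD[OF eq]) (auto simp: segment_def)
      qed
      also have "\<dots> \<le> L" by (rule small[OF that])
      finally show ?thesis .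
    qed
  qed
  finally show ?thesis .
qed

lemma card_row_classes_le:
  fixes M :: "'a::finite mat"
  assumes Q: "2 \<le> Q" and poor: "poor_division g Q M \<rho> s \<gamma> t"
    and a: "a < s" and t: "\<And>c. c < dim_col M \<Longrightarrow> \<gamma> c < t"
  shows "card (class_key Q M \<rho> \<gamma> ` Inl ` segment (dim_row M) \<rho> a (Suc a)) \<le> (CARD('a) ^ Q) ^ (2 * g)"
proof -
  define R where "R = segment (dim_row M) \<rho> a (Suc a)"
  have finR: "finite R" by (simp add: R_def)
  have cz: "zone_predicate (complex_zone Q M)" by (rule zone_predicate_complex_zone[OF Q])
  show ?thesis
    unfolding R_def[symmetric] image_image
  proof (rule card_classes_le[OF finR, where cx = "\<lambda>x y. complex_zone Q M R (segment (dim_col M) \<gamma> x y)"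
        and n = "dim_col M" and \<delta> = \<gamma> and t = t and e = "\<lambda>r c. M $$ (r, c)"])
    show "1 \<le> CARD('a) ^ Q" by (simp add: Suc_le_eq card_gt_0_iff)
    show "complex_zone Q M R (segment (dim_col M) \<gamma> x' y')"
      if "complex_zone Q M R (segment (dim_col M) \<gamma> x y)" "x' \<le> x" "y \<le> y'" for x y x' y'
      using that(1) by (rule zone_mono[OF cz]) (use that finR in \<open>auto simp: segment_def\<close>)
    show "x < y" if "complex_zone Q M R (segment (dim_col M) \<gamma> x y)" for x y
      using zone_nonempty(2)[OF cz that] by (rule segment_nonempty)
    show "\<not> chain (\<lambda>x y. complex_zone Q M R (segment (dim_col M) \<gamma> x y)) g 0 t"
      using poor a unfolding poor_def R_def by simp
    fix r r' assume "r \<in> R" "r' \<in> R" and eq: "\<And>c. c < dim_col M \<Longrightarrow>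
      \<not> complex_zone Q M R (segment (dim_col M) \<gamma> (\<gamma> c) (Suc (\<gamma> c))) \<Longrightarrow> M $$ (r, c) = M $$ (r', c)"
    then have "\<rho> r = a" "\<rho> r' = a" by (simp_all add: R_def segment_part)
    then show "class_key Q M \<rho> \<gamma> (Inl r) = class_key Q M \<rho> \<gamma> (Inl r')"
      using eq by (simp add: class_key_def part_zone_def R_def cong: restrict_cong)
  qed (use t finR in \<open>auto intro: card_row_types_le\<close>)
qed

lemma card_col_classes_le:
  fixes M :: "'a::finite mat"
  assumes Q: "2 \<le> Q" and q: "2 \<le> CARD('a)" and poor: "poor_division g Q M \<rho> s \<gamma> t"
    and b: "b < t" and s: "\<And>r. r < dim_row M \<Longrightarrow> \<rho> r < s"
  shows "card (class_key Q M \<rho> \<gamma> ` Inr ` segment (dim_col M) \<gamma> b (Suc b)) \<le> (CARD('a) ^ Q) ^ (2 * g)"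
proof -
  define C where "C = segment (dim_col M) \<gamma> b (Suc b)"
  have finC: "finite C" by (simp add: C_def)
  have cz: "zone_predicate (complex_zone Q M)" by (rule zone_predicate_complex_zone[OF Q])
  \<comment> \<open>For columns the definition of complexity bounds the count by Q directly; this is
    weakened to the bound for rows.\<close>
  have "Q \<le> 2 ^ Q" by (rule less_imp_le[OF less_exp])
  also have "\<dots> \<le> CARD('a) ^ Q" using q by (rule power_mono) simp
  finally have QL: "Q \<le> CARD('a) ^ Q" .
  show ?thesis
    unfolding C_def[symmetric] image_image
  proof (rule card_classes_le[OF finC, where cx = "\<lambda>x y. complex_zone Q M (segment (dim_row M) \<rho> x y) C"
        and n = "dim_row M" and \<delta> = \<rho> and t = s and e = "\<lambda>c r. M $$ (r, c)"])
    show "1 \<le> CARD('a) ^ Q" by (simp add: Suc_le_eq card_gt_0_iff)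
    show "complex_zone Q M (segment (dim_row M) \<rho> x' y') C"
      if "complex_zone Q M (segment (dim_row M) \<rho> x y) C" "x' \<le> x" "y \<le> y'" for x y x' y'
      using that(1) by (rule zone_mono[OF cz]) (use that finC in \<open>auto simp: segment_def\<close>)
    show "x < y" if "complex_zone Q M (segment (dim_row M) \<rho> x y) C" for x y
      using zone_nonempty(1)[OF cz that] by (rule segment_nonempty)
    show "\<not> chain (\<lambda>x y. complex_zone Q M (segment (dim_row M) \<rho> x y) C) g 0 s"
      using poor b unfolding poor_def C_def by simp
    show "card ((\<lambda>c. restrict (\<lambda>r. M $$ (r, c)) (segment (dim_row M) \<rho> x y)) ` C) \<le> CARD('a) ^ Q"
      if "\<not> complex_zone Q M (segment (dim_row M) \<rho> x y) C" for x y
      using that QL unfolding complex_zone_def by linarith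
    fix c c' assume "c \<in> C" "c' \<in> C" and eq: "\<And>r. r < dim_row M \<Longrightarrow>
      \<not> complex_zone Q M (segment (dim_row M) \<rho> (\<rho> r) (Suc (\<rho> r))) C \<Longrightarrow> M $$ (r, c) = M $$ (r, c')"
    then have "\<gamma> c = b" "\<gamma> c' = b" by (simp_all add: C_def segment_part)
    then show "class_key Q M \<rho> \<gamma> (Inr c) = class_key Q M \<rho> \<gamma> (Inr c')"
      using eq by (simp add: class_key_def part_zone_def C_def cong: restrict_cong)
  qed (use s in auto)
qed

section \<open>Red adjacency between classes\<close>

lemma atomic_type_Inl_Inl:
  assumes "i < dim_row M" "j < dim_row M"
  shows "atomic_type (matrix_structure M) (Inl i) (Inl j) =
    (UNIV, UNIV, {x. x = Less \<and> i < j}, {x. x = Less \<and> j < i})"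
  using assms
  by (auto simp: atomic_type_def matrix_structure_def split: matrix_relation.splits)
    (metis matrix_relation.exhaust)+

lemma atomic_type_Inr_Inr:
  assumes "i < dim_col M" "j < dim_col M"
  shows "atomic_type (matrix_structure M) (Inr i) (Inr j) =
    ({}, {}, {x. x = Less \<and> i < j}, {x. x = Less \<and> j < i})"
  using assms
  by (auto simp: atomic_type_def matrix_structure_def split: matrix_relation.splits)
    (metis matrix_relation.exhaust)+

lemma atomic_type_Inl_Inr:
  assumes "i < dim_row M" "j < dim_col M"
  shows "atomic_type (matrix_structure M) (Inl i) (Inr j) = (UNIV, {}, {Less, Entry (M $$ (i, j))}, {})"
  using assms
  by (auto simp: atomic_type_def matrix_structure_def split: matrix_relation.splits)
    (metis matrix_relation.exhaust)+

lemma atomic_type_Inr_Inl: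
  assumes "i < dim_row M" "j < dim_col M"
  shows "atomic_type (matrix_structure M) (Inr j) (Inl i) = ({}, UNIV, {}, {Less, Entry (M $$ (i, j))})"
  using assms
  by (auto simp: atomic_type_def matrix_structure_def split: matrix_relation.splits)
    (metis matrix_relation.exhaust)+

text \<open>Exchange first the row and then the column. Both exchanges stay in the same simple zone
  because the keys record the parts.\<close>

lemma class_key_entry:
  assumes "class_key Q M \<rho> \<gamma> (Inl i) = class_key Q M \<rho> \<gamma> (Inl r)" "class_key Q M \<rho> \<gamma> (Inr j) = class_key Q M \<rho> \<gamma> (Inr c)"
    and "r < dim_row M" "j < dim_col M" "\<not> part_zone Q M \<rho> \<gamma> (\<rho> r) (\<gamma> c)"
  shows "M $$ (i, j) = M $$ (r, c)"
proof -
  have e: "\<rho> i = \<rho> r" "\<gamma> j = \<gamma> c" using assms(1,2) by (simp_all add: class_key_def)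
  have "restrict (\<lambda>c. M $$ (i, c)) {c. c < dim_col M \<and> \<not> part_zone Q M \<rho> \<gamma> (\<rho> r) (\<gamma> c)} =
    restrict (\<lambda>c. M $$ (r, c)) {c. c < dim_col M \<and> \<not> part_zone Q M \<rho> \<gamma> (\<rho> r) (\<gamma> c)}"
    using assms(1) by (simp add: class_key_def e)
  from restrict_eqD[OF this, of j] have 1: "M $$ (i, j) = M $$ (r, j)" using assms(4,5) e by simp
  have "restrict (\<lambda>r. M $$ (r, j)) {r. r < dim_row M \<and> \<not> part_zone Q M \<rho> \<gamma> (\<rho> r) (\<gamma> c)} =
    restrict (\<lambda>r. M $$ (r, c)) {r. r < dim_row M \<and> \<not> part_zone Q M \<rho> \<gamma> (\<rho> r) (\<gamma> c)}"
    using assms(2) by (simp add: class_key_def e)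
  from restrict_eqD[OF this, of r] have 2: "M $$ (r, j) = M $$ (r, c)" using assms(3,5) by simp
  show ?thesis using 1 2 by simp
qed

lemma class_key_sides [simp]:
  "class_key Q M \<rho> \<gamma> (Inl i) \<noteq> class_key Q M \<rho> \<gamma> (Inr j)"
  "class_key Q M \<rho> \<gamma> (Inr j) \<noteq> class_key Q M \<rho> \<gamma> (Inl i)"
  by (simp_all add: class_key_def)

lemma red_adjacent_fibres:
  fixes f :: "'u \<Rightarrow> 'k"
  assumes "red_adjacent S {x \<in> U. f x = f u} {y \<in> U. f y = f v}"
    and "\<And>x y. x \<in> U \<Longrightarrow> y \<in> U \<Longrightarrow> f x = f u \<Longrightarrow> f y = f v \<Longrightarrow> atomic_type S x y = T"
  shows False
  using assms unfolding red_adjacent_def by fastforce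

text \<open>Classes in different parts lie in disjoint intervals, so all their pairs are ordered in
  the same way. On one side, red adjacency therefore occurs only within a part.\<close>

lemma not_red_same_side:
  fixes \<iota> :: "nat \<Rightarrow> nat + nat" and key :: "nat + nat \<Rightarrow> 'k" and g :: "nat \<Rightarrow> nat"
  assumes mono: "\<And>i j. i \<le> j \<Longrightarrow> j < m \<Longrightarrow> g i \<le> g j" and ne: "g r \<noteq> g r'"
    and key: "\<And>x i. x \<in> U \<Longrightarrow> key x = key (\<iota> i) \<Longrightarrow> \<exists>j<m. x = \<iota> j \<and> g j = g i"
    and type: "\<And>i j. i < m \<Longrightarrow> j < m \<Longrightarrow> atomic_type S (\<iota> i) (\<iota> j) = (A, A, {x. x = Less \<and> i < j}, {x. x = Less \<and> j < i})"
  shows "\<not> red_adjacent S {x \<in> U. key x = key (\<iota> r)} {x \<in> U. key x = key (\<iota> r')}"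
proof
  assume "red_adjacent S {x \<in> U. key x = key (\<iota> r)} {x \<in> U. key x = key (\<iota> r')}"
  then show False
  proof (rule red_adjacent_fibres)
    fix x y assume xy: "x \<in> U" "y \<in> U" "key x = key (\<iota> r)" "key y = key (\<iota> r')"
    obtain i j where i: "i < m" "x = \<iota> i" "g i = g r" and j: "j < m" "y = \<iota> j" "g j = g r'"
      using key[OF xy(1,3)] key[OF xy(2,4)] by blast
    have "i < j \<longleftrightarrow> g r < g r'" "j < i \<longleftrightarrow> g r' < g r"
      using mono[of i j] mono[of j i] i(1,3) j(1,3) ne by (metis le_antisym nat_le_linear not_le)+
    then show "atomic_type S x y = (A, A, {x. x = Less \<and> g r < g r'}, {x. x = Less \<and> g r' < g r})"
      using type[OF i(1) j(1)] i(2) j(2) by simp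
  qed
qed

lemma not_red_rows:
  assumes "\<And>i j. i \<le> j \<Longrightarrow> j < dim_row M \<Longrightarrow> \<rho> i \<le> \<rho> j" "\<rho> r \<noteq> \<rho> r'"
    and U: "U = {..<dim_row M} <+> {..<dim_col M}"
  shows "\<not> red_adjacent (matrix_structure M) (key_class U Q M \<rho> \<gamma> (Inl r)) (key_class U Q M \<rho> \<gamma> (Inl r'))"
proof (rule not_red_same_side[OF assms(1,2) _ atomic_type_Inl_Inl])
  show "\<exists>j<dim_row M. x = Inl j \<and> \<rho> j = \<rho> i" if "x \<in> U" "class_key Q M \<rho> \<gamma> x = class_key Q M \<rho> \<gamma> (Inl i)" for x i
    using that U by (cases x) (auto simp: class_key_def)
qed

lemma not_red_cols:
  assumes "\<And>i j. i \<le> j \<Longrightarrow> j < dim_col M \<Longrightarrow> \<gamma> i \<le> \<gamma> j" "\<gamma> c \<noteq> \<gamma> c'"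
    and U: "U = {..<dim_row M} <+> {..<dim_col M}"
  shows "\<not> red_adjacent (matrix_structure M) (key_class U Q M \<rho> \<gamma> (Inr c)) (key_class U Q M \<rho> \<gamma> (Inr c'))"
proof (rule not_red_same_side[OF assms(1,2) _ atomic_type_Inr_Inr])
  show "\<exists>j<dim_col M. x = Inr j \<and> \<gamma> j = \<gamma> i" if "x \<in> U" "class_key Q M \<rho> \<gamma> x = class_key Q M \<rho> \<gamma> (Inr i)" for x i
    using that U by (cases x) (auto simp: class_key_def)
qed

lemma not_red_row_col:
  assumes rc: "r < dim_row M" "c < dim_col M" and z: "\<not> part_zone Q M \<rho> \<gamma> (\<rho> r) (\<gamma> c)"
    and U: "U = {..<dim_row M} <+> {..<dim_col M}"
  shows "\<not> red_adjacent (matrix_structure M) (key_class U Q M \<rho> \<gamma> (Inl r))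
    (key_class U Q M \<rho> \<gamma> (Inr c))"
    "\<not> red_adjacent (matrix_structure M) (key_class U Q M \<rho> \<gamma> (Inr c))
    (key_class U Q M \<rho> \<gamma> (Inl r))"
proof -
  have entry: "\<exists>i j. x = Inl i \<and> y = Inr j \<and> i < dim_row M \<and> j < dim_col M \<and> M $$ (i, j) = M $$ (r, c)"
    if xy: "x \<in> U" "y \<in> U" "class_key Q M \<rho> \<gamma> x = class_key Q M \<rho> \<gamma> (Inl r)"
      "class_key Q M \<rho> \<gamma> y = class_key Q M \<rho> \<gamma> (Inr c)" for x y
  proof -
    obtain i where i: "x = Inl i" "i < dim_row M" using xy(1,3) U by (cases x) auto
    obtain j where j: "y = Inr j" "j < dim_col M" using xy(2,4) U by (cases y) auto
    have "M $$ (i, j) = M $$ (r, c)"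
      by (rule class_key_entry[OF xy(3)[unfolded i(1)] xy(4)[unfolded j(1)] rc(1) j(2) z])
    then show ?thesis using i j by blast
  qed
  show "\<not> red_adjacent (matrix_structure M) (key_class U Q M \<rho> \<gamma> (Inl r))
    (key_class U Q M \<rho> \<gamma> (Inr c))"
  proof
    assume "red_adjacent (matrix_structure M) (key_class U Q M \<rho> \<gamma> (Inl r))
      (key_class U Q M \<rho> \<gamma> (Inr c))"
    then show False
    proof (rule red_adjacent_fibres)
      fix x y assume xy: "x \<in> U" "y \<in> U" "class_key Q M \<rho> \<gamma> x = class_key Q M \<rho> \<gamma> (Inl r)"
        "class_key Q M \<rho> \<gamma> y = class_key Q M \<rho> \<gamma> (Inr c)"
      from entry[OF this] show "atomic_type (matrix_structure M) x y = (UNIV, {}, {Less, Entry (M $$ (r, c))}, {})"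
        using atomic_type_Inl_Inr by fastforce
    qed
  qed
  show "\<not> red_adjacent (matrix_structure M) (key_class U Q M \<rho> \<gamma> (Inr c))
    (key_class U Q M \<rho> \<gamma> (Inl r))"
  proof
    assume "red_adjacent (matrix_structure M) (key_class U Q M \<rho> \<gamma> (Inr c))
      (key_class U Q M \<rho> \<gamma> (Inl r))"
    then show False
    proof (rule red_adjacent_fibres)
      fix y x assume xy: "y \<in> U" "x \<in> U" "class_key Q M \<rho> \<gamma> y = class_key Q M \<rho> \<gamma> (Inr c)"
        "class_key Q M \<rho> \<gamma> x = class_key Q M \<rho> \<gamma> (Inl r)"
      from entry[OF xy(2,1,4,3)] show "atomic_type (matrix_structure M) y x = ({}, UNIV, {}, {Less, Entry (M $$ (r, c))})"
        using atomic_type_Inr_Inl by fastforce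
    qed
  qed
qed

definition division :: "'a mat \<Rightarrow> (nat \<Rightarrow> nat) \<Rightarrow> nat \<Rightarrow> (nat \<Rightarrow> nat) \<Rightarrow> nat \<Rightarrow> bool" where
  "division M \<rho> s \<gamma> t \<longleftrightarrow>
     (\<forall>i j. i \<le> j \<longrightarrow> j < dim_row M \<longrightarrow> \<rho> i \<le> \<rho> j) \<and> (\<forall>i<dim_row M. \<rho> i < s) \<and>
     (\<forall>i j. i \<le> j \<longrightarrow> j < dim_col M \<longrightarrow> \<gamma> i \<le> \<gamma> j) \<and> (\<forall>i<dim_col M. \<gamma> i < t)"

text \<open>A class can be red to the at most K classes of its own part, because of the order, and
  to the K classes of each of the at most g opposite parts with which its part forms a complex
  zone.\<close>

lemma red_degree_classes:
  fixes M :: "'a::finite mat"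
  assumes Q: "2 \<le> Q" and q: "2 \<le> CARD('a)" and div: "division M \<rho> s \<gamma> t"
    and poor: "poor_division g Q M \<rho> s \<gamma> t"
  defines "K \<equiv> (CARD('a) ^ Q) ^ (2 * g)"
  shows "red_degree_le (matrix_structure M) (K + g * K) (key_classes Q M \<rho> \<gamma>)"
  unfolding red_degree_le_def
proof
  let ?S = "matrix_structure M" and ?key = "class_key Q M \<rho> \<gamma>"
  let ?row = "\<lambda>a. Inl ` segment (dim_row M) \<rho> a (Suc a) :: (nat + nat) set"
  let ?col = "\<lambda>b. Inr ` segment (dim_col M) \<gamma> b (Suc b) :: (nat + nat) set"
  define U where "U = domain ?S"
  have U: "U = {..<dim_row M} <+> {..<dim_col M}" by (simp add: U_def)
  have finU: "finite U" by (simp add: U)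
  have cz: "zone_predicate (complex_zone Q M)" by (rule zone_predicate_complex_zone[OF Q])
  have row_K: "card (?key ` ?row a) \<le> K" if "a < s" for a
    unfolding K_def using div that by (intro card_row_classes_le[OF Q poor]) (auto simp: division_def)
  have col_K: "card (?key ` ?col b) \<le> K" if "b < t" for b
    unfolding K_def using div that by (intro card_col_classes_le[OF Q q poor]) (auto simp: division_def)
  fix X assume "X \<in> fibres ?key (domain ?S)"
  then obtain u where u: "u \<in> U" "X = {x \<in> U. ?key x = ?key u}"
    unfolding fibres_def U_def by (elim imageE)
  let ?F = "{Y \<in> fibres ?key U. red_adjacent ?S X Y}"
  have bound: "card ?F \<le> K + g * K"
    if Z: "finite Z" "card Z \<le> g" "\<And>z. z \<in> Z \<Longrightarrow> card (?key ` B z) \<le> K"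
      and A: "card (?key ` A) \<le> K" and V: "A \<union> (\<Union>z\<in>Z. B z) \<subseteq> U"
      and red: "\<And>v. v \<in> U \<Longrightarrow> red_adjacent ?S X {x \<in> U. ?key x = ?key v} \<Longrightarrow> v \<in> A \<union> (\<Union>z\<in>Z. B z)"
    for A :: "(nat + nat) set" and B :: "nat \<Rightarrow> (nat + nat) set" and Z
  proof -
    have "card ?F \<le> card (?key ` (A \<union> (\<Union>z\<in>Z. B z)))"
      by (rule card_fibres_le[OF finU _ V]) (use red in blast)+
    also have "?key ` (A \<union> (\<Union>z\<in>Z. B z)) = ?key ` A \<union> (\<Union>z\<in>Z. ?key ` B z)" by blast
    also have "card \<dots> \<le> card (?key ` A) + card (\<Union>z\<in>Z. ?key ` B z)" by (rule card_Un_le)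
    also have "\<dots> \<le> K + (\<Sum>z\<in>Z. card (?key ` B z))"
      using A card_UN_le[OF Z(1), of "\<lambda>z. ?key ` B z"] by (rule add_mono)
    also have "\<dots> \<le> K + (\<Sum>z\<in>Z. K)" using Z(3) by (intro add_left_mono sum_mono)
    also have "\<dots> \<le> K + g * K" using Z(2) by simp
    finally show ?thesis .
  qed
  show "card {Y \<in> fibres ?key (domain ?S). red_adjacent ?S X Y} \<le> K + g * K"
  proof (cases u)
    case (Inl r)
    then have r: "r < dim_row M" using u(1) U by auto
    have rs: "\<rho> r < s" using div r by (simp add: division_def)
    show ?thesis unfolding U_def[symmetric]
    proof (rule bound[where A = "?row (\<rho> r)" and B = ?col and Z = "{b. b < t \<and> part_zone Q M \<rho> \<gamma> (\<rho> r) b}"])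
      show "card {b. b < t \<and> part_zone Q M \<rho> \<gamma> (\<rho> r) b} \<le> g"
        unfolding part_zone_def
      proof (rule card_singletons_of_no_chain[where cx = "\<lambda>x y. complex_zone Q M (segment (dim_row M) \<rho> (\<rho> r) (Suc (\<rho> r))) (segment (dim_col M) \<gamma> x y)"])
        show "\<not> chain (\<lambda>x y. complex_zone Q M (segment (dim_row M) \<rho> (\<rho> r) (Suc (\<rho> r))) (segment (dim_col M) \<gamma> x y)) g 0 t"
          using poor rs by (simp add: poor_def)
      qed (rule zone_mono[OF cz], auto simp: segment_def)
      show "card (?key ` ?row (\<rho> r)) \<le> K" by (rule row_K[OF rs])
      show "card (?key ` ?col z) \<le> K" if "z \<in> {b. b < t \<and> part_zone Q M \<rho> \<gamma> (\<rho> r) b}" for z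
        using that by (intro col_K) simp
      show "?row (\<rho> r) \<union> (\<Union>z\<in>{b. b < t \<and> part_zone Q M \<rho> \<gamma> (\<rho> r) b}. ?col z) \<subseteq> U"
        by (auto simp: U segment_part)
      fix v assume v: "v \<in> U" "red_adjacent ?S X {x \<in> U. ?key x = ?key v}"
      show "v \<in> ?row (\<rho> r) \<union> (\<Union>z\<in>{b. b < t \<and> part_zone Q M \<rho> \<gamma> (\<rho> r) b}. ?col z)"
      proof (cases v)
        case (Inl r')
        have "\<rho> r = \<rho> r'"
          using not_red_rows[OF _ _ U, of \<rho> r r' Q \<gamma>] v(2) u(2) \<open>u = Inl r\<close> Inl div by (auto simp: division_def)
        then show ?thesis using Inl v(1) U by (auto simp: segment_part)
      next
        case (Inr c)
        then have c: "c < dim_col M" using v(1) U by auto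
        have "part_zone Q M \<rho> \<gamma> (\<rho> r) (\<gamma> c)"
          using not_red_row_col(1)[OF r c _ U, of Q \<rho> \<gamma>] v(2) u(2) \<open>u = Inl r\<close> Inr by auto
        moreover have "\<gamma> c < t" using div c by (simp add: division_def)
        ultimately show ?thesis using Inr c by (auto simp: segment_part)
      qed
    qed simp
  next
    case (Inr c)
    then have c: "c < dim_col M" using u(1) U by auto
    have ct: "\<gamma> c < t" using div c by (simp add: division_def)
    show ?thesis unfolding U_def[symmetric]
    proof (rule bound[where A = "?col (\<gamma> c)" and B = ?row and Z = "{a. a < s \<and> part_zone Q M \<rho> \<gamma> a (\<gamma> c)}"])
      show "card {a. a < s \<and> part_zone Q M \<rho> \<gamma> a (\<gamma> c)} \<le> g"
        unfolding part_zone_def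
      proof (rule card_singletons_of_no_chain[where cx = "\<lambda>x y. complex_zone Q M (segment (dim_row M) \<rho> x y) (segment (dim_col M) \<gamma> (\<gamma> c) (Suc (\<gamma> c)))"])
        show "\<not> chain (\<lambda>x y. complex_zone Q M (segment (dim_row M) \<rho> x y) (segment (dim_col M) \<gamma> (\<gamma> c) (Suc (\<gamma> c)))) g 0 s"
          using poor ct by (simp add: poor_def)
      qed (rule zone_mono[OF cz], auto simp: segment_def)
      show "card (?key ` ?col (\<gamma> c)) \<le> K" by (rule col_K[OF ct])
      show "card (?key ` ?row z) \<le> K" if "z \<in> {a. a < s \<and> part_zone Q M \<rho> \<gamma> a (\<gamma> c)}" for z
        using that by (intro row_K) simp
      show "?col (\<gamma> c) \<union> (\<Union>z\<in>{a. a < s \<and> part_zone Q M \<rho> \<gamma> a (\<gamma> c)}. ?row z) \<subseteq> U"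
        by (auto simp: U segment_part)
      fix v assume v: "v \<in> U" "red_adjacent ?S X {x \<in> U. ?key x = ?key v}"
      show "v \<in> ?col (\<gamma> c) \<union> (\<Union>z\<in>{a. a < s \<and> part_zone Q M \<rho> \<gamma> a (\<gamma> c)}. ?row z)"
      proof (cases v)
        case (Inr c')
        have "\<gamma> c = \<gamma> c'"
          using not_red_cols[OF _ _ U, of \<gamma> c c' Q \<rho>] v(2) u(2) \<open>u = Inr c\<close> Inr div by (auto simp: division_def)
        then show ?thesis using Inr v(1) U by (auto simp: segment_part)
      next
        case (Inl r)
        then have r: "r < dim_row M" using v(1) U by auto
        have "part_zone Q M \<rho> \<gamma> (\<rho> r) (\<gamma> c)"
          using not_red_row_col(2)[OF r c _ U, of Q \<rho> \<gamma>] v(2) u(2) \<open>u = Inr c\<close> Inl by auto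
        moreover have "\<rho> r < s" using div r by (simp add: division_def)
        ultimately show ?thesis using Inl r by (auto simp: segment_part)
      qed
    qed simp
  qed
qed

section \<open>Classes under coarsening of the division\<close>

lemma part_zone_coarser:
  assumes Q: "2 \<le> Q" and z: "part_zone Q M \<rho> \<gamma> (\<rho> r) (\<gamma> c)" and rc: "r < dim_row M" "c < dim_col M"
    and ref: "\<And>i. i < dim_row M \<Longrightarrow> \<rho> i = \<rho> r \<Longrightarrow> \<rho>' i = \<rho>' r"
      "\<And>j. j < dim_col M \<Longrightarrow> \<gamma> j = \<gamma> c \<Longrightarrow> \<gamma>' j = \<gamma>' c"
  shows "part_zone Q M \<rho>' \<gamma>' (\<rho>' r) (\<gamma>' c)"
  unfolding part_zone_def
proof (rule zone_mono[OF zone_predicate_complex_zone[OF Q] z[unfolded part_zone_def]])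
  show "segment (dim_row M) \<rho> (\<rho> r) (Suc (\<rho> r)) \<subseteq> segment (dim_row M) \<rho>' (\<rho>' r) (Suc (\<rho>' r))"
    using ref(1) by (auto simp: segment_part)
  show "segment (dim_col M) \<gamma> (\<gamma> c) (Suc (\<gamma> c)) \<subseteq> segment (dim_col M) \<gamma>' (\<gamma>' c) (Suc (\<gamma>' c))"
    using ref(2) by (auto simp: segment_part)
qed simp_all

text \<open>Complex zones stay complex when parts grow, so after coarsening fewer entries are
  compared.\<close>

lemma class_key_coarser:
  assumes Q: "2 \<le> Q"
    and ref: "\<And>i j. i < dim_row M \<Longrightarrow> j < dim_row M \<Longrightarrow> \<rho> i = \<rho> j \<Longrightarrow> \<rho>' i = \<rho>' j"
      "\<And>i j. i < dim_col M \<Longrightarrow> j < dim_col M \<Longrightarrow> \<gamma> i = \<gamma> j \<Longrightarrow> \<gamma>' i = \<gamma>' j"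
    and xy: "x \<in> {..<dim_row M} <+> {..<dim_col M}" "y \<in> {..<dim_row M} <+> {..<dim_col M}"
    and eq: "class_key Q M \<rho> \<gamma> x = class_key Q M \<rho> \<gamma> y"
  shows "class_key Q M \<rho>' \<gamma>' x = class_key Q M \<rho>' \<gamma>' y"
proof (cases x)
  case (Inl i)
  then obtain j where j: "y = Inl j" using eq by (cases y) auto
  have lt: "i < dim_row M" "j < dim_row M" using xy Inl j by auto
  have e: "\<rho> i = \<rho> j" using eq Inl j by (simp add: class_key_def)
  have e': "\<rho>' i = \<rho>' j" by (rule ref(1)[OF lt e])
  have r: "restrict (\<lambda>c. M $$ (i, c)) {c. c < dim_col M \<and> \<not> part_zone Q M \<rho> \<gamma> (\<rho> j) (\<gamma> c)} =
    restrict (\<lambda>c. M $$ (j, c)) {c. c < dim_col M \<and> \<not> part_zone Q M \<rho> \<gamma> (\<rho> j) (\<gamma> c)}"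
    using eq Inl j e by (simp add: class_key_def)
  have "M $$ (i, c) = M $$ (j, c)" if c: "c < dim_col M" "\<not> part_zone Q M \<rho>' \<gamma>' (\<rho>' j) (\<gamma>' c)" for c
  proof -
    have "\<not> part_zone Q M \<rho> \<gamma> (\<rho> j) (\<gamma> c)"
      using c(2) part_zone_coarser[OF Q _ lt(2) c(1), of \<rho> \<gamma> \<rho>' \<gamma>'] ref lt(2) c(1) by blast
    then show ?thesis using restrict_eqD[OF r, of c] c(1) by simp
  qed
  then show ?thesis by (simp add: class_key_def Inl j e' cong: restrict_cong)
next
  case (Inr i)
  then obtain j where j: "y = Inr j" using eq by (cases y) auto
  have lt: "i < dim_col M" "j < dim_col M" using xy Inr j by auto
  have e: "\<gamma> i = \<gamma> j" using eq Inr j by (simp add: class_key_def)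
  have e': "\<gamma>' i = \<gamma>' j" by (rule ref(2)[OF lt e])
  have r: "restrict (\<lambda>r. M $$ (r, i)) {r. r < dim_row M \<and> \<not> part_zone Q M \<rho> \<gamma> (\<rho> r) (\<gamma> j)} =
    restrict (\<lambda>r. M $$ (r, j)) {r. r < dim_row M \<and> \<not> part_zone Q M \<rho> \<gamma> (\<rho> r) (\<gamma> j)}"
    using eq Inr j e by (simp add: class_key_def)
  have "M $$ (r', i) = M $$ (r', j)" if c: "r' < dim_row M" "\<not> part_zone Q M \<rho>' \<gamma>' (\<rho>' r') (\<gamma>' j)" for r'
  proof -
    have "\<not> part_zone Q M \<rho> \<gamma> (\<rho> r') (\<gamma> j)"
      using c(2) part_zone_coarser[OF Q _ c(1) lt(2), of \<rho> \<gamma> \<rho>' \<gamma>'] ref lt(2) c(1) by blast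
    then show ?thesis using restrict_eqD[OF r, of r'] c(1) by simp
  qed
  then show ?thesis by (simp add: class_key_def Inr j e' cong: restrict_cong)
qed

text \<open>By \<open>cover\<close> a new part is made of at most two old ones, so a new class
  contains at most 2K old classes. The bound on \<open>d\<close> is then the intermediate red degree
  while these are united.\<close>

lemma contracts_to_coarser_division:
  fixes M :: "'a::finite mat"
  assumes Q: "2 \<le> Q" and q: "2 \<le> CARD('a)"
    and old: "division M \<rho> s \<gamma> t" "poor_division g Q M \<rho> s \<gamma> t"
    and new: "division M \<rho>' s' \<gamma>' t'" "poor_division g Q M \<rho>' s' \<gamma>' t'"
    and ref: "\<And>i j. i < dim_row M \<Longrightarrow> j < dim_row M \<Longrightarrow> \<rho> i = \<rho> j \<Longrightarrow> \<rho>' i = \<rho>' j"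
      "\<And>i j. i < dim_col M \<Longrightarrow> j < dim_col M \<Longrightarrow> \<gamma> i = \<gamma> j \<Longrightarrow> \<gamma>' i = \<gamma>' j"
    and cover: "\<And>r. r < dim_row M \<Longrightarrow> \<exists>a a'. a < s \<and> a' < s \<and> (\<forall>i<dim_row M. \<rho>' i = \<rho>' r \<longrightarrow> \<rho> i = a \<or> \<rho> i = a')"
      "\<And>c. c < dim_col M \<Longrightarrow> \<exists>b b'. b < t \<and> b' < t \<and> (\<forall>j<dim_col M. \<gamma>' j = \<gamma>' c \<longrightarrow> \<gamma> j = b \<or> \<gamma> j = b')"
  defines "K \<equiv> (CARD('a) ^ Q) ^ (2 * g)"
  assumes d: "(K + g * K + 1) * (2 * K) \<le> d"
    and c: "contracts_to (matrix_structure M) d (key_classes Q M \<rho> \<gamma>)"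
  shows "contracts_to (matrix_structure M) d (key_classes Q M \<rho>' \<gamma>')"
proof (rule contracts_to_coarser_fibres[OF _ c])
  let ?U = "domain (matrix_structure M)" and ?key = "class_key Q M \<rho> \<gamma>" and ?key' = "class_key Q M \<rho>' \<gamma>'"
  have U: "?U = {..<dim_row M} <+> {..<dim_col M}" by simp
  show "finite ?U" by simp
  show "?key' u = ?key' v" if "u \<in> ?U" "v \<in> ?U" "?key u = ?key v" for u v
    by (rule class_key_coarser[OF Q, of M \<rho> \<rho>' \<gamma> \<gamma>' u v]) (use that[unfolded U] ref in blast)+
  show "red_degree_le (matrix_structure M) (K + g * K) (fibres ?key' ?U)"
    unfolding K_def by (rule red_degree_classes[OF Q q new])
  show "(K + g * K + 1) * (2 * K) \<le> d" by (rule d)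
  show "card (?key ` {v \<in> ?U. ?key' v = ?key' u}) \<le> 2 * K" if u: "u \<in> ?U" for u
  proof -
    have two: "card (?key ` W) \<le> 2 * K" if "W \<subseteq> A \<union> B" "finite A" "finite B" "card (?key ` A) \<le> K" "card (?key ` B) \<le> K" for W A B
    proof -
      have "card (?key ` W) \<le> card (?key ` A \<union> ?key ` B)" using that(1-3) by (intro card_mono) auto
      also have "\<dots> \<le> card (?key ` A) + card (?key ` B)" by (rule card_Un_le)
      finally show ?thesis using that by simp
    qed
    show ?thesis
    proof (cases u)
      case (Inl r)
      then have r: "r < dim_row M" using u by auto
      obtain a a' where a: "a < s" "a' < s" "\<forall>i<dim_row M. \<rho>' i = \<rho>' r \<longrightarrow> \<rho> i = a \<or> \<rho> i = a'"
        using cover(1)[OF r] by (elim exE conjE)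
      have K: "card (?key ` Inl ` segment (dim_row M) \<rho> a (Suc a)) \<le> K" if "a < s" for a
        unfolding K_def using old that by (intro card_row_classes_le[OF Q old(2)]) (auto simp: division_def)
      show ?thesis
      proof (rule two[OF _ _ _ K[OF a(1)] K[OF a(2)]])
        show "{v \<in> ?U. ?key' v = ?key' u} \<subseteq> Inl ` segment (dim_row M) \<rho> a (Suc a) \<union> Inl ` segment (dim_row M) \<rho> a' (Suc a')"
        proof
          fix v assume v: "v \<in> {v \<in> ?U. ?key' v = ?key' u}"
          then obtain i where i: "v = Inl i" "i < dim_row M" using Inl by (cases v) auto
          have "\<rho>' i = \<rho>' r" using v i Inl by (simp add: class_key_def)
          then show "v \<in> Inl ` segment (dim_row M) \<rho> a (Suc a) \<union> Inl ` segment (dim_row M) \<rho> a' (Suc a')"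
            using a(3) i by (auto simp: segment_part)
        qed
      qed simp_all
    next
      case (Inr r)
      then have r: "r < dim_col M" using u by auto
      obtain a a' where a: "a < t" "a' < t" "\<forall>i<dim_col M. \<gamma>' i = \<gamma>' r \<longrightarrow> \<gamma> i = a \<or> \<gamma> i = a'"
        using cover(2)[OF r] by (elim exE conjE)
      have K: "card (?key ` Inr ` segment (dim_col M) \<gamma> a (Suc a)) \<le> K" if "a < t" for a
        unfolding K_def using old that by (intro card_col_classes_le[OF Q q old(2)]) (auto simp: division_def)
      show ?thesis
      proof (rule two[OF _ _ _ K[OF a(1)] K[OF a(2)]])
        show "{v \<in> ?U. ?key' v = ?key' u} \<subseteq> Inr ` segment (dim_col M) \<gamma> a (Suc a) \<union> Inr ` segment (dim_col M) \<gamma> a' (Suc a')"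
        proof
          fix v assume v: "v \<in> {v \<in> ?U. ?key' v = ?key' u}"
          then obtain i where i: "v = Inr i" "i < dim_col M" using Inr by (cases v) auto
          have "\<gamma>' i = \<gamma>' r" using v i Inr by (simp add: class_key_def)
          then show "v \<in> Inr ` segment (dim_col M) \<gamma> a (Suc a) \<union> Inr ` segment (dim_col M) \<gamma> a' (Suc a')"
            using a(3) i by (auto simp: segment_part)
        qed
      qed simp_all
    qed
  qed
qed

section \<open>Running the greedy process to its end\<close>

lemma merge_parts_cover:
  assumes "\<And>i. i < m \<Longrightarrow> \<rho> i < s" "Suc a < s" "r < m"
  shows "\<exists>c c'. c < s \<and> c' < s \<and> (\<forall>i<m. merge_parts a \<rho> i = merge_parts a \<rho> r \<longrightarrow> \<rho> i = c \<or> \<rho> i = c')"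
proof (cases "merge_parts a \<rho> r = a")
  case True
  then show ?thesis using assms by (intro exI[of _ a] exI[of _ "Suc a"]) (auto simp: merge_parts_def)
next
  case False
  then show ?thesis using assms by (intro exI[of _ "\<rho> r"]) (auto simp: merge_parts_def split: if_splits)
qed

lemma merge_parts_mono: "\<rho> i \<le> \<rho> j \<Longrightarrow> merge_parts a \<rho> i \<le> merge_parts a \<rho> j"
  by (auto simp: merge_parts_def)

lemma merge_parts_less: "\<rho> i < s \<Longrightarrow> Suc a < s \<Longrightarrow> merge_parts a \<rho> i < s - Suc 0"
  by (auto simp: merge_parts_def)

lemma contracts_to_coarsest_division:
  fixes M :: "'a::finite mat"
  assumes Q: "2 \<le> Q" and q: "2 \<le> CARD('a)"
    and C: "\<And>n T. interval_family n n T \<Longrightarrow> \<not> interval_grid p T \<Longrightarrow> card T \<le> C * n" and g: "3 * C < g"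
    and no: "\<And>\<rho> s \<gamma> t. division M \<rho> s \<gamma> t \<Longrightarrow> \<not> zone_grid p (complex_zone Q M) (dim_row M) \<rho> (dim_col M) \<gamma>"
  defines "K \<equiv> (CARD('a) ^ Q) ^ (2 * g)"
  assumes d: "(K + g * K + 1) * (2 * K) \<le> d"
    and "division M \<rho> s \<gamma> t" "poor_division g Q M \<rho> s \<gamma> t"
      "contracts_to (matrix_structure M) d (key_classes Q M \<rho> \<gamma>)"
  shows "\<exists>\<rho> \<gamma> s t. s \<le> 1 \<and> t \<le> 1 \<and> division M \<rho> s \<gamma> t \<and> poor_division g Q M \<rho> s \<gamma> t \<and>
    contracts_to (matrix_structure M) d (key_classes Q M \<rho> \<gamma>)"
  using assms(8-10)
proof (induction "s + t" arbitrary: \<rho> s \<gamma> t rule: less_induct)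
  case less
  note div = less.prems(1) and poor = less.prems(2) and con = less.prems(3)
  have d': "((CARD('a) ^ Q) ^ (2 * g) + g * (CARD('a) ^ Q) ^ (2 * g) + 1) * (2 * (CARD('a) ^ Q) ^ (2 * g)) \<le> d"
    using d unfolding K_def .
  show ?case
  proof (cases "s \<le> 1 \<and> t \<le> 1")
    case True
    then show ?thesis using less.prems by (intro exI conjI) auto
  next
    case False
    then have "2 \<le> s \<or> 2 \<le> t" by auto
    then have "zone_grid p (complex_zone Q M) (dim_row M) \<rho> (dim_col M) \<gamma> \<or>
      (\<exists>a. Suc a < s \<and> poor_division g Q M (merge_parts a \<rho>) (s - 1) \<gamma> t) \<or>
      (\<exists>b. Suc b < t \<and> poor_division g Q M \<rho> s (merge_parts b \<gamma>) (t - 1))"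
      by (intro merge_or_zone_grid[OF zone_predicate_complex_zone[OF Q] _ g poor] C)
    then consider a where "Suc a < s" "poor_division g Q M (merge_parts a \<rho>) (s - 1) \<gamma> t"
      | b where "Suc b < t" "poor_division g Q M \<rho> s (merge_parts b \<gamma>) (t - 1)"
      using no[OF div] by (elim disjE exE conjE) simp_all
    then show ?thesis
    proof cases
      case (1 a)
      have div': "division M (merge_parts a \<rho>) (s - 1) \<gamma> t"
        using div 1(1) by (auto simp: division_def intro: merge_parts_mono merge_parts_less)
      have con': "contracts_to (matrix_structure M) d (key_classes Q M (merge_parts a \<rho>) \<gamma>)"
      proof (rule contracts_to_coarser_division[OF Q q div poor div' 1(2) _ _ _ _ d' con])
        show "\<exists>c c'. c < s \<and> c' < s \<and> (\<forall>i<dim_row M. merge_parts a \<rho> i = merge_parts a \<rho> r \<longrightarrow> \<rho> i = c \<or> \<rho> i = c')"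
          if "r < dim_row M" for r
          using div that by (intro merge_parts_cover[OF _ 1(1)]) (auto simp: division_def)
        show "\<exists>b b'. b < t \<and> b' < t \<and> (\<forall>j<dim_col M. \<gamma> j = \<gamma> c \<longrightarrow> \<gamma> j = b \<or> \<gamma> j = b')" if "c < dim_col M" for c
          using div that by (intro exI[of _ "\<gamma> c"]) (auto simp: division_def)
      qed (auto simp: merge_parts_def)
      have "s - 1 + t < s + t" using 1(1) by simp
      from less.hyps[OF this div' 1(2) con'] show ?thesis .
    next
      case (2 b)
      have div': "division M \<rho> s (merge_parts b \<gamma>) (t - 1)"
        using div 2(1) by (auto simp: division_def intro: merge_parts_mono merge_parts_less)
      have con': "contracts_to (matrix_structure M) d (key_classes Q M \<rho> (merge_parts b \<gamma>))"
      proof (rule contracts_to_coarser_division[OF Q q div poor div' 2(2) _ _ _ _ d' con])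
        show "\<exists>c c'. c < t \<and> c' < t \<and> (\<forall>i<dim_col M. merge_parts b \<gamma> i = merge_parts b \<gamma> r \<longrightarrow> \<gamma> i = c \<or> \<gamma> i = c')"
          if "r < dim_col M" for r
          using div that by (intro merge_parts_cover[OF _ 2(1)]) (auto simp: division_def)
        show "\<exists>a a'. a < s \<and> a' < s \<and> (\<forall>j<dim_row M. \<rho> j = \<rho> r \<longrightarrow> \<rho> j = a \<or> \<rho> j = a')" if "r < dim_row M" for r
          using div that by (intro exI[of _ "\<rho> r"]) (auto simp: division_def)
      qed (auto simp: merge_parts_def)
      have "s + (t - 1) < s + t" using 2(1) by simp
      from less.hyps[OF this div' 2(2) con'] show ?thesis .
    qed
  qed
qed

text \<open>A single row has at most |F| distinct columns and a single column only one, so no zone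
  is complex and there is not even a chain of length 1.\<close>

lemma poor_finest_division:
  fixes M :: "'a::finite mat"
  assumes Q: "CARD('a) < Q" "2 \<le> Q" and g: "0 < g"
  shows "poor_division g Q M id (dim_row M) id (dim_col M)"
proof -
  have row: "\<not> complex_zone Q M (segment m id a (Suc a)) C" for m a C
  proof -
    have "segment m id a (Suc a) = {} \<or> segment m id a (Suc a) = {a}" by (auto simp: segment_part)
    then show ?thesis
    proof
      assume "segment m id a (Suc a) = {}"
      then show ?thesis using zone_nonempty(1)[OF zone_predicate_complex_zone[OF Q(2)]] by metis
    next
      assume e: "segment m id a (Suc a) = {a}"
      show ?thesis unfolding e complex_zone_def using card_columns_of_row_le[of M a C] Q by linarith
    qed
  qed
  have col: "\<not> complex_zone Q M R (segment n id b (Suc b))" for n b R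
  proof -
    let ?f = "\<lambda>c. restrict (\<lambda>r. M $$ (r, c)) R"
    have "segment n id b (Suc b) \<subseteq> {b}" by (auto simp: segment_part)
    then have "card (?f ` segment n id b (Suc b)) \<le> card (?f ` {b})" by (intro card_mono) auto
    then show ?thesis using Q unfolding complex_zone_def by simp
  qed
  show ?thesis unfolding poor_def chain_def using g row col by blast
qed

lemma twin_width_le_or_zone_grid:
  assumes Q: "CARD('a::finite) < Q" and q: "2 \<le> CARD('a)"
  shows "\<exists>d. \<forall>M :: 'a mat. twin_width (matrix_structure M) \<le> d \<or>
    (\<exists>\<rho> s \<gamma> t. division M \<rho> s \<gamma> t \<and> zone_grid p (complex_zone Q M) (dim_row M) \<rho> (dim_col M) \<gamma>)"
proof -
  obtain C where C: "\<forall>n T. interval_family n n T \<longrightarrow> \<not> interval_grid p T \<longrightarrow> card T \<le> C * n"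
    using interval_family_bound[of p] by (elim exE)
  define g where "g = Suc (3 * C)"
  define K where "K = (CARD('a) ^ Q) ^ (2 * g)"
  define d where "d = (K + g * K + 1) * (2 * K)"
  have Q2: "2 \<le> Q" using Q q by simp
  have "twin_width (matrix_structure M) \<le> d"
    if no: "\<not> (\<exists>\<rho> s \<gamma> t. division M \<rho> s \<gamma> t \<and> zone_grid p (complex_zone Q M) (dim_row M) \<rho> (dim_col M) \<gamma>)" for M :: "'a mat"
  proof (cases "domain (matrix_structure M) = {}")
    case True
    show ?thesis unfolding twin_width_empty[OF True] by simp
  next
    case ne: False
    let ?U = "domain (matrix_structure M)"
    have fin: "finite ?U" by simp
    have div: "division M id (dim_row M) id (dim_col M)" by (simp add: division_def)
    \<comment> \<open>In the finest division the index alone separates the lines of one side, so the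
      classes are singletons.\<close>
    have "inj_on (class_key Q M id id) ?U"
      by (rule inj_onI) (auto simp: class_key_def split: sum.splits)
    then have "contracts_to (matrix_structure M) d (fibres (class_key Q M id id) ?U)"
      by (simp only: fibres_inj_on contracts_to.singletons)
    from contracts_to_coarsest_division[OF Q2 q _ _ _ _ div poor_finest_division[OF Q Q2] this, of p C]
    obtain \<rho> \<gamma> s t where fin_div: "s \<le> 1" "t \<le> 1" "division M \<rho> s \<gamma> t"
      "poor_division g Q M \<rho> s \<gamma> t"
      "contracts_to (matrix_structure M) d (fibres (class_key Q M \<rho> \<gamma>) ?U)"
      using C no unfolding g_def K_def d_def by blast
    have "fibres (\<lambda>_. ()) ?U = {?U}" using ne by (auto simp: fibres_def)
    moreover have "contracts_to (matrix_structure M) d (fibres (\<lambda>_. ()) ?U)"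
    \<comment> \<open>With at most one part on each side, at most 2K classes are left. They are
      united in any order, and the target partition has red degree 0.\<close>
    proof (rule contracts_to_coarser_fibres[OF fin fin_div(5), where e = 0 and m = "2 * K"])
      show "red_degree_le (matrix_structure M) 0 (fibres (\<lambda>_. ()) ?U)"
        unfolding \<open>fibres (\<lambda>_. ()) ?U = {?U}\<close> by (auto simp: red_degree_le_def red_adjacent_def)
      show "(0 + 1) * (2 * K) \<le> d" unfolding d_def by (rule mult_le_mono1) simp
      let ?key = "class_key Q M \<rho> \<gamma>"
      show "card (?key ` {v \<in> ?U. () = ()}) \<le> 2 * K" for u
      proof -
        have rows: "card (?key ` Inl ` {..<dim_row M}) \<le> K"
        proof (cases "dim_row M = 0")
          case False
          then have "\<rho> 0 < s" using fin_div(3) by (simp add: division_def)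
          then have "0 < s" by simp
          have "{..<dim_row M} = segment (dim_row M) \<rho> 0 (Suc 0)"
            using fin_div(1,3) by (force simp: division_def segment_part)
          then show ?thesis unfolding K_def
            using card_row_classes_le[OF Q2 fin_div(4) \<open>0 < s\<close>] fin_div(3) by (simp add: division_def)
        qed simp
        have cols: "card (?key ` Inr ` {..<dim_col M}) \<le> K"
        proof (cases "dim_col M = 0")
          case False
          then have "\<gamma> 0 < t" using fin_div(3) by (simp add: division_def)
          then have "0 < t" by simp
          have "{..<dim_col M} = segment (dim_col M) \<gamma> 0 (Suc 0)"
            using fin_div(2,3) by (force simp: division_def segment_part)
          then show ?thesis unfolding K_def
            using card_col_classes_le[OF Q2 q fin_div(4) \<open>0 < t\<close>] fin_div(3) by (simp add: division_def)
        qed simp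
        have "?key ` {v \<in> ?U. () = ()} = ?key ` Inl ` {..<dim_row M} \<union> ?key ` Inr ` {..<dim_col M}"
          by (auto simp: image_iff)
        then have "card (?key ` {v \<in> ?U. () = ()}) \<le> card (?key ` Inl ` {..<dim_row M}) + card (?key ` Inr ` {..<dim_col M})"
          by (simp only: card_Un_le)
        then show ?thesis using rows cols by linarith
      qed
    qed simp
    ultimately show ?thesis using twin_width_le_if_contracts[OF fin] by simp
  qed
  then show ?thesis by (intro exI[of _ d] allI disjCI)
qed

section \<open>Complex grids contain every small matrix\<close>

text \<open>The cells of a grid may leave out lines at both ends, while a contraction must use all
  of them. These lines are added to the outer parts, which keeps complex zones complex; for a
  smaller \<open>p'\<close> the surplus cells join the last part.\<close>

lemma grid_contraction:
  assumes mono: "\<forall>i j. i \<le> j \<longrightarrow> j < m \<longrightarrow> \<rho> i \<le> \<rho> j"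
    and ne: "\<forall>k<p. segment m \<rho> (\<alpha> k) (\<alpha> (Suc k)) \<noteq> {}"
    and p': "0 < p'" "p' \<le> p"
  shows "\<exists>\<phi>. mono_onto m p' \<phi> \<and> (\<forall>k<p'. segment m \<rho> (\<alpha> k) (\<alpha> (Suc k)) \<subseteq> {r. r < m \<and> \<phi> r = k})"
proof -
  \<comment> \<open>Only the inner cuts 1, ..., p' - 1 are counted, so everything before the first
    cell gets index 0 and everything behind cell p' - 1 keeps that index.\<close>
  define \<phi> where "\<phi> r = card {k \<in> {1..<p'}. \<alpha> k \<le> \<rho> r}" for r
  have less: "\<alpha> k < \<alpha> (Suc k)" if "k < p" for k using ne[rule_format, OF that] by (rule segment_nonempty)
  have al: "\<alpha> k \<le> \<alpha> l" if "k \<le> l" "l \<le> p" for k l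
    using that
  proof (induction l rule: dec_induct)
    case (step l)
    then show ?case using less[of l] by simp
  qed simp
  have phi: "\<phi> r = k" if k: "k < p'" and r: "r \<in> segment m \<rho> (\<alpha> k) (\<alpha> (Suc k))" for k r
  proof -
    have "{j \<in> {1..<p'}. \<alpha> j \<le> \<rho> r} = {1..k}"
    proof (intro subset_antisym subsetI)
      fix j assume j: "j \<in> {j \<in> {1..<p'}. \<alpha> j \<le> \<rho> r}"
      have "\<not> Suc k \<le> j" using al[of "Suc k" j] j r p' by (auto simp: segment_def)
      then show "j \<in> {1..k}" using j by simp
    next
      fix j assume j: "j \<in> {1..k}"
      then have "\<alpha> j \<le> \<alpha> k" using k p' by (intro al) auto
      then show "j \<in> {j \<in> {1..<p'}. \<alpha> j \<le> \<rho> r}" using j r k by (simp add: segment_def)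
    qed
    then show ?thesis by (simp add: \<phi>_def)
  qed
  have "mono_onto m p' \<phi>"
    unfolding mono_onto_def
  proof (intro conjI allI impI)
    fix k l :: nat assume "k \<le> l" "l < m"
    then have "\<rho> k \<le> \<rho> l" by (rule mono[rule_format])
    then show "\<phi> k \<le> \<phi> l" unfolding \<phi>_def by (intro card_mono) auto
  next
    show "\<phi> ` {..<m} = {..<p'}"
    proof (intro subset_antisym subsetI)
      fix x assume "x \<in> \<phi> ` {..<m}"
      then obtain r where "x = \<phi> r" by blast
      moreover have "\<phi> r \<le> card {1..<p'}" unfolding \<phi>_def by (rule card_mono) auto
      ultimately show "x \<in> {..<p'}" using p' by simp
    next
      fix k assume k: "k \<in> {..<p'}"
      then obtain r where r: "r \<in> segment m \<rho> (\<alpha> k) (\<alpha> (Suc k))" using ne[rule_format, of k] p' by fastforce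
      then have "r < m" by (simp add: segment_def)
      then show "k \<in> \<phi> ` {..<m}" using phi[of k r] k r by force
    qed
  qed
  moreover have "segment m \<rho> (\<alpha> k) (\<alpha> (Suc k)) \<subseteq> {r. r < m \<and> \<phi> r = k}" if "k < p'" for k
  proof
    fix r assume r: "r \<in> segment m \<rho> (\<alpha> k) (\<alpha> (Suc k))"
    then have "r < m" by (simp add: segment_def)
    then show "r \<in> {r. r < m \<and> \<phi> r = k}" using phi[OF that r] by simp
  qed
  ultimately show ?thesis by blast
qed

lemma mono_onto_le: "mono_onto m p \<phi> \<Longrightarrow> p \<le> m"
  unfolding mono_onto_def by (metis card_image_le card_lessThan finite_lessThan)

lemma not_singleton_imp_other:
  assumes "\<And>x. A \<noteq> {x}" "k \<in> A"
  shows "\<exists>l\<in>A. l \<noteq> k"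
  using assms by blast

text \<open>The first bound on Q gives every part at least two lines, so all weights are free; the
  second one is the union bound of \<open>exists_weights\<close>. Operations never remove the last
  row or column, so empty targets are excluded here and treated as submatrices, for which the two
  dimension bounds are stated.\<close>

lemma zone_grid_imp_linear_minor:
  fixes M N :: "'a::{field, finite} mat"
  assumes div: "division M \<rho> s \<gamma> t" and grid: "zone_grid p (complex_zone Q M) (dim_row M) \<rho> (dim_col M) \<gamma>"
    and Q: "CARD('a) < Q" "p * CARD('a) ^ p < Q" and q: "2 \<le> CARD('a)" and p: "0 < p"
  shows "p \<le> dim_row M" "p \<le> dim_col M"
    "0 < dim_row N \<Longrightarrow> 0 < dim_col N \<Longrightarrow> dim_row N \<le> p \<Longrightarrow> dim_col N \<le> p \<Longrightarrow> linear_minor N M"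
proof -
  let ?m = "dim_row M" and ?n = "dim_col M"
  have Q2: "2 \<le> Q" using Q q by simp
  have cz: "zone_predicate (complex_zone Q M)" by (rule zone_predicate_complex_zone[OF Q2])
  obtain \<alpha> \<beta> where grid: "\<forall>k<p. \<forall>l<p. complex_zone Q M (segment ?m \<rho> (\<alpha> k) (\<alpha> (Suc k))) (segment ?n \<gamma> (\<beta> l) (\<beta> (Suc l)))"
    using grid unfolding zone_grid_def by (elim exE)
  have neR: "\<forall>k<p. segment ?m \<rho> (\<alpha> k) (\<alpha> (Suc k)) \<noteq> {}"
    using zone_nonempty(1)[OF cz grid[rule_format, OF _ p]] by simp
  have neC: "\<forall>k<p. segment ?n \<gamma> (\<beta> k) (\<beta> (Suc k)) \<noteq> {}"
    using zone_nonempty(2)[OF cz grid[rule_format, OF p]] by simp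
  have mono: "\<forall>i j. i \<le> j \<longrightarrow> j < ?m \<longrightarrow> \<rho> i \<le> \<rho> j" "\<forall>i j. i \<le> j \<longrightarrow> j < ?n \<longrightarrow> \<gamma> i \<le> \<gamma> j"
    using div by (simp_all add: division_def)
  show "p \<le> ?m" using grid_contraction[OF mono(1) neR p le_refl] mono_onto_le by blast
  show "p \<le> ?n" using grid_contraction[OF mono(2) neC p le_refl] mono_onto_le by blast
  assume N: "0 < dim_row N" "0 < dim_col N" "dim_row N \<le> p" "dim_col N \<le> p"
  obtain \<phi> where phi: "mono_onto ?m (dim_row N) \<phi>"
    "\<forall>k<dim_row N. segment ?m \<rho> (\<alpha> k) (\<alpha> (Suc k)) \<subseteq> {r. r < ?m \<and> \<phi> r = k}"
    using grid_contraction[OF mono(1) neR N(1,3)] by (elim exE conjE)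
  obtain \<psi> where psi: "mono_onto ?n (dim_col N) \<psi>"
    "\<forall>k<dim_col N. segment ?n \<gamma> (\<beta> k) (\<beta> (Suc k)) \<subseteq> {r. r < ?n \<and> \<psi> r = k}"
    using grid_contraction[OF mono(2) neC N(2,4)] by (elim exE conjE)
  have cell: "complex_zone Q M {r. r < ?m \<and> \<phi> r = i} {c. c < ?n \<and> \<psi> c = j}" if "i < dim_row N" "j < dim_col N" for i j
  proof (rule zone_mono[OF cz])
    show "complex_zone Q M (segment ?m \<rho> (\<alpha> i) (\<alpha> (Suc i))) (segment ?n \<gamma> (\<beta> j) (\<beta> (Suc j)))"
      using grid that N by simp
  qed (use that phi psi in auto)
  have other_row: "\<exists>l<?m. \<phi> l = \<phi> k \<and> l \<noteq> k" if k: "k < ?m" for k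
  proof -
    have "\<phi> k < dim_row N" using phi(1) k by (auto simp: mono_onto_def)
    from cell[OF this N(2)] have z: "complex_zone Q M {r. r < ?m \<and> \<phi> r = \<phi> k} {c. c < ?n \<and> \<psi> c = 0}" .
    have "{r. r < ?m \<and> \<phi> r = \<phi> k} \<noteq> {x}" for x
    proof
      assume e: "{r. r < ?m \<and> \<phi> r = \<phi> k} = {x}"
      show False using z card_columns_of_row_le[of M x "{c. c < ?n \<and> \<psi> c = 0}"] Q unfolding e complex_zone_def by linarith
    qed
    from not_singleton_imp_other[OF this, of k] show ?thesis using k by auto
  qed
  have other_col: "\<exists>l<?n. \<psi> l = \<psi> k \<and> l \<noteq> k" if k: "k < ?n" for k
  proof -
    have "\<psi> k < dim_col N" using psi(1) k by (auto simp: mono_onto_def)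
    from cell[OF N(1) this] have z: "complex_zone Q M {r. r < ?m \<and> \<phi> r = 0} {c. c < ?n \<and> \<psi> c = \<psi> k}" .
    have "{c. c < ?n \<and> \<psi> c = \<psi> k} \<noteq> {x}" for x
    proof
      assume e: "{c. c < ?n \<and> \<psi> c = \<psi> k} = {x}"
      show False using z Q2 unfolding e complex_zone_def by simp
    qed
    from not_singleton_imp_other[OF this, of k] show ?thesis using k by auto
  qed
  have "\<exists>u v. \<forall>i<dim_row N. \<forall>j<dim_col N.
    (\<Sum>k<?m. \<Sum>l<?n. if \<phi> k = i \<and> \<psi> l = j then u k * v l * M $$ (k, l) else 0) = N $$ (i, j)"
  proof (rule exists_weights[where N = "\<lambda>i j. N $$ (i, j)" and M = "\<lambda>k l. M $$ (k, l)"])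
    show "\<psi> l < dim_col N" if "l < ?n" for l using psi(1) that by (auto simp: mono_onto_def)
    fix i j assume ij: "i < dim_row N" "j < dim_col N"
    let ?R = "{r. r < ?m \<and> \<phi> r = i}" and ?C = "{c. c < ?n \<and> \<psi> c = j}"
    let ?f = "\<lambda>c. restrict (\<lambda>r. M $$ (r, c)) ?R"
    \<comment> \<open>One column is chosen for each distinct restriction to the row part.\<close>
    obtain W where W: "W \<subseteq> ?C" "inj_on ?f W" "?f ` ?C = ?f ` W"
      using subset_image_inj[of "?f ` ?C" ?f ?C] by auto
    have "dim_row N * CARD('a) ^ dim_col N \<le> p * CARD('a) ^ p"
      using N q by (intro mult_le_mono power_increasing) auto
    also have "\<dots> < Q" by (rule Q(2))
    also have "Q \<le> card (?f ` W)" using cell[OF ij] unfolding complex_zone_def W(3) .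
    also have "\<dots> = card W" by (rule card_image[OF W(2)])
    finally have "dim_row N * CARD('a) ^ dim_col N < card W" .
    moreover have "l = l'" if l: "l \<in> W" "l' \<in> W" "\<forall>k. k < ?m \<and> \<phi> k = i \<longrightarrow> M $$ (k, l) = M $$ (k, l')" for l l'
    proof (rule inj_onD[OF W(2) _ l(1,2)])
      show "?f l = ?f l'" by (rule restrict_ext) (use l(3) in simp)
    qed
    ultimately show "\<exists>W\<subseteq>?C. dim_row N * CARD('a) ^ dim_col N < card W \<and>
      (\<forall>l\<in>W. \<forall>l'\<in>W. (\<forall>k. k < ?m \<and> \<phi> k = i \<longrightarrow> M $$ (k, l) = M $$ (k, l')) \<longrightarrow> l = l')"
      using W(1) by (intro exI[of _ W] conjI ballI impI)
  qed
  then obtain u v where uv: "\<forall>i<dim_row N. \<forall>j<dim_col N.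
    (\<Sum>k<?m. \<Sum>l<?n. if \<phi> k = i \<and> \<psi> l = j then u k * v l * M $$ (k, l) else 0) = N $$ (i, j)" by (elim exE)
  have "bilinear_contraction (dim_row N) (dim_col N) \<phi> \<psi> u v M = N"
    by (rule eq_matI) (use uv in \<open>simp_all add: bilinear_contraction_def\<close>)
  then show "linear_minor N M"
    using linear_minor_bilinear_contraction[OF phi(1) psi(1) other_row other_col, of u v] by simp
qed

text \<open>A matrix without entries is determined by its dimensions. Being in the class, it is a
  linear minor of a member, namely itself.\<close>

lemma empty_submatrix_in_class:
  assumes "matrix_class \<M>" "M \<in> \<M>" "dim_row N \<le> dim_row M" "dim_col N \<le> dim_col M" "dim_row N = 0 \<or> dim_col N = 0"
  shows "N \<in> \<M>"
proof -
  have "{i. i < dim_row M \<and> i \<in> {..<dim_row N}} = {..<dim_row N}" "{i. i < dim_col M \<and> i \<in> {..<dim_col N}} = {..<dim_col N}"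
    using assms(3,4) by auto
  then have "submatrix M {..<dim_row N} {..<dim_col N} = N"
    using assms(5) by (intro eq_matI) (auto simp: dim_submatrix)
  then show ?thesis using assms(1,2) unfolding matrix_class_def by metis
qed

theorem theorem1:
  fixes \<M> :: "'a::{field, finite} mat set"
  assumes "matrix_class \<M>"
  shows "bounded_twin_width \<M> \<longleftrightarrow> (\<exists>N :: 'a mat. \<forall>M\<in>\<M>. \<not> linear_minor N M)"
proof
  assume "bounded_twin_width \<M>"
  then obtain d where "\<forall>M\<in>\<M>. twin_width (matrix_structure M) \<le> d"
    unfolding bounded_twin_width_def by (elim exE)
  then show "\<exists>N :: 'a mat. \<forall>M\<in>\<M>. \<not> linear_minor N M"
    using twin_width_excludes_linear_minor by blast
next
  assume "\<exists>N :: 'a mat. \<forall>M\<in>\<M>. \<not> linear_minor N M"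
  then obtain N :: "'a mat" where N: "\<forall>M\<in>\<M>. \<not> linear_minor N M" by (elim exE)
  \<comment> \<open>The successor keeps p positive even if \<open>N\<close> is empty.\<close>
  define p where "p = Suc (max (dim_row N) (dim_col N))"
  define Q where "Q = Suc (CARD('a) + p * CARD('a) ^ p)"
  have Q: "CARD('a) < Q" "p * CARD('a) ^ p < Q" by (simp_all add: Q_def)
  have q: "2 \<le> CARD('a)" using card_mono[of "UNIV :: 'a set" "{0, 1}"] by simp
  have p: "0 < p" "dim_row N \<le> p" "dim_col N \<le> p" by (simp_all add: p_def)
  obtain d where d: "\<forall>M :: 'a mat. twin_width (matrix_structure M) \<le> d \<or>
    (\<exists>\<rho> s \<gamma> t. division M \<rho> s \<gamma> t \<and> zone_grid p (complex_zone Q M) (dim_row M) \<rho> (dim_col M) \<gamma>)"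
    using twin_width_le_or_zone_grid[OF Q(1) q, of p] by (elim exE)
  have "twin_width (matrix_structure M) \<le> d" if M: "M \<in> \<M>" for M
  proof (rule ccontr)
    assume "\<not> ?thesis"
    then obtain \<rho> s \<gamma> t where dg: "division M \<rho> s \<gamma> t" "zone_grid p (complex_zone Q M) (dim_row M) \<rho> (dim_col M) \<gamma>"
      using d[rule_format, of M] by (elim disjE exE conjE) simp_all
    note minor = zone_grid_imp_linear_minor[OF dg Q q p(1)]
    show False
    proof (cases "dim_row N = 0 \<or> dim_col N = 0")
      case True
      have "N \<in> \<M>"
        by (rule empty_submatrix_in_class[OF assms M _ _ True]) (use minor(1,2) p in auto)
      then show False using N by (auto simp: linear_minor_def)
    next
      case False
      then show False using minor(3)[of N] p N M by auto
    qed
  qed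
  then show "bounded_twin_width \<M>" unfolding bounded_twin_width_def by blast
qed

end
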